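(* Any flat rank 2 distribution with growth vector $(2,1,2,\dots)$ (whether it is represented by a nondegenerate single Monge equation or by an underdetermined system of ODEs) is, locally, the result of successive integrable extensions of the Hilbert--Cartan equation $y'=(z'')^2$.
   Context: All considerations are local. For a distribution $\Delta\subset TM$ the weak derived flag is defined by $\Delta_1=\Delta$, $\Gamma(\Delta_{i+1})=[\Gamma(\Delta),\Gamma(\Delta_i)]$; it is assumed that all $\Delta_i$ have constant rank and that $\Delta$ is completely non-holonomic, i.e. $\Delta_s=TM$ for some $s$. The Carnot algebra of $\Delta$ at $x\in M$ is the graded nilpotent Lie algebra $\mathfrak{m}(x)=\bigoplus_{i<0}g_i$, $g_{-1}=\Delta_x$, $g_{-i}=(\Delta_i/\Delta_{i-1})_x$, with bracket induced by the commutator of vector fields. The growth vector is $(\dim g_{-1},\dim g_{-2},\dots)$. The distribution is flat if its Carnot algebra is (up to isomorphism) a fixed $\mathfrak{m}$ at all points and $(M,\Delta)$ is locally diffeomorphic to the simply connected nilpotent Lie group with Lie algebra $\mathfrak{m}$ equipped with the left-invariant distribution determined by $g_{-1}\subset\mathfrak{m}$. The Hilbert--Cartan equation is identified with the rank 2 distribution on $\mathbb{R}^5(x,y,z,z_1,z_2)$ spanned by $\partial_x+z_2^2\,\partial_y+z_1\,\partial_z+z_2\,\partial_{z_1}$ and $\partial_{z_2}$ (growth vector $(2,1,2)$). An integrable extension of $(M,\Delta)$ is a submersion $\pi:(\tilde M,\tilde\Delta)\to(M,\Delta)$ such that (i) $d_x\pi:\tilde\Delta_x\to\Delta_{\pi(x)}$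 is an isomorphism for all $x\in\tilde M$, and (ii) $\tilde\Delta_2\cap\operatorname{Ker}d\pi=0$. "Result of successive integrable extensions" means: there is a finite (possibly empty) chain of integrable extensions $(M_r,\Delta_r)\to\cdots\to(M_1,\Delta_1)\to(M_0,\Delta_0)$ starting from the Hilbert--Cartan equation $(M_0,\Delta_0)$ and with $(M_r,\Delta_r)$ locally equivalent to the given distribution (the subscripts here number the members of the chain). *)

theory Defs
  imports "HOL-Analysis.Analysis" "HOL-Algebra.Group" "HOL-Library.Function_Algebras"
begin

text \<open>
  The dimension of the manifold varies along a chain of extensions, so it cannot be a type.
  Points and tangent vectors of \<open>\<real>\<^sup>n\<close> are sequences that vanish from index \<open>n\<close> on, i.e. elements of
  \<^term>\<open>topspace (Euclidean_space n)\<close>. All considerations being local, manifolds are open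
  subsets of \<^term>\<open>Euclidean_space n\<close>.
\<close>

type_synonym pt = "nat \<Rightarrow> real"

abbreviation space_R :: "nat \<Rightarrow> pt set"
  where "space_R n \<equiv> topspace (Euclidean_space n)"

instantiation "fun" :: (type, real_vector) real_vector
begin

definition scaleR_fun :: "real \<Rightarrow> ('a \<Rightarrow> 'b) \<Rightarrow> 'a \<Rightarrow> 'b"
  where "scaleR_fun c f = (\<lambda>i. c *\<^sub>R f i)"

instance
  by standard (auto simp: scaleR_fun_def fun_eq_iff scaleR_add_right scaleR_add_left)

end


section \<open>Calculus on open subsets of Euclidean space\<close>

definition partial :: "nat \<Rightarrow> (pt \<Rightarrow> real) \<Rightarrow> pt \<Rightarrow> real"
  where "partial j f x = deriv (\<lambda>t. f (x(j := t))) (x j)"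

text \<open>
  Class \<open>C\<^sup>\<infinity>\<close>: all iterated partial derivatives exist and are continuous. The topology of the
  type \<^typ>\<open>pt\<close> is the product topology, which induces that of \<^term>\<open>Euclidean_space n\<close>.
\<close>

definition smooth :: "nat \<Rightarrow> pt set \<Rightarrow> (pt \<Rightarrow> real) \<Rightarrow> bool"
  where "smooth n U f \<longleftrightarrow>
    (\<forall>js. set js \<subseteq> {..<n} \<longrightarrow>
       continuous_on U (foldr partial js f) \<and>
       (\<forall>x\<in>U. \<forall>j<n. (\<lambda>t. foldr partial js f (x(j := t))) differentiable at (x j)))"

definition smooth_map :: "nat \<Rightarrow> pt set \<Rightarrow> nat \<Rightarrow> (pt \<Rightarrow> pt) \<Rightarrow> bool"
  where "smooth_map n U m F \<longleftrightarrow>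
    F ` U \<subseteq> space_R m \<and> (\<forall>i<m. smooth n U (\<lambda>x. F x i))"

definition differential :: "nat \<Rightarrow> (pt \<Rightarrow> pt) \<Rightarrow> pt \<Rightarrow> pt \<Rightarrow> pt"
  where "differential n F x v = (\<lambda>i. \<Sum>j<n. partial j (\<lambda>y. F y i) x * v j)"

definition diffeomorphism :: "nat \<Rightarrow> pt set \<Rightarrow> nat \<Rightarrow> pt set \<Rightarrow> (pt \<Rightarrow> pt) \<Rightarrow> bool"
  where "diffeomorphism n V m W F \<longleftrightarrow>
    smooth_map n V m F \<and>
    (\<exists>F'. smooth_map m W n F' \<and> F ` V = W \<and> F' ` W = V \<and>
          (\<forall>x\<in>V. F' (F x) = x) \<and> (\<forall>y\<in>W. F (F' y) = y))"

definition submersion :: "nat \<Rightarrow> pt set \<Rightarrow> nat \<Rightarrow> pt set \<Rightarrow> (pt \<Rightarrow> pt) \<Rightarrow> bool"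
  where "submersion n U m W F \<longleftrightarrow>
    smooth_map n U m F \<and> F ` U \<subseteq> W \<and>
    (\<forall>x\<in>U. differential n F x ` space_R n = space_R m)"

definition lie_bracket :: "nat \<Rightarrow> (pt \<Rightarrow> pt) \<Rightarrow> (pt \<Rightarrow> pt) \<Rightarrow> pt \<Rightarrow> pt"
  where "lie_bracket n X Y x = differential n Y x (X x) - differential n X x (Y x)"


section \<open>Distributions and the weak derived flag\<close>

type_synonym dist = "pt \<Rightarrow> pt set"

text \<open>Sections of \<open>D\<close> over an open set \<open>V\<close>.\<close>

definition is_section :: "nat \<Rightarrow> dist \<Rightarrow> pt set \<Rightarrow> (pt \<Rightarrow> pt) \<Rightarrow> bool"
  where "is_section n D V X \<longleftrightarrow> smooth_map n V n X \<and> (\<forall>x\<in>V. X x \<in> D x)"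

definition subbundle :: "nat \<Rightarrow> nat \<Rightarrow> pt set \<Rightarrow> dist \<Rightarrow> bool"
  where "subbundle n k U D \<longleftrightarrow>
    (\<forall>p\<in>U. dim (D p) = k \<and>
       (\<exists>V X. openin (Euclidean_space n) V \<and> p \<in> V \<and> V \<subseteq> U \<and>
          (\<forall>i<k. smooth_map n V n (X i)) \<and>
          (\<forall>x\<in>V. D x = span ((\<lambda>i. X i x) ` {..<k}))))"

text \<open>
  The module \<open>[\<Gamma>(\<Delta>), \<Gamma>(\<Delta>\<^sub>i)]\<close> is generated by the brackets of local sections; the fibre of
  \<open>\<Delta>\<^bsub>i+1\<^esub>\<close> is spanned by their values. By the Leibniz rule it contains the fibre of \<open>\<Delta>\<^sub>i\<close> whenever
  \<open>\<Delta>\<close> has positive rank, so nothing needs to be added. The index \<open>0\<close> stands for the zero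
  subbundle.
\<close>

fun weak_flag :: "nat \<Rightarrow> pt set \<Rightarrow> dist \<Rightarrow> nat \<Rightarrow> dist"
  where
    "weak_flag n U D 0 = (\<lambda>x. {0})"
  | "weak_flag n U D (Suc 0) = D"
  | "weak_flag n U D (Suc (Suc i)) =
      (\<lambda>x. span {lie_bracket n X Y x | X Y V.
              openin (Euclidean_space n) V \<and> x \<in> V \<and> V \<subseteq> U \<and>
              is_section n D V X \<and> is_section n (weak_flag n U D (Suc i)) V Y})"

text \<open>Includes the standing assumptions: constant ranks, complete non-holonomy.\<close>

definition distribution :: "nat \<Rightarrow> nat \<Rightarrow> pt set \<Rightarrow> dist \<Rightarrow> bool"
  where "distribution n k U D \<longleftrightarrow>
    openin (Euclidean_space n) U \<and> subbundle n k U D \<and>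
    (\<forall>i. \<exists>r. \<forall>x\<in>U. dim (weak_flag n U D i x) = r) \<and>
    (\<exists>s\<ge>1. \<forall>x\<in>U. weak_flag n U D s x = space_R n)"

text \<open>\<open>dim g\<^bsub>-i\<^esub>\<close> at \<open>x\<close>, where \<open>g\<^bsub>-i\<^esub> = \<Delta>\<^sub>i / \<Delta>\<^bsub>i-1\<^esub>\<close>. Only \<open>i \<ge> 1\<close> is meaningful.\<close>

definition growth :: "nat \<Rightarrow> pt set \<Rightarrow> dist \<Rightarrow> pt \<Rightarrow> nat \<Rightarrow> nat"
  where "growth n U D x i = dim (weak_flag n U D i x) - dim (weak_flag n U D (i - 1) x)"

definition locally_equivalent ::
    "nat \<Rightarrow> pt set \<Rightarrow> dist \<Rightarrow> nat \<Rightarrow> pt set \<Rightarrow> dist \<Rightarrow> bool"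
  where "locally_equivalent n U D m W E \<longleftrightarrow>
    (\<forall>p\<in>U. \<exists>V V' F. openin (Euclidean_space n) V \<and> p \<in> V \<and> V \<subseteq> U \<and>
       openin (Euclidean_space m) V' \<and> V' \<subseteq> W \<and> diffeomorphism n V m V' F \<and>
       (\<forall>x\<in>V. differential n F x ` D x = E (F x)))"


section \<open>The Carnot algebra at a point\<close>

text \<open>
  Elements of \<open>g\<^bsub>-i\<^esub> = (\<Delta>\<^sub>i / \<Delta>\<^bsub>i-1\<^esub>)\<^sub>x\<close> for \<open>i \<ge> 1\<close> are cosets. The bracket of the classes of \<open>X x\<close> and \<open>Y x\<close>,
  for local sections \<open>X\<close> of \<open>\<Delta>\<^sub>i\<close> and \<open>Y\<close> of \<open>\<Delta>\<^sub>j\<close>, is the class of \<open>[X, Y] x\<close>.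
\<close>

definition carnot_class :: "nat \<Rightarrow> pt set \<Rightarrow> dist \<Rightarrow> pt \<Rightarrow> nat \<Rightarrow> pt \<Rightarrow> pt set"
  where "carnot_class n U D x i v = (\<lambda>w. v + w) ` weak_flag n U D (i - 1) x"

definition carnot_space :: "nat \<Rightarrow> pt set \<Rightarrow> dist \<Rightarrow> pt \<Rightarrow> nat \<Rightarrow> pt set set"
  where "carnot_space n U D x i = carnot_class n U D x i ` weak_flag n U D i x"

definition carnot_bracket ::
    "nat \<Rightarrow> pt set \<Rightarrow> dist \<Rightarrow> pt \<Rightarrow> nat \<Rightarrow> nat \<Rightarrow> pt set \<Rightarrow> pt set \<Rightarrow> pt set"
  where "carnot_bracket n U D x i j A B =
    (THE C. \<exists>V X Y. openin (Euclidean_space n) V \<and> x \<in> V \<and> V \<subseteq> U \<and>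
       is_section n (weak_flag n U D i) V X \<and> is_section n (weak_flag n U D j) V Y \<and>
       X x \<in> A \<and> Y x \<in> B \<and> C = carnot_class n U D x (i + j) (lie_bracket n X Y x))"

text \<open>
  A Lie algebra structure on the vector space \<open>\<real>\<^sup>n\<close>. Being bilinear on the whole type is no
  restriction, as only the values on \<open>\<real>\<^sup>n\<close> matter.
\<close>

definition lie_algebra :: "nat \<Rightarrow> (pt \<Rightarrow> pt \<Rightarrow> pt) \<Rightarrow> bool"
  where "lie_algebra n b \<longleftrightarrow>
    bilinear b \<and>
    (\<forall>u\<in>space_R n. \<forall>v\<in>space_R n. b u v \<in> space_R n) \<and>
    (\<forall>u\<in>space_R n. b u u = 0) \<and>
    (\<forall>u\<in>space_R n. \<forall>v\<in>space_R n. \<forall>w\<in>space_R n.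
       b u (b v w) + b v (b w u) + b w (b u v) = 0)"

text \<open>
  Here \<open>g i\<close> is the component of degree \<open>-i\<close>. Finitely many negative degrees make the algebra
  nilpotent.
\<close>

definition graded_nilpotent_lie_algebra ::
    "nat \<Rightarrow> (pt \<Rightarrow> pt \<Rightarrow> pt) \<Rightarrow> (nat \<Rightarrow> pt set) \<Rightarrow> bool"
  where "graded_nilpotent_lie_algebra n b g \<longleftrightarrow>
    lie_algebra n b \<and>
    g 0 = {0} \<and> (\<forall>i. subspace (g i) \<and> g i \<subseteq> space_R n) \<and>
    (\<forall>i j. \<forall>u\<in>g i. \<forall>v\<in>g j. b u v \<in> g (i + j)) \<and>
    (\<exists>s. (\<forall>i>s. g i = {0}) \<and>
         (\<forall>v\<in>space_R n. \<exists>!u. (\<forall>i. u i \<in> g i) \<and> v = (\<Sum>i\<le>s. u i)))"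

definition carnot_algebra_iso ::
    "nat \<Rightarrow> pt set \<Rightarrow> dist \<Rightarrow> pt \<Rightarrow> (pt \<Rightarrow> pt \<Rightarrow> pt) \<Rightarrow> (nat \<Rightarrow> pt set) \<Rightarrow> bool"
  where "carnot_algebra_iso n U D x b g \<longleftrightarrow>
    (\<exists>\<phi>. (\<forall>i\<ge>1. bij_betw (\<phi> i) (carnot_space n U D x i) (g i)) \<and>
         (\<forall>i\<ge>1. \<forall>u\<in>weak_flag n U D i x. \<forall>v\<in>weak_flag n U D i x. \<forall>c d.
            \<phi> i (carnot_class n U D x i (c *\<^sub>R u + d *\<^sub>R v)) =
              c *\<^sub>R \<phi> i (carnot_class n U D x i u) + d *\<^sub>R \<phi> i (carnot_class n U D x i v)) \<and>
         (\<forall>i\<ge>1. \<forall>j\<ge>1. \<forall>A\<in>carnot_space n U D x i. \<forall>B\<in>carnot_space n U D x j.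
            \<phi> (i + j) (carnot_bracket n U D x i j A B) = b (\<phi> i A) (\<phi> j B)))"


section \<open>Lie groups and flat distributions\<close>

text \<open>
  A simply connected nilpotent Lie group is diffeomorphic to \<open>\<real>\<^sup>n\<close>, and \<open>\<real>\<^sup>n\<close> is simply connected.
  It is therefore given by a smooth group structure on \<open>\<real>\<^sup>n\<close>. Pairs in \<open>\<real>\<^sup>n \<times> \<real>\<^sup>n\<close> are encoded as
  points of \<open>\<real>\<^bsup>2n\<^esup>\<close> to express smoothness of the multiplication.
\<close>

definition fst_half :: "nat \<Rightarrow> pt \<Rightarrow> pt"
  where "fst_half n z = (\<lambda>i. if i < n then z i else 0)"

definition snd_half :: "nat \<Rightarrow> pt \<Rightarrow> pt"
  where "snd_half n z = (\<lambda>i. if i < n then z (n + i) else 0)"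

definition lie_group :: "nat \<Rightarrow> pt monoid \<Rightarrow> bool"
  where "lie_group n G \<longleftrightarrow>
    group G \<and> carrier G = space_R n \<and>
    smooth_map (2 * n) (space_R (2 * n)) n (\<lambda>z. fst_half n z \<otimes>\<^bsub>G\<^esub> snd_half n z) \<and>
    smooth_map n (space_R n) n (\<lambda>x. inv\<^bsub>G\<^esub> x)"

text \<open>The left-invariant vector field with value \<open>v\<close> at the identity.\<close>

definition left_field :: "nat \<Rightarrow> pt monoid \<Rightarrow> pt \<Rightarrow> pt \<Rightarrow> pt"
  where "left_field n G v x = differential n (\<lambda>y. x \<otimes>\<^bsub>G\<^esub> y) \<one>\<^bsub>G\<^esub> v"

text \<open>
  \<open>\<iota>\<close> identifies the Lie algebra \<open>b\<close> with that of \<open>G\<close>, i.e. the tangent space at the identity with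
  the bracket of left-invariant vector fields.
\<close>

definition lie_algebra_of_group :: "nat \<Rightarrow> pt monoid \<Rightarrow> (pt \<Rightarrow> pt \<Rightarrow> pt) \<Rightarrow> (pt \<Rightarrow> pt) \<Rightarrow> bool"
  where "lie_algebra_of_group n G b \<iota> \<longleftrightarrow>
    linear \<iota> \<and> bij_betw \<iota> (space_R n) (space_R n) \<and>
    (\<forall>u\<in>space_R n. \<forall>v\<in>space_R n.
       \<iota> (b u v) = lie_bracket n (left_field n G (\<iota> u)) (left_field n G (\<iota> v)) \<one>\<^bsub>G\<^esub>)"

definition left_distribution :: "nat \<Rightarrow> pt monoid \<Rightarrow> pt set \<Rightarrow> dist"
  where "left_distribution n G H x = (\<lambda>v. left_field n G v x) ` H"

definition flat :: "nat \<Rightarrow> pt set \<Rightarrow> dist \<Rightarrow> bool"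
  where "flat n U D \<longleftrightarrow>
    (\<exists>b g. graded_nilpotent_lie_algebra n b g \<and>
       (\<forall>x\<in>U. carnot_algebra_iso n U D x b g) \<and>
       (\<exists>G \<iota>. lie_group n G \<and> lie_algebra_of_group n G b \<iota> \<and>
          locally_equivalent n U D n (space_R n) (left_distribution n G (\<iota> ` g 1))))"


section \<open>Integrable extensions of the Hilbert--Cartan equation\<close>

definition integrable_extension ::
    "nat \<Rightarrow> pt set \<Rightarrow> dist \<Rightarrow> nat \<Rightarrow> pt set \<Rightarrow> dist \<Rightarrow> (pt \<Rightarrow> pt) \<Rightarrow> bool"
  where "integrable_extension n' U' D' n U D \<pi> \<longleftrightarrow>
    (\<exists>k'. distribution n' k' U' D') \<and> (\<exists>k. distribution n k U D) \<and>
    submersion n' U' n U \<pi> \<and>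
    (\<forall>x\<in>U'. bij_betw (differential n' \<pi> x) (D' x) (D (\<pi> x))) \<and>
    (\<forall>x\<in>U'. weak_flag n' U' D' 2 x \<inter> {v \<in> space_R n'. differential n' \<pi> x v = 0} = {0})"

definition coord_vec :: "nat \<Rightarrow> pt"
  where "coord_vec i = (\<lambda>j. if j = i then 1 else 0)"

text \<open>The coordinates \<open>x, y, z, z\<^sub>1, z\<^sub>2\<close> have the indices \<open>0, 1, 2, 3, 4\<close>.\<close>

definition hilbert_cartan :: dist
  where "hilbert_cartan q =
    span {coord_vec 0 + (q 4)\<^sup>2 *\<^sub>R coord_vec 1 + q 3 *\<^sub>R coord_vec 2 + q 4 *\<^sub>R coord_vec 3,
          coord_vec 4}"

inductive successive_extension :: "nat \<Rightarrow> pt set \<Rightarrow> dist \<Rightarrow> bool"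
  where
    base: "successive_extension 5 (space_R 5) hilbert_cartan"
  | step: "successive_extension n U D \<Longrightarrow> integrable_extension n' U' D' n U D \<pi> \<Longrightarrow>
      successive_extension n' U' D'"

end

theory Submission
  imports Defs
begin

text \<open>
  One integrable extension suffices. Let \<open>\<mm> = g\<^sub>1 \<oplus> g\<^sub>2 \<oplus> \<dots>\<close> be the graded algebra of the flat model \<open>G\<close>. It is
  generated by \<open>g\<^sub>1\<close> because the distribution is completely non-holonomic, and since its growth begins
  with \<open>(2, 1, 2)\<close>, the quotient by the ideal \<open>g\<^sub>4 \<oplus> g\<^sub>5 \<oplus> \<dots>\<close> is the free 3-step nilpotent algebra on two generators.
  The Hilbert--Cartan distribution carries a frame with exactly these structure constants. The
  projection of algebras is integrated to a map \<open>\<pi> : G \<rightarrow> \<real>\<^sup>5\<close> relating the two frames: by the Poincare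
  lemma, its components are primitives of successive closed 1-forms. Then \<open>d\<pi>\<close> is injective on the second
  step of the flag, as its kernel consists of left translates of \<open>g\<^sub>4 \<oplus> g\<^sub>5 \<oplus> \<dots>\<close>.
\<close>

text \<open>The dimension is a number and not a type, so points lie in
  \<open>nat \<Rightarrow> real\<close>, whose product topology is not given by a norm; the
  multivariable calculus is therefore built from one-variable derivatives. Of the group
  \<open>G\<close> only a frame with constant structure coefficients is used, and the
  Hilbert--Cartan distribution is treated through the same notion, so the target needs no group
  structure. Over such a frame the weak derived flag becomes a purely algebraic flag, and the
  dimensions at a single point decide all ranks. The equations for \<open>\<pi>\<close> can be
  solved one after another because the coefficients of the Hilbert--Cartan frame depend on
  \<open>z_1\<close> and \<open>z_2\<close> only; each form is closed because the projection of
  algebras preserves brackets. Primitives exist globally since \<open>G\<close> is all of R^n. The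
  total space of the extension is thus the whole group, and small neighbourhoods matter only when
  the given distribution is compared with the model.\<close>

section \<open>Partial derivatives and smooth functions\<close>

lemma space_R_iff: "x \<in> space_R n \<longleftrightarrow> (\<forall>i\<ge>n. x i = 0)"
  by (simp add: topspace_Euclidean_space)

lemma openin_Euclidean_space_iff:
  "openin (Euclidean_space n) U \<longleftrightarrow> (\<exists>T. open T \<and> U = T \<inter> space_R n)"
  by (auto simp: Euclidean_space_def openin_subtopology euclidean_product_topology)

lemma openin_Euclidean_spaceD: "openin (Euclidean_space n) U \<Longrightarrow> x \<in> U \<Longrightarrow> x \<in> space_R n"
  using openin_subset by blast

lemma fun_upd_in_space_R: "x \<in> space_R n \<Longrightarrow> j < n \<Longrightarrow> x(j := t) \<in> space_R n"
  by (auto simp: space_R_iff)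

text \<open>Two points of \<open>space_R n\<close> differ at most in the first \<open>n\<close>
  coordinates, so only finitely many factors of a basic open set matter and their radii have a
  positive minimum. These boxes take the place of balls in the epsilon arguments below.\<close>

lemma continuous_neighbourhood_box:
  assumes U: "openin (Euclidean_space n) U" and f: "continuous_on U f"
    and x: "x \<in> U" and e: "e > (0::real)"
  shows "\<exists>d>0. \<forall>y\<in>space_R n. (\<forall>i<n. \<bar>y i - x i\<bar> < d) \<longrightarrow> y \<in> U \<and> \<bar>f y - f x\<bar> < e"
proof -
  obtain T where T: "open T" "U = T \<inter> space_R n"
    using U openin_Euclidean_space_iff by blast
  obtain T' where T': "open T'" "f -` ball (f x) e \<inter> U = T' \<inter> U"
    using f unfolding continuous_on_open_invariant by (metis open_ball)
  have "open (T \<inter> T')" using T T' by auto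
  moreover have "x \<in> T \<inter> T'"
  proof -
    have "x \<in> f -` ball (f x) e \<inter> U" using x e by auto
    then have "x \<in> T' \<inter> U" using T'(2) by simp
    then show ?thesis using T by auto
  qed
  ultimately obtain X where X: "x \<in> Pi\<^sub>E UNIV X" "\<And>i. open (X i)" "Pi\<^sub>E UNIV X \<subseteq> T \<inter> T'"
    using product_topology_open_contains_basis[of "\<lambda>_. euclidean" UNIV "T \<inter> T'" x]
    by (auto simp: open_fun_def)
  have "\<forall>i. \<exists>d>0. ball (x i) d \<subseteq> X i"
    using X(1,2) by (metis PiE_mem UNIV_I openE)
  then obtain d where d: "\<And>i. d i > 0" "\<And>i. ball (x i) (d i) \<subseteq> X i" by metis
  \<comment> \<open>The \<open>1\<close> keeps the set nonempty when \<open>n = 0\<close>.\<close>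
  define D where "D = Min (insert 1 (d ` {..<n}))"
  have D: "D > 0" "\<And>i. i < n \<Longrightarrow> D \<le> d i"
    using d by (auto simp: D_def)
  show ?thesis
  proof (intro exI conjI ballI impI)
    show "D > 0" by fact
    fix y assume y: "y \<in> space_R n" "\<forall>i<n. \<bar>y i - x i\<bar> < D"
    have "y i \<in> X i" for i
    proof (cases "i < n")
      case True
      then have "y i \<in> ball (x i) (d i)"
        using y D(2)[of i] by (auto simp: dist_real_def abs_minus_commute)
      then show ?thesis using d by blast
    next
      case False
      then have "y i = x i" using y(1) x T(2) by (auto simp: space_R_iff)
      then show ?thesis using X(1) by auto
    qed
    then have "y \<in> T \<inter> T'" using X(3) by auto
    then have yU: "y \<in> U" and "y \<in> T'" using T y by auto
    then have "y \<in> f -` ball (f x) e \<inter> U" using T' by auto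
    then show "y \<in> U" "\<bar>f y - f x\<bar> < e"
      using yU by (auto simp: dist_real_def abs_minus_commute)
  qed
qed

lemma eventually_curve_in_open:
  assumes U: "openin (Euclidean_space n) U" and x: "x \<in> U"
    and c: "\<And>i. i < n \<Longrightarrow> ((\<lambda>t. c t i) \<longlongrightarrow> x i) F" and s: "eventually (\<lambda>t. c t \<in> space_R n) F"
  shows "eventually (\<lambda>t. c t \<in> U) F"
proof -
  obtain d where d: "d > 0" "\<And>y. y \<in> space_R n \<Longrightarrow> (\<forall>i<n. \<bar>y i - x i\<bar> < d) \<Longrightarrow> y \<in> U"
    using continuous_neighbourhood_box[OF U continuous_on_const x, of 1 "0"] by auto
  have "eventually (\<lambda>t. \<forall>i\<in>{..<n}. \<bar>c t i - x i\<bar> < d) F"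
    using c d(1) by (intro eventually_ball_finite) (auto simp: tendsto_iff dist_real_def)
  with s show ?thesis
    by eventually_elim (use d(2) in auto)
qed

lemma eventually_fun_upd_in_open:
  assumes U: "openin (Euclidean_space n) U" and x: "x \<in> U" and j: "j < n"
  shows "eventually (\<lambda>t. x(j := t) \<in> U) (nhds (x j))"
proof (rule eventually_curve_in_open[OF U x])
  show "((\<lambda>t. (x(j := t)) i) \<longlongrightarrow> x i) (nhds (x j))" for i
    by (cases "i = j") (auto simp: filterlim_ident)
  show "\<forall>\<^sub>F t in nhds (x j). x(j := t) \<in> space_R n"
    using fun_upd_in_space_R[OF openin_Euclidean_spaceD[OF U x] j] by simp
qed

lemma partial_cong:
  assumes "openin (Euclidean_space n) U" "\<And>y. y \<in> U \<Longrightarrow> f y = g y" "x \<in> U" "j < n"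
  shows "partial j f x = partial j g x"
  unfolding partial_def
  by (rule deriv_cong_ev) (use eventually_fun_upd_in_open[OF assms(1,3,4)] assms in \<open>auto elim: eventually_mono\<close>)

section \<open>Smoothness as a coinductive property\<close>

definition has_partials :: "nat \<Rightarrow> pt set \<Rightarrow> (pt \<Rightarrow> real) \<Rightarrow> bool"
  where "has_partials n U f \<longleftrightarrow> continuous_on U f \<and>
    (\<forall>x\<in>U. \<forall>j<n. (\<lambda>t. f (x(j := t))) differentiable at (x j))"

lemma has_partialsD:
  assumes "has_partials n U f" "x \<in> U" "j < n"
  shows "((\<lambda>t. f (x(j := t))) has_real_derivative partial j f x) (at (x j))"
  using assms by (auto simp: has_partials_def partial_def DERIV_deriv_iff_real_differentiable)

lemma has_partials_cong:
  assumes "openin (Euclidean_space n) U" "\<And>y. y \<in> U \<Longrightarrow> f y = g y" "has_partials n U f"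
  shows "has_partials n U g"
  unfolding has_partials_def
proof (intro conjI ballI allI impI)
  show "continuous_on U g"
    using assms continuous_on_cong[of U U f g] by (auto simp: has_partials_def)
  fix x j assume x: "x \<in> U" "j < n"
  have "\<forall>\<^sub>F t in nhds (x j). f (x(j := t)) = g (x(j := t))"
    using eventually_fun_upd_in_open[OF assms(1) x] by eventually_elim (use assms in auto)
  from DERIV_cong_ev[OF refl this refl] has_partialsD[OF assms(3) x]
  show "(\<lambda>t. g (x(j := t))) differentiable at (x j)"
    by (auto simp: real_differentiable_def)
qed

lemma smooth_iff_foldr: "smooth n U f \<longleftrightarrow> (\<forall>js. set js \<subseteq> {..<n} \<longrightarrow> has_partials n U (foldr partial js f))"
  by (simp add: smooth_def has_partials_def)

lemma smooth_has_partials: "smooth n U f \<Longrightarrow> has_partials n U f"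
  unfolding smooth_iff_foldr by (erule allE[of _ "[]"]) auto

lemma smooth_partial: "smooth n U f \<Longrightarrow> j < n \<Longrightarrow> smooth n U (partial j f)"
  unfolding smooth_iff_foldr
proof (intro allI impI)
  fix js assume a: "\<forall>js. set js \<subseteq> {..<n} \<longrightarrow> has_partials n U (foldr partial js f)" "j < n" "set js \<subseteq> {..<n}"
  show "has_partials n U (foldr partial js (partial j f))"
    using a(1)[rule_format, of "js @ [j]"] a(2,3) by auto
qed

lemma smooth_continuous: "smooth n U f \<Longrightarrow> continuous_on U f"
  using smooth_has_partials has_partials_def by blast

text \<open>\<open>smooth\<close> is the largest class whose members satisfy
  \<open>has_partials\<close> and whose partial derivatives stay in the class, so any class
  \<open>P\<close> closed in this sense consists of smooth functions. Partials need to agree with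
  members of \<open>P\<close> on \<open>U\<close> only, since at points of an open set they see only
  the values there (\<open>partial_cong\<close>).\<close>

lemma smooth_coinduct [consumes 2, case_names smooth]:
  assumes U: "openin (Euclidean_space n) U" and P: "P f"
    and step: "\<And>f. P f \<Longrightarrow> has_partials n U f \<and> (\<forall>j<n. \<exists>g. P g \<and> (\<forall>x\<in>U. partial j f x = g x))"
  shows "smooth n U f"
  unfolding smooth_iff_foldr
proof (intro allI impI)
  fix js assume "set js \<subseteq> {..<n}"
  then have "\<exists>g. P g \<and> (\<forall>x\<in>U. foldr partial js f x = g x)"
  proof (induction js)
    case Nil
    then show ?case using P by auto
  next
    case (Cons j js)
    then obtain g where g: "P g" "\<forall>x\<in>U. foldr partial js f x = g x" by auto
    then obtain h where "P h" "\<forall>x\<in>U. partial j g x = h x" using step[OF g(1)] Cons.prems by auto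
    moreover have "partial j (foldr partial js f) x = partial j g x" if "x \<in> U" for x
      using partial_cong[OF U _ that, of "foldr partial js f" g j] g Cons.prems by auto
    ultimately show ?case by auto
  qed
  then obtain g where "P g" "\<forall>x\<in>U. foldr partial js f x = g x" by auto
  then show "has_partials n U (foldr partial js f)"
    using has_partials_cong[OF U, of g] step by auto
qed

lemma smooth_cong:
  assumes "openin (Euclidean_space n) U" "\<And>y. y \<in> U \<Longrightarrow> f y = g y" "smooth n U f"
  shows "smooth n U g"
proof (rule smooth_coinduct[OF assms(1), where P="\<lambda>g. \<exists>f. smooth n U f \<and> (\<forall>y\<in>U. f y = g y)"])
  show "\<exists>f. smooth n U f \<and> (\<forall>y\<in>U. f y = g y)" using assms by auto
next
  fix g assume "\<exists>f. smooth n U f \<and> (\<forall>y\<in>U. f y = g y)"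
  then obtain f where f: "smooth n U f" "\<And>y. y \<in> U \<Longrightarrow> f y = g y" by auto
  have "\<exists>h. (\<exists>f. smooth n U f \<and> (\<forall>y\<in>U. f y = h y)) \<and> (\<forall>x\<in>U. partial j g x = h x)" if "j < n" for j
    using partial_cong[OF assms(1) f(2) _ that] smooth_partial[OF f(1) that]
    by (intro exI[of _ "partial j f"]) auto
  then show "has_partials n U g \<and> (\<forall>j<n. \<exists>h. (\<exists>f. smooth n U f \<and> (\<forall>y\<in>U. f y = h y)) \<and> (\<forall>x\<in>U. partial j g x = h x))"
    using has_partials_cong[OF assms(1) f(2) smooth_has_partials[OF f(1)]] by blast
qed

lemma has_partials_subset: "has_partials n U f \<Longrightarrow> V \<subseteq> U \<Longrightarrow> has_partials n V f"
  by (auto simp: has_partials_def intro: continuous_on_subset)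

lemma smooth_subset: "smooth n U f \<Longrightarrow> V \<subseteq> U \<Longrightarrow> smooth n V f"
  unfolding smooth_iff_foldr using has_partials_subset by blast

text \<open>The coordinates of \<open>c t0\<close> are replaced by those of \<open>c t\<close> one
  at a time. By the mean value theorem each replacement changes \<open>f\<close> by a partial
  derivative at an intermediate point times the increment of one coordinate, and continuity of the
  partials identifies the limit. No total derivative is involved.\<close>

lemma chain_rule_curve:
  assumes U: "openin (Euclidean_space n) U" and f: "has_partials n U f"
    and cp: "\<And>j. j < n \<Longrightarrow> continuous_on U (partial j f)"
    and c0: "c t0 \<in> U" and cs: "\<forall>\<^sub>F t in nhds t0. c t \<in> space_R n"
    and cd: "\<And>i. i < n \<Longrightarrow> ((\<lambda>t. c t i) has_real_derivative c' i) (at t0)"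
  shows "((\<lambda>t. f (c t)) has_real_derivative (\<Sum>j<n. partial j f (c t0) * c' j)) (at t0)"
proof -
  define g where "g k t = (\<lambda>i. if i < k then c t i else c t0 i)" for k t
  have c0n: "\<And>i. i \<ge> n \<Longrightarrow> c t0 i = 0"
    using openin_Euclidean_spaceD[OF U c0] by (auto simp: space_R_iff)
  have ci: "((\<lambda>t. c t i) \<longlongrightarrow> c t0 i) (nhds t0)" if "i < n" for i
    using DERIV_isCont[OF cd[OF that]] tendsto_at_iff_tendsto_nhds[of "\<lambda>t. c t i" t0] by (simp add: isCont_def)
  have "k \<le> n \<Longrightarrow> ((\<lambda>t. f (g k t)) has_real_derivative (\<Sum>j<k. partial j f (c t0) * c' j)) (at t0)" for k
  proof (induction k)
    case 0
    have "f (g 0 t) = f (c t0)" for t by (simp add: g_def)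
    then show ?case by simp
  next
    case (Suc k)
    then have kn: "k < n" by simp
    define L where "L = partial k f (c t0)"
    define h where "h t = f (g (Suc k) t) - f (g k t)" for t
    \<comment> \<open>The value \<open>L\<close> at zero increment makes
      \<open>h t = q t * (c t k - c t0 k)\<close> true for every \<open>t\<close>, also where the
      coordinate returns to its value at \<open>t0\<close>, and makes \<open>q\<close> continuous at
      \<open>t0\<close>.\<close>
    define q where "q t = (if c t k = c t0 k then L else h t / (c t k - c t0 k))" for t
    have gS: "g (Suc k) t = (g k t)(k := c t k)" for t by (auto simp: g_def less_Suc_eq)
    have gk: "g k t = (g k t)(k := c t0 k)" for t by (auto simp: g_def)
    have hq: "h t = q t * (c t k - c t0 k)" for t
    proof (cases "c t k = c t0 k")
      case True
      then have "g (Suc k) t = g k t" using gS[of t] gk[of t] by simp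
      then show ?thesis using True by (simp add: h_def)
    qed (simp add: q_def)
    have "(q \<longlongrightarrow> L) (nhds t0)"
      unfolding tendsto_iff dist_real_def
    proof (intro allI impI)
      fix e :: real assume e: "e > 0"
      obtain d where d: "d > 0" "\<And>y. y \<in> space_R n \<Longrightarrow> (\<forall>i<n. \<bar>y i - c t0 i\<bar> < d)
           \<Longrightarrow> y \<in> U \<and> \<bar>partial k f y - L\<bar> < e"
        using continuous_neighbourhood_box[OF U cp[OF kn] c0 e] unfolding L_def by auto
      have "eventually (\<lambda>t. \<forall>i\<in>{..<n}. \<bar>c t i - c t0 i\<bar> < d) (nhds t0)"
        using ci d(1) by (intro eventually_ball_finite) (auto simp: tendsto_iff dist_real_def)
      with cs show "\<forall>\<^sub>F t in nhds t0. \<bar>q t - L\<bar> < e"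
      proof eventually_elim
        case (elim t)
        have in_box: "(g k t)(k := s) \<in> U \<and> \<bar>partial k f ((g k t)(k := s)) - L\<bar> < e"
          if "\<bar>s - c t0 k\<bar> < d" for s
          by (rule d(2)) (use elim that d(1) kn c0n in \<open>auto simp: g_def space_R_iff\<close>)
        show ?case
        proof (cases "c t k = c t0 k")
          case True then show ?thesis using e by (simp add: q_def)
        next
          case False
          have der: "((\<lambda>s. f ((g k t)(k := s))) has_real_derivative partial k f ((g k t)(k := s))) (at s)"
            if "\<bar>s - c t0 k\<bar> < d" for s
            using has_partialsD[OF f, of "(g k t)(k := s)" k] in_box[OF that] kn by simp
          have seg: "\<bar>s - c t0 k\<bar> < d" if "s \<in> {min (c t k) (c t0 k)..max (c t k) (c t0 k)}" for s
            using elim(2)[rule_format, of k] kn that by (auto simp: min_def max_def split: if_splits)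
          have "min (c t k) (c t0 k) < max (c t k) (c t0 k)" using False by auto
          from MVT2[OF this, of "\<lambda>s. f ((g k t)(k := s))" "\<lambda>s. partial k f ((g k t)(k := s))"]
          obtain z where z: "z > min (c t k) (c t0 k)" "z < max (c t k) (c t0 k)" 
            "f ((g k t)(k := max (c t k) (c t0 k))) - f ((g k t)(k := min (c t k) (c t0 k))) =
             (max (c t k) (c t0 k) - min (c t k) (c t0 k)) * partial k f ((g k t)(k := z))"
            using der seg by (metis (no_types, lifting) atLeastAtMost_iff)
          have "h t = (c t k - c t0 k) * partial k f ((g k t)(k := z))"
            using z(3) gS[of t] gk[of t] by (auto simp: h_def min_def max_def algebra_simps split: if_splits)
          then have "q t = partial k f ((g k t)(k := z))" using False by (simp add: q_def)
          then show ?thesis using in_box[OF seg, of z] z by auto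
        qed
      qed
    qed
    then have "(q \<longlongrightarrow> L) (at t0)" by (rule tendsto_mono[rotated]) (simp add: at_within_def)
    moreover have "((\<lambda>t. (c t k - c t0 k) / (t - t0)) \<longlongrightarrow> c' k) (at t0)"
      using cd[OF kn] by (simp add: has_field_derivative_iff)
    ultimately have "((\<lambda>t. q t * ((c t k - c t0 k) / (t - t0))) \<longlongrightarrow> L * c' k) (at t0)"
      by (rule tendsto_mult)
    then have "(h has_real_derivative L * c' k) (at t0)"
      by (simp add: has_field_derivative_iff hq)
    from DERIV_add[OF Suc.IH this] kn
    show ?case by (simp add: h_def L_def)
  qed
  from this[of n] have "((\<lambda>t. f (g n t)) has_real_derivative (\<Sum>j<n. partial j f (c t0) * c' j)) (at t0)"
    by simp
  moreover have ev: "\<forall>\<^sub>F t in nhds t0. f (g n t) = f (c t)"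
    using cs
  proof eventually_elim
    case (elim t)
    have "g n t = c t" using elim c0n by (auto simp: g_def space_R_iff)
    then show ?case by simp
  qed
  ultimately show ?thesis using DERIV_cong_ev[OF refl ev refl] by simp
qed

lemma openin_space_R [simp]: "openin (Euclidean_space n) (space_R n)"
  by simp

lemma partial_eqI:
  "((\<lambda>t. f (x(j := t))) has_real_derivative D) (at (x j)) \<Longrightarrow> partial j f x = D"
  unfolding partial_def by (rule DERIV_imp_deriv)

lemma smooth_const: "openin (Euclidean_space n) U \<Longrightarrow> smooth n U (\<lambda>x. c)"
proof (rule smooth_coinduct[where P="\<lambda>f. \<exists>c. f = (\<lambda>x. c)"])
  fix f :: "pt \<Rightarrow> real" assume "\<exists>c. f = (\<lambda>x. c)"
  then obtain c where f: "f = (\<lambda>x. c)" by auto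
  have "partial j f x = 0" for j x
    by (rule partial_eqI) (simp add: f)
  then show "has_partials n U f \<and> (\<forall>j<n. \<exists>g. (\<exists>c. g = (\<lambda>x. c)) \<and> (\<forall>x\<in>U. partial j f x = g x))"
    by (auto simp: f has_partials_def)
qed auto

lemma partial_coord: "partial j (\<lambda>x. x i) x = (if i = j then 1 else 0)"
  by (rule partial_eqI) auto

lemma smooth_coord:
  assumes U: "openin (Euclidean_space n) U" shows "smooth n U (\<lambda>x. x i)"
proof (rule smooth_coinduct[OF U, where P="\<lambda>f. f = (\<lambda>x. x i) \<or> smooth n U f"])
  fix f :: "pt \<Rightarrow> real" assume "f = (\<lambda>x. x i) \<or> smooth n U f"
  then show "has_partials n U f \<and> (\<forall>j<n. \<exists>g. (g = (\<lambda>x. x i) \<or> smooth n U g) \<and> (\<forall>x\<in>U. partial j f x = g x))"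
  proof
    assume f: "f = (\<lambda>x. x i)"
    have "(\<lambda>t. if i = j then t else c) differentiable at y" for j and c y :: real
      by (cases "i = j") auto
    then have "has_partials n U f"
      by (auto simp: f has_partials_def intro: continuous_on_product_coordinates continuous_on_subset)
    moreover have "\<exists>g. (g = (\<lambda>x. x i) \<or> smooth n U g) \<and> (\<forall>x\<in>U. partial j f x = g x)" for j
      using smooth_const[OF U] by (intro exI[of _ "\<lambda>x. if i = j then 1 else 0"]) (auto simp: f partial_coord)
    ultimately show ?thesis by blast
  next
    assume "smooth n U f"
    then show ?thesis using smooth_has_partials smooth_partial by blast
  qed
qed simp

lemma
  assumes f: "has_partials n U f" and g: "has_partials n U g" and x: "x \<in> U" "j < n"
  shows partial_add: "partial j (\<lambda>x. f x + g x) x = partial j f x + partial j g x"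
    and partial_mult: "partial j (\<lambda>x. f x * g x) x = partial j f x * g x + f x * partial j g x"
    and partial_diff: "partial j (\<lambda>x. f x - g x) x = partial j f x - partial j g x"
proof -
  note D = has_partialsD[OF f x] has_partialsD[OF g x]
  show "partial j (\<lambda>x. f x + g x) x = partial j f x + partial j g x"
    by (rule partial_eqI) (rule DERIV_add[OF D])
  show "partial j (\<lambda>x. f x - g x) x = partial j f x - partial j g x"
    by (rule partial_eqI) (rule DERIV_diff[OF D])
  show "partial j (\<lambda>x. f x * g x) x = partial j f x * g x + f x * partial j g x"
    by (rule partial_eqI) (rule DERIV_cong[OF DERIV_mult[OF D]], simp add: algebra_simps)
qed

lemma
  assumes f: "has_partials n U f" and g: "has_partials n U g"
  shows has_partials_add: "has_partials n U (\<lambda>x. f x + g x)"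
    and has_partials_mult: "has_partials n U (\<lambda>x. f x * g x)"
proof -
  have "(\<lambda>t. f (x(j := t)) + g (x(j := t))) differentiable at (x j)"
    "(\<lambda>t. f (x(j := t)) * g (x(j := t))) differentiable at (x j)" if "x \<in> U" "j < n" for x j
    using f g that by (auto simp: has_partials_def intro!: differentiable_add differentiable_mult)
  then show "has_partials n U (\<lambda>x. f x + g x)" "has_partials n U (\<lambda>x. f x * g x)"
    using f g by (auto simp: has_partials_def intro!: continuous_intros)
qed

section \<open>Composition of smooth maps\<close>

lemma smooth_map_continuous_on:
  assumes "smooth_map n U m F" shows "continuous_on U F"
proof (rule continuous_on_coordinatewise_then_product)
  fix i
  show "continuous_on U (\<lambda>x. F x i)"
  proof (cases "i < m")
    case True
    then show ?thesis using assms by (auto simp: smooth_map_def intro: smooth_continuous)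
  next
    case False
    then have "F x i = 0" if "x \<in> U" for x
      using assms that by (auto simp: smooth_map_def space_R_iff image_subset_iff)
    then show ?thesis using continuous_on_cong[of U U "\<lambda>x. F x i" "\<lambda>x. 0"] by simp
  qed
qed

lemma smooth_map_in_space: "smooth_map n U m F \<Longrightarrow> x \<in> U \<Longrightarrow> F x \<in> space_R m"
  by (auto simp: smooth_map_def)

lemma smooth_map_component:
  assumes "openin (Euclidean_space n) U" "smooth_map n U m F" shows "smooth n U (\<lambda>x. F x i)"
proof (cases "i < m")
  case False
  then have "F x i = 0" if "x \<in> U" for x
    using assms that by (auto simp: smooth_map_def space_R_iff image_subset_iff)
  then show ?thesis using smooth_cong[OF assms(1) _ smooth_const[OF assms(1), of 0]] by simp
qed (use assms in \<open>auto simp: smooth_map_def\<close>)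

lemma compose_has_partial:
  assumes U: "openin (Euclidean_space n) U" and W: "openin (Euclidean_space m) W"
    and F: "smooth_map n U m F" and FU: "F ` U \<subseteq> W" and f: "smooth m W f" and x: "x \<in> U" and j: "j < n"
  shows "((\<lambda>t. f (F (x(j := t)))) has_real_derivative
    (\<Sum>i<m. partial i f (F x) * partial j (\<lambda>y. F y i) x)) (at (x j))"
proof -
  have "((\<lambda>t. f (F (x(j := t)))) has_real_derivative
    (\<Sum>i<m. partial i f (F (x(j := x j))) * partial j (\<lambda>y. F y i) x)) (at (x j))"
  proof (rule chain_rule_curve[OF W smooth_has_partials[OF f]])
    show "\<And>j. j < m \<Longrightarrow> continuous_on W (partial j f)"
      using f smooth_partial smooth_continuous by blast
    show "F (x(j := x j)) \<in> W" using FU x by auto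
    show "\<forall>\<^sub>F t in nhds (x j). F (x(j := t)) \<in> space_R m"
      using eventually_fun_upd_in_open[OF U x j] by eventually_elim (use F in \<open>auto simp: smooth_map_def\<close>)
    show "((\<lambda>t. F (x(j := t)) i) has_real_derivative partial j (\<lambda>y. F y i) x) (at (x j))" if "i < m" for i
      using F that x j has_partialsD[OF smooth_has_partials, of n U "\<lambda>y. F y i"] by (auto simp: smooth_map_def)
  qed
  then show ?thesis by simp
qed

lemma partial_compose:
  assumes U: "openin (Euclidean_space n) U" and W: "openin (Euclidean_space m) W"
    and F: "smooth_map n U m F" and FU: "F ` U \<subseteq> W" and f: "smooth m W f" and x: "x \<in> U" and j: "j < n"
  shows "partial j (\<lambda>x. f (F x)) x = (\<Sum>i<m. partial i f (F x) * partial j (\<lambda>y. F y i) x)"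
  by (rule partial_eqI) (rule compose_has_partial[OF assms])

text \<open>By the chain rule, a partial derivative of a composition with \<open>F\<close> is a sum
  of products of such compositions with partials of \<open>F\<close>. Compositions alone are not
  closed under differentiation, but the algebra they generate together with the smooth functions is;
  it serves as the class in \<open>smooth_coinduct\<close>.\<close>

inductive comp_alg :: "nat \<Rightarrow> pt set \<Rightarrow> nat \<Rightarrow> pt set \<Rightarrow> (pt \<Rightarrow> pt) \<Rightarrow> (pt \<Rightarrow> real) \<Rightarrow> bool"
  for n U m W F where
    base: "smooth n U f \<Longrightarrow> comp_alg n U m W F f"
  | comp: "smooth m W f \<Longrightarrow> comp_alg n U m W F (\<lambda>x. f (F x))"
  | add: "comp_alg n U m W F f \<Longrightarrow> comp_alg n U m W F g \<Longrightarrow> comp_alg n U m W F (\<lambda>x. f x + g x)"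
  | mult: "comp_alg n U m W F f \<Longrightarrow> comp_alg n U m W F g \<Longrightarrow> comp_alg n U m W F (\<lambda>x. f x * g x)"

lemma comp_alg_sum:
  assumes U: "openin (Euclidean_space n) U" and "finite I" and "\<And>i. i \<in> I \<Longrightarrow> comp_alg n U m W F (f i)"
  shows "comp_alg n U m W F (\<lambda>x. \<Sum>i\<in>I. f i x)"
  using assms(2,3)
proof (induction I rule: finite_induct)
  case empty
  then show ?case using comp_alg.base[OF smooth_const[OF U, of 0]] by simp
next
  case (insert i I)
  then show ?case using comp_alg.add by simp
qed

lemma comp_alg_smooth:
  assumes U: "openin (Euclidean_space n) U" and W: "openin (Euclidean_space m) W"
    and F: "smooth_map n U m F" and FU: "F ` U \<subseteq> W" and f: "comp_alg n U m W F f"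
  shows "smooth n U f"
proof (rule smooth_coinduct[OF U, where P="comp_alg n U m W F"])
  fix f assume "comp_alg n U m W F f"
  then show "has_partials n U f \<and> (\<forall>j<n. \<exists>g. comp_alg n U m W F g \<and> (\<forall>x\<in>U. partial j f x = g x))"
  proof induction
    case (base f)
    then show ?case
      using smooth_has_partials smooth_partial comp_alg.base by blast
  next
    case (comp f)
    have "continuous_on U (\<lambda>x. f (F x))"
      using continuous_on_compose2[OF smooth_continuous[OF comp] smooth_map_continuous_on[OF F] FU] .
    then have "has_partials n U (\<lambda>x. f (F x))"
      using compose_has_partial[OF U W F FU comp] by (auto simp: has_partials_def real_differentiable_def)
    moreover have "\<exists>g. comp_alg n U m W F g \<and> (\<forall>x\<in>U. partial j (\<lambda>x. f (F x)) x = g x)" if "j < n" for j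
    proof (intro exI conjI ballI)
      show "comp_alg n U m W F (\<lambda>x. \<Sum>i<m. partial i f (F x) * partial j (\<lambda>y. F y i) x)"
        using F that comp by (intro comp_alg_sum[OF U] comp_alg.mult comp_alg.comp comp_alg.base)
           (auto simp: smooth_map_def intro: smooth_partial)
    qed (rule partial_compose[OF U W F FU comp _ that])
    ultimately show ?case by blast
  next
    case (add f g)
    have "\<exists>h. comp_alg n U m W F h \<and> (\<forall>x\<in>U. partial j (\<lambda>x. f x + g x) x = h x)" if j: "j < n" for j
    proof -
      obtain f' g' where "comp_alg n U m W F f'" "\<forall>x\<in>U. partial j f x = f' x"
         "comp_alg n U m W F g'" "\<forall>x\<in>U. partial j g x = g' x" using add j by blast
      then show ?thesis using add j
        by (intro exI[of _ "\<lambda>x. f' x + g' x"]) (auto intro: comp_alg.add simp: partial_add)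
    qed
    then show ?case using add has_partials_add by blast
  next
    case (mult f g)
    have "\<exists>h. comp_alg n U m W F h \<and> (\<forall>x\<in>U. partial j (\<lambda>x. f x * g x) x = h x)" if j: "j < n" for j
    proof -
      obtain f' g' where "comp_alg n U m W F f'" "\<forall>x\<in>U. partial j f x = f' x"
         "comp_alg n U m W F g'" "\<forall>x\<in>U. partial j g x = g' x" using mult j by blast
      then show ?thesis using mult j
        by (intro exI[of _ "\<lambda>x. f' x * g x + f x * g' x"])
           (auto intro!: comp_alg.add comp_alg.mult simp: partial_mult)
    qed
    then show ?case using mult has_partials_mult by blast
  qed
qed (rule f)

lemma smooth_compose:
  assumes "openin (Euclidean_space n) U" "openin (Euclidean_space m) W"
    "smooth_map n U m F" "F ` U \<subseteq> W" "smooth m W f"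
  shows "smooth n U (\<lambda>x. f (F x))"
  by (rule comp_alg_smooth[OF assms(1-4)]) (rule comp_alg.comp[OF assms(5)])

lemma smooth_map_id: "openin (Euclidean_space n) U \<Longrightarrow> smooth_map n U n (\<lambda>x. x)"
  using openin_Euclidean_spaceD by (auto simp: smooth_map_def smooth_coord)

text \<open>With the identity as \<open>F\<close>, \<open>comp_alg\<close> contains the sums and
  products of smooth functions, so the coinduction done for compositions covers them as
  well.\<close>

lemma
  assumes U: "openin (Euclidean_space n) U" and f: "smooth n U f" and g: "smooth n U g"
  shows smooth_add: "smooth n U (\<lambda>x. f x + g x)"
    and smooth_mult: "smooth n U (\<lambda>x. f x * g x)"
  using comp_alg_smooth[OF U U smooth_map_id[OF U], OF _ comp_alg.add[OF comp_alg.base comp_alg.base]] f g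
    comp_alg_smooth[OF U U smooth_map_id[OF U], OF _ comp_alg.mult[OF comp_alg.base comp_alg.base]] by auto

lemma smooth_sum:
  assumes U: "openin (Euclidean_space n) U" and "finite I" "\<And>i. i \<in> I \<Longrightarrow> smooth n U (f i)"
  shows "smooth n U (\<lambda>x. \<Sum>i\<in>I. f i x)"
  using assms(2,3) by (induction I rule: finite_induct) (auto intro: smooth_const[OF U] smooth_add[OF U])

lemma smooth_cmult: "openin (Euclidean_space n) U \<Longrightarrow> smooth n U f \<Longrightarrow> smooth n U (\<lambda>x. c * f x)"
  by (intro smooth_mult smooth_const)

lemma smooth_diff:
  assumes U: "openin (Euclidean_space n) U" and f: "smooth n U f" and g: "smooth n U g"
  shows "smooth n U (\<lambda>x. f x - g x)"
  using smooth_add[OF U f smooth_cmult[OF U g, of "-1"]] by simp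

lemma smooth_map_const: "u \<in> space_R m \<Longrightarrow> openin (Euclidean_space n) V \<Longrightarrow> smooth_map n V m (\<lambda>x. u)"
  by (auto simp: smooth_map_def smooth_const)

lemma smooth_map_compose:
  assumes "openin (Euclidean_space n) U" "openin (Euclidean_space m) W"
    "smooth_map n U m F" "F ` U \<subseteq> W" "smooth_map m W k G"
  shows "smooth_map n U k (\<lambda>x. G (F x))"
  using assms(4,5) smooth_compose[OF assms(1-4), of "\<lambda>x. G x i" for i] by (auto simp: smooth_map_def)

lemma smooth_map_subset: "smooth_map n U m F \<Longrightarrow> V \<subseteq> U \<Longrightarrow> smooth_map n V m F"
  by (auto simp: smooth_map_def intro: smooth_subset)

text \<open>Mixed differences along the two axes are evaluated twice by the mean value theorem.\<close>

lemma partial_commute: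
  assumes U: "openin (Euclidean_space n) U" and f: "smooth n U f" and x: "x \<in> U" and i: "i < n" and j: "j < n"
  shows "partial i (partial j f) x = partial j (partial i f) x"
proof (cases "i = j")
  case False
  define a where "a = partial i (partial j f) x"
  define b where "b = partial j (partial i f) x"
  have "\<bar>a - b\<bar> \<le> 0 + e" if e: "e > 0" for e
  proof -
    have e2: "e/2 > 0" using e by simp
    have ca: "continuous_on U (partial i (partial j f))" and cb: "continuous_on U (partial j (partial i f))"
      using f i j by (auto intro: smooth_partial smooth_continuous)
    from continuous_neighbourhood_box[OF U ca x e2] obtain d1 where d1: "d1 > 0"
      "\<And>y. y \<in> space_R n \<Longrightarrow> (\<forall>i<n. \<bar>y i - x i\<bar> < d1) \<Longrightarrow> y \<in> U \<and> \<bar>partial i (partial j f) y - a\<bar> < e/2"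
      unfolding a_def by auto
    from continuous_neighbourhood_box[OF U cb x e2] obtain d2 where d2: "d2 > 0"
      "\<And>y. y \<in> space_R n \<Longrightarrow> (\<forall>i<n. \<bar>y i - x i\<bar> < d2) \<Longrightarrow> y \<in> U \<and> \<bar>partial j (partial i f) y - b\<bar> < e/2"
      unfolding b_def by auto
    define h where "h = min d1 d2 / 2"
    have h: "h > 0" "h < d1" "h < d2" using d1(1) d2(1) by (auto simp: h_def)
    define p where "p s t = x(i := s, j := t)" for s t
    have px: "p s t \<in> space_R n" for s t
      using openin_Euclidean_spaceD[OF U x] i j by (auto simp: p_def space_R_iff)
    have near: "\<forall>k<n. \<bar>p s t k - x k\<bar> < d" if "d > 0" "\<bar>s - x i\<bar> < d" "\<bar>t - x j\<bar> < d" for s t d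
      using that by (auto simp: p_def)
    have pU: "p s t \<in> U" if "s \<in> {x i..x i + h}" "t \<in> {x j..x j + h}" for s t
      by (rule d1(2)[OF px, THEN conjunct1]) (rule near, use that h d1 in auto)
    have pi: "(p s t)(i := s') = p s' t" and pj: "(p s t)(j := t') = p s t'"
      and pii: "p s t i = s" and pjj: "p s t j = t" for s t s' t'
      using False by (auto simp: p_def fun_upd_twist)
    have Di: "((\<lambda>s. g (p s t)) has_real_derivative partial i g (p s t)) (at s)"
      if "smooth n U g" "s \<in> {x i..x i + h}" "t \<in> {x j..x j + h}" for g s t
      using has_partialsD[OF smooth_has_partials[OF that(1)] pU[OF that(2,3)] i] by (simp add: pi pii)
    have Dj: "((\<lambda>t. g (p s t)) has_real_derivative partial j g (p s t)) (at t)"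
      if "smooth n U g" "s \<in> {x i..x i + h}" "t \<in> {x j..x j + h}" for g s t
      using has_partialsD[OF smooth_has_partials[OF that(1)] pU[OF that(2,3)] j] by (simp add: pj pjj)
    define E where "E = f (p (x i + h) (x j + h)) - f (p (x i + h) (x j)) - f (p (x i) (x j + h)) + f (p (x i) (x j))"
    have E1: "E = (f (p (x i + h) (x j + h)) - f (p (x i + h) (x j))) - (f (p (x i) (x j + h)) - f (p (x i) (x j)))"
      and E2: "E = (f (p (x i + h) (x j + h)) - f (p (x i) (x j + h))) - (f (p (x i + h) (x j)) - f (p (x i) (x j)))"
      by (simp_all add: E_def)
    have "\<exists>s\<in>{x i<..<x i + h}. \<exists>t\<in>{x j<..<x j + h}. E = h * (h * partial j (partial i f) (p s t))"
    proof -
      have "\<exists>s>x i. s < x i + h \<and> E = (x i + h - x i) * (partial i f (p s (x j + h)) - partial i f (p s (x j)))"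
        unfolding E1 by (rule MVT2) (use h in \<open>auto intro!: DERIV_diff Di[OF f]\<close>)
      then obtain s where s: "s > x i" "s < x i + h"
        "E = h * (partial i f (p s (x j + h)) - partial i f (p s (x j)))" by auto
      moreover have "\<exists>t>x j. t < x j + h \<and> partial i f (p s (x j + h)) - partial i f (p s (x j)) 
          = (x j + h - x j) * partial j (partial i f) (p s t)"
        by (rule MVT2) (use h s in \<open>auto intro!: Dj smooth_partial[OF f i]\<close>)
      ultimately show ?thesis by force
    qed
    then obtain s t where st: "s \<in> {x i<..<x i + h}" "t \<in> {x j<..<x j + h}"
      "E = h * (h * partial j (partial i f) (p s t))" by auto
    have "\<exists>s\<in>{x i<..<x i + h}. \<exists>t\<in>{x j<..<x j + h}. E = h * (h * partial i (partial j f) (p s t))"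
    proof -
      have "\<exists>t>x j. t < x j + h \<and> E = (x j + h - x j) * (partial j f (p (x i + h) t) - partial j f (p (x i) t))"
        unfolding E2 by (rule MVT2) (use h in \<open>auto intro!: DERIV_diff Dj[OF f]\<close>)
      then obtain t where t: "t > x j" "t < x j + h"
        "E = h * (partial j f (p (x i + h) t) - partial j f (p (x i) t))" by auto
      moreover have "\<exists>s>x i. s < x i + h \<and> partial j f (p (x i + h) t) - partial j f (p (x i) t)
          = (x i + h - x i) * partial i (partial j f) (p s t)"
        by (rule MVT2) (use h t in \<open>auto intro!: Di smooth_partial[OF f j]\<close>)
      ultimately show ?thesis by force
    qed
    then obtain s' t' where st': "s' \<in> {x i<..<x i + h}" "t' \<in> {x j<..<x j + h}"
      "E = h * (h * partial i (partial j f) (p s' t'))" by auto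
    have "partial j (partial i f) (p s t) = partial i (partial j f) (p s' t')"
      using st(3) st'(3) h by simp
    moreover have "\<bar>partial i (partial j f) (p s' t') - a\<bar> < e/2"
      by (rule d1(2)[OF px, THEN conjunct2]) (rule near, use st' h d1 in auto)
    moreover have "\<bar>partial j (partial i f) (p s t) - b\<bar> < e/2"
      by (rule d2(2)[OF px, THEN conjunct2]) (rule near, use st h d2 in auto)
    ultimately show ?thesis by linarith
  qed
  then have "\<bar>a - b\<bar> \<le> 0" by (rule field_le_epsilon)
  then show ?thesis by (simp add: a_def b_def)
qed simp

section \<open>Naturality of the Lie bracket and of the weak derived flag\<close>

lemma has_partials_const: "has_partials n U (\<lambda>x. c)"
  by (auto simp: has_partials_def)

lemma partial_const [simp]: "partial j (\<lambda>x. c) x = 0"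
  by (rule partial_eqI) simp

lemma has_partials_sum:
  assumes "finite I" "\<And>i. i \<in> I \<Longrightarrow> has_partials n U (f i)"
  shows "has_partials n U (\<lambda>x. \<Sum>i\<in>I. f i x)"
  using assms by (induction I rule: finite_induct) (auto simp: has_partials_const has_partials_add)

lemma partial_sum:
  assumes "finite I" "\<And>i. i \<in> I \<Longrightarrow> has_partials n U (f i)" "x \<in> U" "j < n"
  shows "partial j (\<lambda>x. \<Sum>i\<in>I. f i x) x = (\<Sum>i\<in>I. partial j (f i) x)"
  using assms(1,2)
proof (induction I rule: finite_induct)
  case (insert i I)
  then show ?case
    using partial_add[of n U "f i" "\<lambda>x. \<Sum>i\<in>I. f i x" x j] has_partials_sum[of I n U f] assms(3,4) by simp
qed simp

section \<open>Directional derivatives, differentials and brackets\<close>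

definition ddir :: "nat \<Rightarrow> (pt \<Rightarrow> real) \<Rightarrow> pt \<Rightarrow> pt \<Rightarrow> real"
  where "ddir n f x v = (\<Sum>j<n. partial j f x * v j)"

lemma differential_apply: "differential n F x v i = ddir n (\<lambda>y. F y i) x v"
  by (simp add: differential_def ddir_def)

lemma plus_pt_apply: "(u + v) i = u i + v i" for u v :: pt
  by simp

lemma scaleR_pt_apply: "(c *\<^sub>R v) i = c * v i" for v :: pt
  by (simp add: scaleR_fun_def)

lemma sum_pt_apply: "(\<Sum>k\<in>I. f k) i = (\<Sum>k\<in>I. f k i)" for f :: "'a \<Rightarrow> pt"
  by (induction I rule: infinite_finite_induct) auto

lemma linear_ddir: "linear (ddir n f x)"
  by (rule linearI) (auto simp: ddir_def scaleR_pt_apply distrib_left sum.distrib sum_distrib_left algebra_simps)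

lemma linear_differential: "linear (differential n F x)"
  by (rule linearI)
    (auto simp: fun_eq_iff differential_apply linear_add[OF linear_ddir] linear_scale[OF linear_ddir] scaleR_pt_apply)

lemma subspace_space_R [simp]: "subspace (space_R n)"
  by (auto simp: subspace_def space_R_iff scaleR_pt_apply)

lemma ddir_cong:
  assumes "openin (Euclidean_space n) U" "\<And>y. y \<in> U \<Longrightarrow> f y = g y" "x \<in> U"
  shows "ddir n f x v = ddir n g x v"
  using partial_cong[OF assms] by (simp add: ddir_def)

lemma differential_cong:
  assumes "openin (Euclidean_space n) U" "\<And>y. y \<in> U \<Longrightarrow> F y = G y" "x \<in> U"
  shows "differential n F x v = differential n G x v"
  using assms ddir_cong[OF assms(1) _ assms(3), of "\<lambda>y. F y i" "\<lambda>y. G y i" for i]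
  by (auto simp: fun_eq_iff differential_apply)

lemma differential_in_space_R:
  assumes U: "openin (Euclidean_space n) U" and F: "smooth_map n U m F" and x: "x \<in> U"
  shows "differential n F x v \<in> space_R m"
  unfolding space_R_iff differential_apply
proof (intro allI impI)
  fix i assume "m \<le> i"
  then have "F y i = 0" if "y \<in> U" for y
    using smooth_map_in_space[OF F that] by (auto simp: space_R_iff)
  from ddir_cong[OF U this x] show "ddir n (\<lambda>y. F y i) x v = 0" by (simp add: ddir_def)
qed

lemma ddir_compose:
  assumes U: "openin (Euclidean_space n) U" and W: "openin (Euclidean_space m) W"
    and F: "smooth_map n U m F" and FU: "F ` U \<subseteq> W" and f: "smooth m W f" and x: "x \<in> U"
  shows "ddir n (\<lambda>y. f (F y)) x v = ddir m f (F x) (differential n F x v)"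
proof -
  have "ddir n (\<lambda>y. f (F y)) x v = (\<Sum>j<n. (\<Sum>i<m. partial i f (F x) * partial j (\<lambda>y. F y i) x) * v j)"
    unfolding ddir_def by (intro sum.cong) (simp_all add: partial_compose[OF assms])
  also have "\<dots> = (\<Sum>i<m. \<Sum>j<n. partial i f (F x) * (partial j (\<lambda>y. F y i) x * v j))"
    by (subst sum.swap) (simp add: sum_distrib_right mult.assoc)
  finally show ?thesis by (simp add: ddir_def differential_apply sum_distrib_left)
qed

lemma differential_compose:
  assumes U: "openin (Euclidean_space n) U" and W: "openin (Euclidean_space m) W"
    and F: "smooth_map n U m F" and FU: "F ` U \<subseteq> W" and G: "smooth_map m W k G" and x: "x \<in> U"
  shows "differential n (\<lambda>y. G (F y)) x v = differential m G (F x) (differential n F x v)"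
  using ddir_compose[OF U W F FU smooth_map_component[OF W G] x]
  by (auto simp: fun_eq_iff differential_apply)

lemma ddir_coord: "i < n \<Longrightarrow> ddir n (\<lambda>y. y i) x v = v i"
  by (simp add: ddir_def partial_coord if_distrib[of "\<lambda>c. c * _"] cong: if_cong)

lemma differential_id: "v \<in> space_R n \<Longrightarrow> differential n (\<lambda>y. y) x v = v"
proof
  fix i assume v: "v \<in> space_R n"
  show "differential n (\<lambda>y. y) x v i = v i"
  proof (cases "i < n")
    case False
    then show ?thesis using v by (auto simp: differential_apply ddir_def partial_coord space_R_iff intro!: sum.neutral)
  qed (simp add: differential_apply ddir_coord)
qed

lemma lie_bracket_apply:
  "lie_bracket n X Y x i = ddir n (\<lambda>y. Y y i) x (X x) - ddir n (\<lambda>y. X y i) x (Y x)"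
  by (simp add: lie_bracket_def differential_apply)

lemma lie_bracket_in_space_R:
  assumes "openin (Euclidean_space n) U" "smooth_map n U n X" "smooth_map n U n Y" "x \<in> U"
  shows "lie_bracket n X Y x \<in> space_R n"
  unfolding lie_bracket_def
  by (intro subspace_diff[OF subspace_space_R] differential_in_space_R[OF assms(1) _ assms(4)] assms)

text \<open>The relation between \<open>Y\<close> and \<open>Y'\<close> is differentiated along
  \<open>v\<close>. The product rule leaves the second derivatives of \<open>F\<close>, contracted
  with \<open>Y x\<close> and \<open>v\<close>, and the image of the derivative of \<open>Y\<close>;
  only the latter survives in a commutator.\<close>

lemma ddir_related:
  assumes U: "openin (Euclidean_space n) U" and W: "openin (Euclidean_space m) W"
    and F: "smooth_map n U m F" and FU: "F ` U \<subseteq> W"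
    and Y: "smooth_map n U n Y" and Y': "smooth_map m W m Y'"
    and rel: "\<And>x. x \<in> U \<Longrightarrow> Y' (F x) = differential n F x (Y x)" and x: "x \<in> U"
  shows "ddir m (\<lambda>y. Y' y i) (F x) (differential n F x v) =
    (\<Sum>l<n. \<Sum>j<n. partial l (partial j (\<lambda>y. F y i)) x * (Y x j * v l)) +
    ddir n (\<lambda>y. F y i) x (differential n Y x v)"
proof -
  let ?Fi = "\<lambda>y. F y i"
  have Fi: "smooth n U ?Fi" by (rule smooth_map_component[OF U F])
  have Yj: "smooth n U (\<lambda>y. Y y j)" for j by (rule smooth_map_component[OF U Y])
  have "ddir m (\<lambda>y. Y' y i) (F x) (differential n F x v) = ddir n (\<lambda>y. Y' (F y) i) x v"
    by (rule ddir_compose[OF U W F FU smooth_map_component[OF W Y'] x, symmetric])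
  also have "\<dots> = ddir n (\<lambda>y. \<Sum>j<n. partial j ?Fi y * Y y j) x v"
    by (rule ddir_cong[OF U _ x]) (simp add: rel differential_apply ddir_def)
  also have "\<dots> = (\<Sum>l<n. (\<Sum>j<n. partial l (partial j ?Fi) x * Y x j + partial j ?Fi x * partial l (\<lambda>y. Y y j) x) * v l)"
    unfolding ddir_def
  proof (intro sum.cong refl, goal_cases)
    case (1 l)
    have "partial l (\<lambda>y. \<Sum>j<n. partial j ?Fi y * Y y j) x = (\<Sum>j<n. partial l (\<lambda>y. partial j ?Fi y * Y y j) x)"
    proof (rule partial_sum[OF _ _ x])
      fix j assume "j \<in> {..<n}"
      then show "has_partials n U (\<lambda>y. partial j ?Fi y * Y y j)"
        by (intro smooth_has_partials[OF smooth_mult[OF U smooth_partial[OF Fi] Yj]]) simp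
    qed (use 1 in auto)
    also have "\<dots> = (\<Sum>j<n. partial l (partial j ?Fi) x * Y x j + partial j ?Fi x * partial l (\<lambda>y. Y y j) x)"
      by (intro sum.cong refl partial_mult[OF smooth_has_partials[OF smooth_partial[OF Fi]] smooth_has_partials[OF Yj] x])
        (use 1 in auto)
    finally show ?case by simp
  qed
  also have "\<dots> = (\<Sum>l<n. \<Sum>j<n. partial l (partial j ?Fi) x * (Y x j * v l)) +
      (\<Sum>l<n. \<Sum>j<n. partial j ?Fi x * (partial l (\<lambda>y. Y y j) x * v l))"
    by (simp add: sum_distrib_right sum.distrib distrib_right mult.assoc)
  also have "(\<Sum>l<n. \<Sum>j<n. partial j ?Fi x * (partial l (\<lambda>y. Y y j) x * v l)) =
      ddir n ?Fi x (differential n Y x v)"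
    by (subst sum.swap) (simp add: ddir_def differential_apply sum_distrib_left)
  finally show ?thesis .
qed

text \<open>For the two orders of \<open>X\<close> and \<open>Y\<close> the second-derivative terms
  of \<open>ddir_related\<close> coincide by \<open>partial_commute\<close> and cancel. The result
  is applied to local diffeomorphisms and to left translations.\<close>

lemma lie_bracket_related:
  assumes U: "openin (Euclidean_space n) U" and W: "openin (Euclidean_space m) W"
    and F: "smooth_map n U m F" and FU: "F ` U \<subseteq> W"
    and X: "smooth_map n U n X" and X': "smooth_map m W m X'"
    and Y: "smooth_map n U n Y" and Y': "smooth_map m W m Y'"
    and relX: "\<And>x. x \<in> U \<Longrightarrow> X' (F x) = differential n F x (X x)"
    and relY: "\<And>x. x \<in> U \<Longrightarrow> Y' (F x) = differential n F x (Y x)" and x: "x \<in> U"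
  shows "lie_bracket m X' Y' (F x) = differential n F x (lie_bracket n X Y x)"
proof
  fix i
  let ?Fi = "\<lambda>y. F y i"
  have "(\<Sum>l<n. \<Sum>j<n. partial l (partial j ?Fi) x * (Y x j * X x l)) =
    (\<Sum>l<n. \<Sum>j<n. partial j (partial l ?Fi) x * (Y x j * X x l))"
    using partial_commute[OF U smooth_map_component[OF U F] x] by (intro sum.cong refl) auto
  also have "\<dots> = (\<Sum>l<n. \<Sum>j<n. partial l (partial j ?Fi) x * (X x j * Y x l))"
    by (subst sum.swap) (simp add: mult.commute)
  finally have sym: "(\<Sum>l<n. \<Sum>j<n. partial l (partial j ?Fi) x * (Y x j * X x l)) = \<dots>" .
  have "differential n F x (lie_bracket n X Y x) i =
      ddir n ?Fi x (differential n Y x (X x)) - ddir n ?Fi x (differential n X x (Y x))"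
    unfolding lie_bracket_def linear_diff[OF linear_differential] by (simp add: differential_apply)
  moreover have "ddir m (\<lambda>y. Y' y i) (F x) (differential n F x (X x)) =
    (\<Sum>l<n. \<Sum>j<n. partial l (partial j ?Fi) x * (Y x j * X x l)) + ddir n ?Fi x (differential n Y x (X x))"
    by (rule ddir_related[OF U W F FU Y Y' _ x]) (rule relY)
  moreover have "ddir m (\<lambda>y. X' y i) (F x) (differential n F x (Y x)) =
    (\<Sum>l<n. \<Sum>j<n. partial l (partial j ?Fi) x * (X x j * Y x l)) + ddir n ?Fi x (differential n X x (Y x))"
    by (rule ddir_related[OF U W F FU X X' _ x]) (rule relX)
  ultimately show "lie_bracket m X' Y' (F x) i = differential n F x (lie_bracket n X Y x) i"
    using sym relX[OF x] relY[OF x] by (simp add: lie_bracket_apply)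
qed

section \<open>The weak derived flag under restriction and diffeomorphism\<close>

lemma is_section_subset: "is_section n D V X \<Longrightarrow> V' \<subseteq> V \<Longrightarrow> is_section n D V' X"
  by (auto simp: is_section_def intro: smooth_map_subset)

lemma is_section_cong: "(\<And>x. x \<in> V \<Longrightarrow> D x = E x) \<Longrightarrow> is_section n D V X \<longleftrightarrow> is_section n E V X"
  by (auto simp: is_section_def)

text \<open>A section over a larger open set may be restricted before it is bracketed, so the flag
  at \<open>x\<close> depends only on the distribution near \<open>x\<close>. Flatness supplies
  equivalences of small open sets only; this carries dimensions between them and the full
  manifolds.\<close>

lemma weak_flag_local:
  assumes "openin (Euclidean_space n) V" "V \<subseteq> U" "x \<in> V"
  shows "weak_flag n V D i x = weak_flag n U D i x"
  using assms(3)
proof (induction i arbitrary: x)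
  case (Suc i)
  show ?case
  proof (cases i)
    case (Suc k)
    let ?S = "\<lambda>U. {lie_bracket n X Y x | X Y V'. openin (Euclidean_space n) V' \<and> x \<in> V' \<and> V' \<subseteq> U \<and>
              is_section n D V' X \<and> is_section n (weak_flag n U D (Suc k)) V' Y}"
    have IH: "\<And>x. x \<in> V \<Longrightarrow> weak_flag n V D (Suc k) x = weak_flag n U D (Suc k) x"
      using Suc.IH Suc by simp
    have "?S V = ?S U"
    proof (intro equalityI subsetI)
      fix w assume "w \<in> ?S V"
      then obtain X Y V' where h: "w = lie_bracket n X Y x" "openin (Euclidean_space n) V'" "x \<in> V'" "V' \<subseteq> V"
        "is_section n D V' X" "is_section n (weak_flag n V D (Suc k)) V' Y" by blast
      have "is_section n (weak_flag n V D (Suc k)) V' Y = is_section n (weak_flag n U D (Suc k)) V' Y"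
        by (rule is_section_cong) (use IH h(4) in auto)
      with h(6) have "is_section n (weak_flag n U D (Suc k)) V' Y" by simp
      moreover have "V' \<subseteq> U" using h(4) assms(2) by blast
      ultimately show "w \<in> ?S U" 
        by (intro CollectI exI[of _ X] exI[of _ Y] exI[of _ V'] conjI h) 
    next
      fix w assume "w \<in> ?S U"
      then obtain X Y V' where h: "w = lie_bracket n X Y x" "openin (Euclidean_space n) V'" "x \<in> V'" "V' \<subseteq> U"
        "is_section n D V' X" "is_section n (weak_flag n U D (Suc k)) V' Y" by blast
      have "is_section n (weak_flag n U D (Suc k)) (V' \<inter> V) Y" "is_section n D (V' \<inter> V) X"
        by (rule is_section_subset[OF h(6)], simp, rule is_section_subset[OF h(5)], simp)
      moreover have "is_section n (weak_flag n U D (Suc k)) (V' \<inter> V) Y = is_section n (weak_flag n V D (Suc k)) (V' \<inter> V) Y"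
        by (rule is_section_cong) (use IH in auto)
      moreover have "openin (Euclidean_space n) (V' \<inter> V)" using h assms by auto
      ultimately show "w \<in> ?S V" using h(1,3) Suc.prems
        by (intro CollectI exI[of _ X] exI[of _ Y] exI[of _ "V' \<inter> V"] conjI) auto
    qed
    then show ?thesis unfolding Suc weak_flag.simps by (rule arg_cong)
  qed simp
qed simp

lemma weak_flag_subspace:
  assumes "subspace (D x)"
  shows "subspace (weak_flag n U D i x)"
proof (cases i)
  case (Suc j)
  then show ?thesis using assms by (cases j) simp_all
qed (simp add: subspace_single_0)

lemma weak_flag_subset_space_R:
  assumes "D x \<subseteq> space_R n"
  shows "weak_flag n U D i x \<subseteq> space_R n"
proof (cases i)
  case 0
  then show ?thesis by (simp add: space_R_iff)
next
  case (Suc j)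
  show ?thesis
  proof (cases j)
    case 0
    then show ?thesis using Suc assms by simp
  next
    case (Suc k)
    have "lie_bracket n X Y x \<in> space_R n"
      if "openin (Euclidean_space n) V" "x \<in> V" "is_section n D V X" "is_section n (weak_flag n U D (Suc k)) V Y" for X Y V
      by (rule lie_bracket_in_space_R[OF that(1)]) (use that in \<open>simp_all add: is_section_def\<close>)
    then show ?thesis
      unfolding Suc \<open>i = Suc j\<close> weak_flag.simps
      by (intro span_minimal subspace_space_R subsetI) blast
  qed
qed

text \<open>An image under \<open>F\<close> is a preimage under its continuous inverse
  \<open>G\<close>, cut down to the open set \<open>W\<close>.\<close>

lemma open_image_diffeo:
  assumes F: "smooth_map n V m F" and W: "openin (Euclidean_space m) W" and G: "smooth_map m W n G"
    and FG: "F ` V \<subseteq> W" "G ` W \<subseteq> V" "\<And>x. x \<in> V \<Longrightarrow> G (F x) = x" "\<And>y. y \<in> W \<Longrightarrow> F (G y) = y"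
    and U: "openin (Euclidean_space n) U" "U \<subseteq> V"
  shows "openin (Euclidean_space m) (F ` U)"
proof -
  obtain T where T: "open T" "U = T \<inter> space_R n" using U openin_Euclidean_space_iff by blast
  obtain T' where T': "open T'" "T' \<inter> W = G -` T \<inter> W"
    using smooth_map_continuous_on[OF G] T(1) unfolding continuous_on_open_invariant by blast
  have "F ` U = G -` T \<inter> W"
  proof (intro equalityI subsetI)
    fix y assume "y \<in> F ` U"
    then obtain x where x: "x \<in> U" "y = F x" by blast
    then have "x \<in> V" "x \<in> T" using U(2) T(2) by blast+
    then show "y \<in> G -` T \<inter> W" using FG(1) FG(3)[of x] x(2) by (simp add: image_subset_iff)
  next
    fix y assume y: "y \<in> G -` T \<inter> W"
    then have "G y \<in> U" using T(2) smooth_map_in_space[OF G, of y] by simp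
    moreover have "y = F (G y)" using FG(4)[of y] y by simp
    ultimately show "y \<in> F ` U" by blast
  qed
  then have F_eq: "F ` U = T' \<inter> W" using T' by simp
  obtain T'' where T'': "open T''" "W = T'' \<inter> space_R m" using W openin_Euclidean_space_iff by blast
  show ?thesis
    unfolding openin_Euclidean_space_iff
    by (rule exI[of _ "T' \<inter> T''"]) (use F_eq T'' T'(1) in \<open>simp add: Int_assoc open_Int\<close>)
qed

text \<open>Induction along the flag: sections are pushed forward, and their brackets correspond by
  \<open>lie_bracket_related\<close>. Hypothesis and conclusion are inclusions, so that the lemma
  applies to \<open>G\<close> as well, which gives the equality in
  \<open>weak_flag_push\<close>.\<close>

lemma weak_flag_push_subset:
  assumes V: "openin (Euclidean_space n) V" and F: "smooth_map n V m F"
    and W: "openin (Euclidean_space m) W" and G: "smooth_map m W n G"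
    and FG: "F ` V \<subseteq> W" "G ` W \<subseteq> V" "\<And>x. x \<in> V \<Longrightarrow> G (F x) = x" "\<And>y. y \<in> W \<Longrightarrow> F (G y) = y"
    and DE: "\<And>x. x \<in> V \<Longrightarrow> differential n F x ` D x \<subseteq> E (F x)"
    and x: "x \<in> V"
  shows "differential n F x ` weak_flag n V D i x \<subseteq> weak_flag m W E i (F x)"
  using x
proof (induction i arbitrary: x)
  case 0
  show ?case
    unfolding weak_flag.simps image_insert image_empty linear_0[OF linear_differential] by (rule subset_refl)
next
  case (Suc i)
  show ?case
  proof (cases i)
    case 0
    then show ?thesis using DE Suc by auto
  next
    case (Suc k)
    \<comment> \<open>General \<open>D'\<close> and \<open>E'\<close>, because sections of
      \<open>D\<close> itself and of the previous step of the flag both have to be pushed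
      forward.\<close>
    have push: "is_section m E' (F ` U) (\<lambda>y. differential n F (G y) (X (G y)))"
      if sec: "is_section n D' U X" and U: "openin (Euclidean_space n) U" "U \<subseteq> V"
        and DE': "\<And>x. x \<in> V \<Longrightarrow> differential n F x ` D' x \<subseteq> E' (F x)" for D' E' U X
      unfolding is_section_def
    proof
      have oF: "openin (Euclidean_space m) (F ` U)" by (rule open_image_diffeo[OF F W G FG U])
      have GU: "G ` F ` U \<subseteq> U" using FG U by (auto simp: subset_iff)
      have G': "smooth_map m (F ` U) n G" by (rule smooth_map_subset[OF G]) (use FG U in blast)
      have X: "smooth_map n U n X" using sec by (simp add: is_section_def)
      have "smooth_map n U m (\<lambda>x. differential n F x (X x))"
        unfolding smooth_map_def
      proof (intro conjI allI impI)
        show "(\<lambda>x. differential n F x (X x)) ` U \<subseteq> space_R m"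
          using differential_in_space_R[OF V F] U by blast
        show "smooth n U (\<lambda>x. differential n F x (X x) i)" if "i < m" for i
          unfolding differential_apply ddir_def
          by (intro smooth_sum[OF U(1)] smooth_mult[OF U(1)] smooth_map_component[OF U(1) X]
              smooth_partial[OF smooth_map_component[OF U(1) smooth_map_subset[OF F U(2)]]]) auto
      qed
      from smooth_map_compose[OF oF U(1) G' GU this]
      show "smooth_map m (F ` U) m (\<lambda>y. differential n F (G y) (X (G y)))" .
      show "\<forall>y\<in>F ` U. differential n F (G y) (X (G y)) \<in> E' y"
      proof
        fix y assume "y \<in> F ` U"
        then obtain x where x: "x \<in> U" "y = F x" by auto
        then have "X x \<in> D' x" "x \<in> V" using sec U by (auto simp: is_section_def)
        then show "differential n F (G y) (X (G y)) \<in> E' y" using x DE' FG by auto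
      qed
    qed
    show ?thesis
      unfolding Suc weak_flag.simps linear_span_image[OF linear_differential, symmetric]
    proof (intro span_mono subsetI)
      fix w assume "w \<in> differential n F x ` {lie_bracket n X Y x |X Y Va. openin (Euclidean_space n) Va \<and>
         x \<in> Va \<and> Va \<subseteq> V \<and> is_section n D Va X \<and> is_section n (weak_flag n V D (Suc k)) Va Y}"
      then obtain X Y U where h: "w = differential n F x (lie_bracket n X Y x)" "openin (Euclidean_space n) U"
        "x \<in> U" "U \<subseteq> V" "is_section n D U X" "is_section n (weak_flag n V D (Suc k)) U Y" by blast
      let ?p = "\<lambda>X y. differential n F (G y) (X (G y))"
      have oF: "openin (Euclidean_space m) (F ` U)" by (rule open_image_diffeo[OF F W G FG h(2,4)])
      have X: "is_section m E (F ` U) (?p X)" by (rule push[OF h(5,2,4) DE])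
      have Y: "is_section m (weak_flag m W E (Suc k)) (F ` U) (?p Y)"
        by (rule push[OF h(6,2,4)]) (use Suc.IH Suc in auto)
      have "lie_bracket m (?p X) (?p Y) (F x) = differential n F x (lie_bracket n X Y x)"
        by (rule lie_bracket_related[OF h(2) oF smooth_map_subset[OF F h(4)] subset_refl])
          (use h X Y FG in \<open>auto simp: is_section_def subset_iff\<close>)
      then show "w \<in> {lie_bracket m X Y (F x) |X Y V. openin (Euclidean_space m) V \<and>
         F x \<in> V \<and> V \<subseteq> W \<and> is_section m E V X \<and> is_section m (weak_flag m W E (Suc k)) V Y}"
        using h oF X Y FG by (intro CollectI exI[of _ "?p X"] exI[of _ "?p Y"] exI[of _ "F ` U"]) auto
    qed
  qed
qed

lemma weak_flag_push:
  assumes V: "openin (Euclidean_space n) V" and F: "smooth_map n V m F"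
    and W: "openin (Euclidean_space m) W" and G: "smooth_map m W n G"
    and FG: "F ` V \<subseteq> W" "G ` W \<subseteq> V" "\<And>x. x \<in> V \<Longrightarrow> G (F x) = x" "\<And>y. y \<in> W \<Longrightarrow> F (G y) = y"
    and DE: "\<And>x. x \<in> V \<Longrightarrow> differential n F x ` D x = E (F x)"
    and D: "\<And>x. x \<in> V \<Longrightarrow> D x \<subseteq> space_R n" and E: "\<And>y. y \<in> W \<Longrightarrow> E y \<subseteq> space_R m"
    and x: "x \<in> V"
  shows "weak_flag m W E i (F x) = differential n F x ` weak_flag n V D i x"
    "inj_on (differential n F x) (space_R n)" "differential n F x ` space_R n = space_R m"
proof -
  have gf: "differential m G (F x) (differential n F x v) = v" if "x \<in> V" "v \<in> space_R n" for x v
    using differential_compose[OF V W F FG(1) G that(1), of v]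
      differential_cong[OF V _ that(1), of "\<lambda>y. G (F y)" "\<lambda>y. y"] FG(3) differential_id[OF that(2)] by simp
  have fg: "differential n F (G y) (differential m G y v) = v" if "y \<in> W" "v \<in> space_R m" for y v
    using differential_compose[OF W V G FG(2) F that(1), of v]
      differential_cong[OF W _ that(1), of "\<lambda>y. F (G y)" "\<lambda>y. y"] FG(4) differential_id[OF that(2)] by simp
  show "inj_on (differential n F x) (space_R n)" by (rule inj_onI) (metis gf x)
  have Fx: "F x \<in> W" using FG x by blast
  show "differential n F x ` space_R n = space_R m"
  proof
    show "space_R m \<subseteq> differential n F x ` space_R n"
      using fg[OF Fx] FG(3)[OF x] differential_in_space_R[OF W G Fx] by (metis image_eqI subsetI)
  qed (use differential_in_space_R[OF V F x] in blast)
  have GE: "differential m G y ` E y \<subseteq> D (G y)" if y: "y \<in> W" for y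
  proof -
    have Gy: "G y \<in> V" using FG y by blast
    have "E y = differential n F (G y) ` D (G y)" using DE[OF Gy] FG(4)[OF y] by simp
    then show ?thesis using gf[OF Gy] FG(4)[OF y] D[OF Gy] by auto
  qed
  have sub: "weak_flag m W E i (F x) \<subseteq> space_R m"
    by (rule weak_flag_subset_space_R) (rule E[OF Fx])
  have incl: "differential m G (F x) ` weak_flag m W E i (F x) \<subseteq> weak_flag n V D i x"
    using weak_flag_push_subset[OF W G V F FG(2,1,4,3) GE Fx, of i] FG(3)[OF x] by simp
  have "weak_flag m W E i (F x) \<subseteq> differential n F x ` weak_flag n V D i x"
  proof (intro subsetI)
    fix v assume v: "v \<in> weak_flag m W E i (F x)"
    with incl have "differential m G (F x) v \<in> weak_flag n V D i x" by blast
    moreover have "v = differential n F x (differential m G (F x) v)"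
      using fg[OF Fx] FG(3)[OF x] v sub by auto
    ultimately show "v \<in> differential n F x ` weak_flag n V D i x" by blast
  qed
  with weak_flag_push_subset[OF V F W G FG _ x, of D E i] DE
  show "weak_flag m W E i (F x) = differential n F x ` weak_flag n V D i x" by blast
qed

section \<open>The weak derived flag of an invariant distribution\<close>

lemma ddir_sum:
  assumes "finite I" "\<And>i. i \<in> I \<Longrightarrow> has_partials n U (f i)" "x \<in> U"
  shows "ddir n (\<lambda>x. \<Sum>i\<in>I. f i x) x v = (\<Sum>i\<in>I. ddir n (f i) x v)"
  unfolding ddir_def using partial_sum[OF assms] by (subst sum.swap) (simp add: sum_distrib_right)

lemma ddir_mult:
  assumes "has_partials n U f" "has_partials n U g" "x \<in> U"
  shows "ddir n (\<lambda>x. f x * g x) x v = ddir n f x v * g x + f x * ddir n g x v"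
  using partial_mult[OF assms]
  by (simp add: ddir_def distrib_right sum.distrib sum_distrib_left sum_distrib_right algebra_simps)

lemma ddir_const [simp]: "ddir n (\<lambda>x. c) x v = 0"
  by (simp add: ddir_def)

lemma coord_vec_in_space_R: "i < n \<Longrightarrow> coord_vec i \<in> space_R n"
  by (auto simp: coord_vec_def space_R_iff)

lemma coord_vec_expansion:
  assumes "u \<in> space_R n" shows "u = (\<Sum>k<n. u k *\<^sub>R coord_vec k)"
proof
  fix i
  have "(\<Sum>k<n. u k *\<^sub>R coord_vec k) i = (\<Sum>k<n. if k = i then u k else 0)"
    unfolding sum_pt_apply scaleR_pt_apply coord_vec_def by (intro sum.cong) auto
  also have "\<dots> = u i" using assms by (auto simp: space_R_iff)
  finally show "u i = (\<Sum>k<n. u k *\<^sub>R coord_vec k) i" by simp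
qed

lemma linear_expansion:
  fixes L :: "pt \<Rightarrow> 'a::real_vector"
  assumes "linear L" "u \<in> space_R n" shows "L u = (\<Sum>k<n. u k *\<^sub>R L (coord_vec k))"
  using arg_cong[OF coord_vec_expansion[OF assms(2)], of L]
  by (simp add: linear_sum[OF assms(1)] linear_scale[OF assms(1)])

text \<open>A linear projection \<open>p\<close> onto \<open>W\<close> satisfies
  \<open>p (k y) = k y\<close> on \<open>V\<close>, and this identity can be differentiated. The
  lemma keeps derivatives of the coefficients of a section inside the same step of the flag.\<close>

lemma differential_in_subspace:
  assumes V: "openin (Euclidean_space n) V" and k: "smooth_map n V m k" and W: "subspace W" "W \<subseteq> space_R m"
    and kW: "\<And>y. y \<in> V \<Longrightarrow> k y \<in> W" and x: "x \<in> V"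
  shows "differential n k x v \<in> W"
proof -
  obtain p :: "pt \<Rightarrow> pt" where p: "p ` UNIV \<subseteq> W" "linear p" "\<And>w. w \<in> W \<Longrightarrow> p w = w"
    using linear_exists_left_inverse_on[of "\<lambda>x. x" W] W(1) by (auto simp: linear_id[unfolded id_def])
  have kp: "k y i = (\<Sum>j<m. k y j * p (coord_vec j) i)" if "y \<in> V" for y i
    using fun_cong[OF linear_expansion[OF p(2), of "k y" m], of i] p(3)[OF kW[OF that]] kW[OF that] W(2)
    by (simp add: sum_pt_apply scaleR_pt_apply subset_iff)
  note hp = smooth_has_partials[OF smooth_map_component[OF V k]]
  have "differential n k x v i = p (differential n k x v) i" for i
  proof -
    have "differential n k x v i = ddir n (\<lambda>y. \<Sum>j<m. k y j * p (coord_vec j) i) x v"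
      unfolding differential_apply by (rule ddir_cong[OF V _ x]) (rule kp)
    also have "\<dots> = (\<Sum>j<m. ddir n (\<lambda>y. k y j * p (coord_vec j) i) x v)"
      by (rule ddir_sum[OF _ _ x]) (auto intro!: has_partials_mult hp has_partials_const)
    also have "\<dots> = (\<Sum>j<m. differential n k x v j * p (coord_vec j) i)"
      by (simp add: ddir_mult[OF hp has_partials_const x] differential_apply)
    also have "\<dots> = p (differential n k x v) i"
      using fun_cong[OF linear_expansion[OF p(2) differential_in_space_R[OF V k x, of v]], of i]
      by (simp add: sum_pt_apply scaleR_pt_apply)
    finally show ?thesis .
  qed
  then have "differential n k x v = p (differential n k x v)" by (rule ext)
  then show ?thesis using p(1) by (metis UNIV_I image_subset_iff)
qed

text \<open>The counterpart of \<open>weak_flag\<close> for constant coefficients. The previous step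
  is added explicitly: brackets of constants need not reproduce it, whereas brackets of sections do
  so through the derivatives of their coefficients.\<close>

fun alg_flag :: "(pt \<Rightarrow> pt \<Rightarrow> pt) \<Rightarrow> pt set \<Rightarrow> nat \<Rightarrow> pt set"
  where
    "alg_flag b H 0 = {0}"
  | "alg_flag b H (Suc 0) = H"
  | "alg_flag b H (Suc (Suc i)) =
      span ({b u v | u v. u \<in> H \<and> v \<in> alg_flag b H (Suc i)} \<union> alg_flag b H (Suc i))"

section \<open>Frames with constant structure coefficients\<close>

text \<open>
  A trivialisation \<open>P x\<close> of the tangent bundle for which the fields \<open>\<lambda>x. P x u\<close> form a Lie algebra
  with bracket \<open>b\<close>. It is what left-invariant fields on a Lie group and the Hilbert--Cartan frame have in common.
\<close>

locale parallelism =
  fixes n :: nat and U :: "pt set" and P Q :: "pt \<Rightarrow> pt \<Rightarrow> pt" and b :: "pt \<Rightarrow> pt \<Rightarrow> pt"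
  assumes open_U: "openin (Euclidean_space n) U"
    and linear_P: "x \<in> U \<Longrightarrow> linear (P x)"
    and linear_Q: "x \<in> U \<Longrightarrow> linear (Q x)"
    and smooth_P: "u \<in> space_R n \<Longrightarrow> smooth_map n U n (\<lambda>x. P x u)"
    and smooth_Q: "openin (Euclidean_space n) V \<Longrightarrow> V \<subseteq> U \<Longrightarrow> smooth_map n V n X \<Longrightarrow>
      smooth_map n V n (\<lambda>x. Q x (X x))"
    and P_Q: "x \<in> U \<Longrightarrow> w \<in> space_R n \<Longrightarrow> P x (Q x w) = w"
    and Q_P: "x \<in> U \<Longrightarrow> u \<in> space_R n \<Longrightarrow> Q x (P x u) = u"
    and bracket_P: "x \<in> U \<Longrightarrow> u \<in> space_R n \<Longrightarrow> v \<in> space_R n \<Longrightarrow>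
      lie_bracket n (\<lambda>y. P y u) (\<lambda>y. P y v) x = P x (b u v)"
    and bilinear_b: "bilinear b"
    and b_in_space: "u \<in> space_R n \<Longrightarrow> v \<in> space_R n \<Longrightarrow> b u v \<in> space_R n"
begin

lemma P_in_space: "x \<in> U \<Longrightarrow> u \<in> space_R n \<Longrightarrow> P x u \<in> space_R n"
  using smooth_map_in_space[OF smooth_P] .

lemma Q_in_space: "x \<in> U \<Longrightarrow> w \<in> space_R n \<Longrightarrow> Q x w \<in> space_R n"
  using smooth_map_in_space[OF smooth_Q[OF open_U subset_refl smooth_map_const[OF _ open_U]]] .

lemma P_image_space: "x \<in> U \<Longrightarrow> P x ` space_R n = space_R n"
  using P_in_space Q_in_space P_Q by (auto simp: image_iff) metis

lemma inj_on_P: "x \<in> U \<Longrightarrow> inj_on (P x) (space_R n)"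
  by (rule inj_on_inverseI) (rule Q_P)

lemma P_apply_expansion:
  "y \<in> U \<Longrightarrow> u \<in> space_R n \<Longrightarrow> P y u i = (\<Sum>k<n. u k * P y (coord_vec k) i)"
  using fun_cong[OF linear_expansion[OF linear_P], of y u n i] by (simp add: sum_pt_apply scaleR_pt_apply)

lemma smooth_P_section:
  assumes V: "openin (Euclidean_space n) V" "V \<subseteq> U" and k: "smooth_map n V n k"
  shows "smooth_map n V n (\<lambda>y. P y (k y))"
  unfolding smooth_map_def
proof (intro conjI allI impI)
  show "(\<lambda>y. P y (k y)) ` V \<subseteq> space_R n"
    using P_in_space smooth_map_in_space[OF k] V(2) by blast
  fix i assume "i < n"
  have "smooth n V (\<lambda>y. \<Sum>j<n. k y j * P y (coord_vec j) i)"
    using smooth_map_component[OF V(1) smooth_map_subset[OF smooth_P V(2)]] coord_vec_in_space_R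
    by (intro smooth_sum[OF V(1)] smooth_mult[OF V(1)] smooth_map_component[OF V(1) k]) auto
  then show "smooth n V (\<lambda>y. P y (k y) i)"
    by (rule smooth_cong[OF V(1), rotated])
      (use P_apply_expansion smooth_map_in_space[OF k] V(2) in \<open>auto simp: subset_iff\<close>)
qed

lemma differential_P_section:
  assumes V: "openin (Euclidean_space n) V" "V \<subseteq> U" and k: "smooth_map n V n k" and x: "x \<in> V"
  shows "differential n (\<lambda>y. P y (k y)) x v =
    P x (differential n k x v) + differential n (\<lambda>y. P y (k x)) x v"
proof
  fix i
  have xU: "x \<in> U" using x V by blast
  have sP: "has_partials n V (\<lambda>y. P y (coord_vec j) i)" if "j < n" for j
    by (rule smooth_has_partials[OF smooth_map_component[OF V(1) smooth_map_subset[OF smooth_P V(2)]]])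
      (rule coord_vec_in_space_R[OF that])
  note hk = smooth_has_partials[OF smooth_map_component[OF V(1) k]]
  have exp: "ddir n (\<lambda>y. P y (f y) i) x v =
      (\<Sum>j<n. ddir n (\<lambda>y. f y j) x v * P x (coord_vec j) i + f x j * ddir n (\<lambda>y. P y (coord_vec j) i) x v)"
    if f: "\<And>j. has_partials n V (\<lambda>y. f y j)" "\<And>y. y \<in> V \<Longrightarrow> f y \<in> space_R n" for f
  proof -
    have "ddir n (\<lambda>y. P y (f y) i) x v = ddir n (\<lambda>y. \<Sum>j<n. f y j * P y (coord_vec j) i) x v"
      by (rule ddir_cong[OF V(1) _ x]) (use P_apply_expansion f(2) V(2) in auto)
    also have "\<dots> = (\<Sum>j<n. ddir n (\<lambda>y. f y j * P y (coord_vec j) i) x v)"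
      by (rule ddir_sum[OF _ _ x]) (auto intro!: has_partials_mult f sP)
    also have "\<dots> = (\<Sum>j<n. ddir n (\<lambda>y. f y j) x v * P x (coord_vec j) i + f x j * ddir n (\<lambda>y. P y (coord_vec j) i) x v)"
      by (intro sum.cong refl ddir_mult[OF f(1) sP x]) auto
    finally show ?thesis .
  qed
  have "differential n (\<lambda>y. P y (k y)) x v i = (\<Sum>j<n. differential n k x v j * P x (coord_vec j) i)
      + (\<Sum>j<n. k x j * ddir n (\<lambda>y. P y (coord_vec j) i) x v)"
    unfolding differential_apply using exp[OF hk smooth_map_in_space[OF k]] by (simp add: sum.distrib)
  also have "(\<Sum>j<n. differential n k x v j * P x (coord_vec j) i) = P x (differential n k x v) i"
    by (rule P_apply_expansion[OF xU, symmetric]) (rule differential_in_space_R[OF V(1) k x])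
  also have "(\<Sum>j<n. k x j * ddir n (\<lambda>y. P y (coord_vec j) i) x v) = differential n (\<lambda>y. P y (k x)) x v i"
    unfolding differential_apply
    using exp[of "\<lambda>y. k x"] smooth_map_in_space[OF k x] by (simp add: has_partials_const)
  finally show "differential n (\<lambda>y. P y (k y)) x v i =
      (P x (differential n k x v) + differential n (\<lambda>y. P y (k x)) x v) i" by simp
qed

text \<open>The Leibniz rule in the frame. The terms in which the frame is differentiated form the
  bracket of the two fields with coefficients frozen at \<open>x\<close>, which
  \<open>bracket_P\<close> evaluates; the other two terms differentiate the coefficients.\<close>

lemma lie_bracket_P_sections:
  assumes V: "openin (Euclidean_space n) V" "V \<subseteq> U" and h: "smooth_map n V n h" and k: "smooth_map n V n k"
    and x: "x \<in> V"
  shows "lie_bracket n (\<lambda>y. P y (h y)) (\<lambda>y. P y (k y)) x =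
    P x (b (h x) (k x) + differential n k x (P x (h x)) - differential n h x (P x (k x)))"
proof -
  have xU: "x \<in> U" using x V by blast
  have "lie_bracket n (\<lambda>y. P y (h y)) (\<lambda>y. P y (k y)) x =
     P x (differential n k x (P x (h x))) - P x (differential n h x (P x (k x))) +
     lie_bracket n (\<lambda>y. P y (h x)) (\<lambda>y. P y (k x)) x"
    unfolding lie_bracket_def differential_P_section[OF V h x] differential_P_section[OF V k x]
    by (simp add: algebra_simps)
  also have "lie_bracket n (\<lambda>y. P y (h x)) (\<lambda>y. P y (k x)) x = P x (b (h x) (k x))"
    by (rule bracket_P[OF xU smooth_map_in_space[OF h x] smooth_map_in_space[OF k x]])
  finally show ?thesis
    by (simp add: linear_add[OF linear_P[OF xU]] linear_diff[OF linear_P[OF xU]] fun_eq_iff)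
qed

context
  fixes H :: "pt set" and D :: dist
  assumes H: "subspace H" "H \<subseteq> space_R n" "H \<noteq> {0}" and D: "\<And>x. x \<in> U \<Longrightarrow> D x = P x ` H"
begin

lemma alg_flag_subspace: "subspace (alg_flag b H i)"
proof (cases i)
  case (Suc j)
  then show ?thesis using H by (cases j) simp_all
qed (simp add: subspace_single_0)

lemma alg_flag_subset: "alg_flag b H i \<subseteq> space_R n"
proof (induction i)
  case (Suc i)
  show ?case
  proof (cases i)
    case (Suc k)
    have "{b u v | u v. u \<in> H \<and> v \<in> alg_flag b H (Suc k)} \<union> alg_flag b H (Suc k) \<subseteq> space_R n"
      using Suc.IH b_in_space H(2) unfolding Suc by blast
    then show ?thesis unfolding Suc alg_flag.simps by (rule span_minimal[OF _ subspace_space_R])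
  qed (use H in simp)
qed (simp add: space_R_iff)

lemma section_coefficients:
  assumes "is_section n D' V X" "openin (Euclidean_space n) V" "V \<subseteq> U"
    "\<And>x. x \<in> V \<Longrightarrow> D' x = P x ` W" "W \<subseteq> space_R n"
  shows "smooth_map n V n (\<lambda>x. Q x (X x))" "\<And>x. x \<in> V \<Longrightarrow> Q x (X x) \<in> W" "\<And>x. x \<in> V \<Longrightarrow> X x = P x (Q x (X x))"
proof -
  have X: "smooth_map n V n X" "\<And>x. x \<in> V \<Longrightarrow> X x \<in> D' x" using assms(1) by (auto simp: is_section_def)
  show "smooth_map n V n (\<lambda>x. Q x (X x))" by (rule smooth_Q[OF assms(2,3) X(1)])
  fix x assume x: "x \<in> V"
  then obtain w where "w \<in> W" "X x = P x w" using X(2)[OF x] assms(4) by blast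
  then show "Q x (X x) \<in> W" "X x = P x (Q x (X x))"
    using Q_P[of x w] subsetD[OF assms(3) x] subsetD[OF assms(5), of w] by auto
qed

text \<open>Both inclusions rest on \<open>lie_bracket_P_sections\<close>. Its derivative terms stay
  in the previous step by \<open>differential_in_subspace\<close>, and constant coefficients realise
  every \<open>b u v\<close>. A vector of the previous step itself arises from bracketing a constant
  section with a section that vanishes at \<open>x\<close>.\<close>

lemma weak_flag_parallel: "x \<in> U \<Longrightarrow> weak_flag n U D i x = P x ` alg_flag b H i"
proof (induction i arbitrary: x)
  case 0
  show ?case
    unfolding weak_flag.simps alg_flag.simps image_insert image_empty linear_0[OF linear_P[OF 0]] ..
next
  case (Suc i)
  show ?case
  proof (cases i)
    case 0
    then show ?thesis using D Suc.prems by simp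
  next
    case (Suc k)
    let ?W = "alg_flag b H (Suc k)"
    let ?Br = "{lie_bracket n X Y x | X Y V. openin (Euclidean_space n) V \<and> x \<in> V \<and> V \<subseteq> U \<and>
              is_section n D V X \<and> is_section n (weak_flag n U D (Suc k)) V Y}"
    let ?S = "{b u v | u v. u \<in> H \<and> v \<in> ?W} \<union> ?W"
    note xU = Suc.prems
    have IH: "\<And>x. x \<in> U \<Longrightarrow> weak_flag n U D (Suc k) x = P x ` ?W" using Suc.IH Suc by simp
    have W: "subspace ?W" "?W \<subseteq> space_R n" by (rule alg_flag_subspace, rule alg_flag_subset)
    have HW: "H \<subseteq> ?W"
    proof (induction k)
      case (Suc k)
      then show ?case unfolding alg_flag.simps(3) using span_superset by blast
    qed simp
    have "span ?Br \<subseteq> P x ` span ?S"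
    proof (rule span_minimal)
      show "subspace (P x ` span ?S)" by (rule linear_subspace_image[OF linear_P[OF xU] subspace_span])
      show "?Br \<subseteq> P x ` span ?S"
      proof
        fix w assume "w \<in> ?Br"
        then obtain X Y V where V: "w = lie_bracket n X Y x" "openin (Euclidean_space n) V" "x \<in> V" "V \<subseteq> U"
          "is_section n D V X" "is_section n (weak_flag n U D (Suc k)) V Y" by blast
        let ?h = "\<lambda>x. Q x (X x)" and ?k = "\<lambda>x. Q x (Y x)"
        have "D x = P x ` H" if "x \<in> V" for x using D V(4) that by blast
        note h = section_coefficients[OF V(5,2,4) this H(2), simplified]
        have "weak_flag n U D (Suc k) x = P x ` ?W" if "x \<in> V" for x using IH V(4) that by blast
        note k = section_coefficients[OF V(6,2,4) this W(2), simplified]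
        have "w = lie_bracket n (\<lambda>y. P y (?h y)) (\<lambda>y. P y (?k y)) x"
          unfolding V(1) lie_bracket_def h(3)[OF V(3),symmetric] k(3)[OF V(3),symmetric]
          using differential_cong[OF V(2) h(3) V(3)] differential_cong[OF V(2) k(3) V(3)] by simp
        also have "\<dots> = P x (b (?h x) (?k x) + differential n ?k x (P x (?h x)) - differential n ?h x (P x (?k x)))"
          by (rule lie_bracket_P_sections[OF V(2,4) h(1) k(1) V(3)])
        also have "\<dots> \<in> P x ` span ?S"
        proof (intro imageI subspace_diff[OF subspace_span] subspace_add[OF subspace_span] span_base)
          show "b (?h x) (?k x) \<in> ?S" using h(2)[OF V(3)] k(2)[OF V(3)] by blast
          show "differential n ?k x (P x (?h x)) \<in> ?S"
            using differential_in_subspace[OF V(2) k(1) W k(2) V(3)] by blast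
          show "differential n ?h x (P x (?k x)) \<in> ?S"
            using differential_in_subspace[OF V(2) h(1) H(1,2) h(2) V(3)] HW by blast
        qed
        finally show "w \<in> P x ` span ?S" .
      qed
    qed
    moreover have "P x ` span ?S \<subseteq> span ?Br"
      unfolding linear_span_image[OF linear_P[OF xU], symmetric]
    proof (intro span_minimal subspace_span subsetI)
      have secH: "is_section n D U (\<lambda>y. P y u)" if "u \<in> H" for u
        using that H D smooth_P by (auto simp: is_section_def)
      fix w assume "w \<in> P x ` ?S"
      then consider u v where "w = P x (b u v)" "u \<in> H" "v \<in> ?W" | v where "w = P x v" "v \<in> ?W"
        by blast
      then show "w \<in> span ?Br"
      proof cases
        case 1
        have "is_section n (weak_flag n U D (Suc k)) U (\<lambda>y. P y v)"
          using 1(3) W(2) IH smooth_P by (auto simp: is_section_def)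
        moreover have "w = lie_bracket n (\<lambda>y. P y u) (\<lambda>y. P y v) x"
          using bracket_P[OF xU, of u v] 1 subsetD[OF H(2)] subsetD[OF W(2)] by simp
        ultimately have "w \<in> ?Br"
          using secH[OF 1(2)] open_U xU
          by (intro CollectI exI[of _ "\<lambda>y. P y u"] exI[of _ "\<lambda>y. P y v"] exI[of _ U] conjI) auto
        then show ?thesis by (rule span_base)
      next
        case 2
        obtain u where u: "u \<in> H" "u \<noteq> 0" using H(1,3) subspace_0 by blast
        have "P x u \<noteq> 0"
          using inj_onD[OF inj_on_P[OF xU], of u 0] u H(2) linear_0[OF linear_P[OF xU]] subspace_0[OF subspace_space_R] by auto
        then obtain i where i: "P x u i \<noteq> 0" by (auto simp: fun_eq_iff)
        \<comment> \<open>Normalises the coordinate function, so that \<open>c * (y i - x i)\<close>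
          has derivative 1 along \<open>P x u\<close>.\<close>
        define c where "c = 1 / P x u i"
        have i_n: "i < n"
        proof (rule ccontr)
          assume "\<not> i < n"
          then show False using P_in_space[OF xU, of u] u(1) H(2) i by (auto simp: space_R_iff)
        qed
        \<comment> \<open>Since \<open>k'\<close> vanishes at \<open>x\<close> and has derivative
          \<open>v\<close> along \<open>P x u\<close>, the bracket of the two sections at
          \<open>x\<close> is exactly \<open>P x v\<close>.\<close>
        define k' where "k' y = (c * (y i - x i)) *\<^sub>R v" for y :: pt
        have vW: "v \<in> space_R n" using 2 W by blast
        have s1: "smooth n U (\<lambda>y. y i - x i)"
          by (rule smooth_diff[OF open_U smooth_coord[OF open_U] smooth_const[OF open_U]])
        have "smooth n U (\<lambda>y. c * (y i - x i) * v j)" for j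
          by (rule smooth_mult[OF open_U smooth_mult[OF open_U smooth_const[OF open_U] s1] smooth_const[OF open_U]])
        then have "smooth n U (\<lambda>y. k' y j)" for j unfolding k'_def scaleR_pt_apply .
        moreover have "k' y \<in> space_R n" for y using subspace_scale[OF subspace_space_R vW] by (simp add: k'_def)
        ultimately have k': "smooth_map n U n k'" unfolding smooth_map_def by blast
        have k'W: "k' y \<in> ?W" for y using subspace_scale[OF W(1) 2(2)] by (simp add: k'_def)
        have dk': "differential n k' x (P x u) = v"
        proof
          fix j
          have "differential n k' x (P x u) j = ddir n (\<lambda>y. (c * v j) * (y i - x i)) x (P x u)"
            by (simp add: differential_apply k'_def scaleR_pt_apply mult_ac)
          also have "\<dots> = (c * v j) * ddir n (\<lambda>y. y i - x i) x (P x u)"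
            by (simp add: ddir_mult[OF has_partials_const smooth_has_partials[OF s1] xU])
          also have "ddir n (\<lambda>y. y i - x i) x (P x u) = ddir n (\<lambda>y. y i) x (P x u)"
            unfolding ddir_def
            by (simp add: partial_diff[OF smooth_has_partials[OF smooth_coord[OF open_U]] has_partials_const xU])
          finally show "differential n k' x (P x u) j = v j" using i by (simp add: ddir_coord[OF i_n] c_def)
        qed
        have "lie_bracket n (\<lambda>y. P y u) (\<lambda>y. P y (k' y)) x =
          P x (b u (k' x) + differential n k' x (P x u) - differential n (\<lambda>y. u) x (P x (k' x)))"
          using lie_bracket_P_sections[OF open_U subset_refl smooth_map_const[OF _ open_U] k' xU, of u] u H(2) by auto
        also have "k' x = 0" by (simp add: k'_def)
        also have "differential n (\<lambda>y. u) x (P x 0) = 0" by (auto simp: fun_eq_iff differential_apply)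
        also have "b u 0 = 0" using bilinear_b by (rule bilinear_rzero)
        finally have "w = lie_bracket n (\<lambda>y. P y u) (\<lambda>y. P y (k' y)) x"
          using 2 dk' by simp
        moreover have "is_section n (weak_flag n U D (Suc k)) U (\<lambda>y. P y (k' y))"
          using k'W IH smooth_P_section[OF open_U subset_refl k'] by (auto simp: is_section_def)
        ultimately have "w \<in> ?Br"
          using secH[OF u(1)] open_U xU
          by (intro CollectI exI[of _ "\<lambda>y. P y u"] exI[of _ "\<lambda>y. P y (k' y)"] exI[of _ U] conjI) auto
        then show ?thesis by (rule span_base)
      qed
    qed
    ultimately show ?thesis unfolding Suc weak_flag.simps alg_flag.simps by (rule equalityI)
  qed
qed

end

end

section \<open>Left-invariant fields on a Lie group\<close>

text \<open>The inverse of the encoding by \<open>fst_half\<close> and \<open>snd_half\<close>. It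
  presents products of variable group elements as compositions with a smooth map on
  \<open>space_R (2 * n)\<close>.\<close>

definition join_halves :: "nat \<Rightarrow> pt \<Rightarrow> pt \<Rightarrow> pt"
  where "join_halves n x y = (\<lambda>i. if i < n then x i else if i < 2 * n then y (i - n) else 0)"

lemma join_halves_in_space: "join_halves n x y \<in> space_R (2 * n)"
  by (auto simp: space_R_iff join_halves_def)

lemma
  assumes "x \<in> space_R n" "y \<in> space_R n"
  shows fst_half_join: "fst_half n (join_halves n x y) = x" and snd_half_join: "snd_half n (join_halves n x y) = y"
  using assms by (auto simp: fst_half_def snd_half_def join_halves_def space_R_iff fun_eq_iff)

lemma smooth_map_join_halves:
  assumes V: "openin (Euclidean_space k) V" and a: "smooth_map k V n a" and c: "smooth_map k V n c"
  shows "smooth_map k V (2 * n) (\<lambda>x. join_halves n (a x) (c x))"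
  unfolding smooth_map_def
proof (intro conjI allI impI)
  fix i assume "i < 2 * n"
  then have "(\<lambda>x. join_halves n (a x) (c x) i) = (if i < n then (\<lambda>x. a x i) else (\<lambda>x. c x (i - n)))"
    by (auto simp: join_halves_def)
  then show "smooth k V (\<lambda>x. join_halves n (a x) (c x) i)"
    using smooth_map_component[OF V a] smooth_map_component[OF V c] by simp
qed (use join_halves_in_space in blast)

locale Rn_lie_group =
  fixes n :: nat and G (structure)
  assumes lie_group: "lie_group n G"
begin

sublocale group G
  using lie_group by (simp add: lie_group_def)

lemma carrier_eq: "carrier G = space_R n"
  using lie_group by (simp add: lie_group_def)

lemma mult_in_space: "x \<in> space_R n \<Longrightarrow> y \<in> space_R n \<Longrightarrow> x \<otimes> y \<in> space_R n"
  using m_closed unfolding carrier_eq .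

lemma one_in_space: "\<one> \<in> space_R n"
  using one_closed unfolding carrier_eq .

lemma inv_in_space: "x \<in> space_R n \<Longrightarrow> inv x \<in> space_R n"
  using inv_closed unfolding carrier_eq .

lemma smooth_inv: "smooth_map n (space_R n) n (\<lambda>x. inv x)"
  using lie_group by (simp add: lie_group_def)

abbreviation mulcomp :: "nat \<Rightarrow> pt \<Rightarrow> real"
  where "mulcomp i z \<equiv> (fst_half n z \<otimes> snd_half n z) i"

lemma smooth_mulcomp: "smooth (2 * n) (space_R (2 * n)) (mulcomp i)"
  using smooth_map_component[OF openin_space_R, of "2 * n" n "\<lambda>z. fst_half n z \<otimes> snd_half n z" i] lie_group
  by (simp add: lie_group_def)

lemma mulcomp_join: "x \<in> space_R n \<Longrightarrow> y \<in> space_R n \<Longrightarrow> (x \<otimes> y) i = mulcomp i (join_halves n x y)"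
  by (simp add: fst_half_join snd_half_join)

lemma smooth_map_translation:
  assumes x: "x \<in> space_R n" shows "smooth_map n (space_R n) n (\<lambda>y. x \<otimes> y)"
  unfolding smooth_map_def
proof (intro conjI allI impI)
  fix i assume "i < n"
  have "smooth n (space_R n) (\<lambda>y. mulcomp i (join_halves n x y))"
    by (rule smooth_compose[OF openin_space_R openin_space_R smooth_map_join_halves[OF openin_space_R
        smooth_map_const[OF x openin_space_R] smooth_map_id[OF openin_space_R]] _ smooth_mulcomp])
      (use join_halves_in_space in blast)
  then show "smooth n (space_R n) (\<lambda>y. (x \<otimes> y) i)"
    by (rule smooth_cong[OF openin_space_R, rotated]) (simp only: mulcomp_join[OF x])
qed (use mult_in_space[OF x] in blast)

text \<open>Differentiating in the right factor means differentiating the multiplication in slot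
  \<open>n + j\<close>. In this form the derivative is visibly smooth in both factors
  together.\<close>

lemma partial_translation:
  assumes x: "x \<in> space_R n" and y: "y \<in> space_R n" and j: "j < n"
  shows "partial j (\<lambda>y'. (x \<otimes> y') i) y = partial (n + j) (mulcomp i) (join_halves n x y)"
proof -
  have "(join_halves n x y)(n + j := t) = join_halves n x (y(j := t))" for t
    using j by (auto simp: join_halves_def fun_eq_iff)
  moreover have "join_halves n x y (n + j) = y j" using j by (simp add: join_halves_def)
  ultimately show ?thesis
    unfolding partial_def by (simp only: mulcomp_join[OF x fun_upd_in_space_R[OF y j]])
qed

text \<open>The maps \<open>a\<close>, \<open>c\<close> and \<open>X\<close> are all variable, to
  cover the left-invariant fields (\<open>a x = x\<close>, \<open>c x = \<one>\<close>) as well as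
  the inverse trivialisation (\<open>a x = inv x\<close>, \<open>c x = x\<close>).\<close>

lemma smooth_map_translation_differential:
  assumes V: "openin (Euclidean_space n) V"
    and a: "smooth_map n V n a" and c: "smooth_map n V n c" and X: "smooth_map n V n X"
  shows "smooth_map n V n (\<lambda>x. differential n (\<lambda>y. a x \<otimes> y) (c x) (X x))"
  unfolding smooth_map_def
proof (intro conjI allI impI)
  show "(\<lambda>x. differential n (\<lambda>y. a x \<otimes> y) (c x) (X x)) ` V \<subseteq> space_R n"
    using differential_in_space_R[OF openin_space_R smooth_map_translation] smooth_map_in_space a c by blast
  fix i assume "i < n"
  have "smooth n V (\<lambda>x. partial (n + j) (mulcomp i) (join_halves n (a x) (c x)))" if "j < n" for j
    by (rule smooth_compose[OF V openin_space_R smooth_map_join_halves[OF V a c] _ smooth_partial[OF smooth_mulcomp]])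
      (use join_halves_in_space that in auto)
  then have "smooth n V (\<lambda>x. \<Sum>j<n. partial (n + j) (mulcomp i) (join_halves n (a x) (c x)) * X x j)"
    by (intro smooth_sum[OF V] smooth_mult[OF V] smooth_map_component[OF V X]) auto
  then show "smooth n V (\<lambda>x. differential n (\<lambda>y. a x \<otimes> y) (c x) (X x) i)"
  proof (rule smooth_cong[OF V, rotated])
    fix x assume "x \<in> V"
    then have "a x \<in> space_R n" "c x \<in> space_R n" using a c smooth_map_in_space by blast+
    from partial_translation[OF this]
    show "(\<Sum>j<n. partial (n + j) (mulcomp i) (join_halves n (a x) (c x)) * X x j) =
        differential n (\<lambda>y. a x \<otimes> y) (c x) (X x) i"
      by (simp add: differential_apply ddir_def)
  qed
qed

lemma differential_translation_compose:
  assumes "x \<in> space_R n" "x' \<in> space_R n" "y \<in> space_R n"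
  shows "differential n (\<lambda>y. x \<otimes> y) (x' \<otimes> y) (differential n (\<lambda>y. x' \<otimes> y) y v) =
    differential n (\<lambda>y. (x \<otimes> x') \<otimes> y) y v"
proof -
  have "differential n (\<lambda>y. x \<otimes> (x' \<otimes> y)) y v =
      differential n (\<lambda>y. x \<otimes> y) (x' \<otimes> y) (differential n (\<lambda>y. x' \<otimes> y) y v)"
    by (rule differential_compose[OF openin_space_R openin_space_R smooth_map_translation[OF assms(2)] _
        smooth_map_translation[OF assms(1)] assms(3)]) (use mult_in_space[OF assms(2)] in blast)
  moreover have "differential n (\<lambda>y. x \<otimes> (x' \<otimes> y)) y v = differential n (\<lambda>y. (x \<otimes> x') \<otimes> y) y v"
    by (rule differential_cong[OF openin_space_R _ assms(3)]) (use assms m_assoc carrier_eq in auto)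
  ultimately show ?thesis by simp
qed

lemma differential_translation_one:
  assumes "y \<in> space_R n" "v \<in> space_R n"
  shows "differential n (\<lambda>y. \<one> \<otimes> y) y v = v"
proof -
  have "differential n (\<lambda>y. \<one> \<otimes> y) y v = differential n (\<lambda>y. y) y v"
    by (rule differential_cong[OF openin_space_R _ assms(1)]) (use carrier_eq in auto)
  then show ?thesis using differential_id[OF assms(2)] by simp
qed

lemma left_field_translated:
  assumes "x \<in> space_R n" "y \<in> space_R n"
  shows "left_field n G v (x \<otimes> y) = differential n (\<lambda>y. x \<otimes> y) y (left_field n G v y)"
  using differential_translation_compose[OF assms one_in_space, of v] r_one[of y] assms
  by (simp add: left_field_def carrier_eq)

lemma left_field_smooth: "v \<in> space_R n \<Longrightarrow> smooth_map n (space_R n) n (left_field n G v)"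
  unfolding left_field_def
  by (rule smooth_map_translation_differential[OF openin_space_R smooth_map_id[OF openin_space_R]
      smooth_map_const[OF one_in_space openin_space_R] smooth_map_const[OF _ openin_space_R]])

text \<open>Left translation by \<open>x\<close> relates each left-invariant field to itself, hence
  also their bracket, whose value at \<open>\<one>\<close> is thereby transported to
  \<open>x\<close>.\<close>

lemma lie_bracket_left_field:
  assumes x: "x \<in> space_R n" and v: "v \<in> space_R n" and w: "w \<in> space_R n"
  shows "lie_bracket n (left_field n G v) (left_field n G w) x =
    left_field n G (lie_bracket n (left_field n G v) (left_field n G w) \<one>) x"
proof -
  have "lie_bracket n (left_field n G v) (left_field n G w) (x \<otimes> \<one>) =
     differential n (\<lambda>y. x \<otimes> y) \<one> (lie_bracket n (left_field n G v) (left_field n G w) \<one>)"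
    by (rule lie_bracket_related[OF openin_space_R openin_space_R smooth_map_translation[OF x]])
      (use mult_in_space[OF x] left_field_smooth v w left_field_translated[OF x] one_in_space in auto)
  then show ?thesis using x carrier_eq by (simp add: left_field_def)
qed

end

lemma lie_group_parallelism:
  assumes G: "lie_group n G" and b: "lie_algebra n b" and \<iota>: "lie_algebra_of_group n G b \<iota>"
  shows "\<exists>Q. parallelism n (space_R n) (\<lambda>x u. left_field n G (\<iota> u) x) Q b"
proof -
  interpret Rn_lie_group n G by unfold_locales (rule G)
  have lin: "linear \<iota>" and bij: "bij_betw \<iota> (space_R n) (space_R n)"
    and br: "\<And>u v. u \<in> space_R n \<Longrightarrow> v \<in> space_R n \<Longrightarrow>
       \<iota> (b u v) = lie_bracket n (left_field n G (\<iota> u)) (left_field n G (\<iota> v)) \<one>\<^bsub>G\<^esub>"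
    using \<iota> by (auto simp: lie_algebra_of_group_def)
  have \<iota>_sp: "\<iota> u \<in> space_R n" if "u \<in> space_R n" for u using bij that by (auto simp: bij_betw_def)
  \<comment> \<open>\<open>\<iota>\<close> is bijective on \<open>space_R n\<close> only. A left
    inverse that is linear on the whole type is what makes \<open>Q x\<close> linear in the sense of
    \<open>parallelism\<close>.\<close>
  obtain \<kappa> :: "pt \<Rightarrow> pt" where \<kappa>: "linear \<kappa>" "\<And>u. u \<in> space_R n \<Longrightarrow> \<kappa> (\<iota> u) = u"
    using linear_exists_left_inverse_on[OF lin subspace_space_R, of n] bij by (auto simp: bij_betw_def)
  have \<iota>\<kappa>: "\<iota> (\<kappa> v) = v \<and> \<kappa> v \<in> space_R n" if "v \<in> space_R n" for v
  proof -
    have "v \<in> \<iota> ` space_R n" using bij_betw_imp_surj_on[OF bij] that by simp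
    then obtain u where "u \<in> space_R n" "v = \<iota> u" by blast
    then show ?thesis using \<kappa>(2) by simp
  qed
  \<comment> \<open>Tangent vectors at \<open>x\<close> are translated back to the identity and then
    returned to the Lie algebra.\<close>
  define Q where "Q x w = \<kappa> (differential n (\<lambda>y. inv\<^bsub>G\<^esub> x \<otimes>\<^bsub>G\<^esub> y) x w)" for x w
  have dsp: "differential n (\<lambda>y. x \<otimes>\<^bsub>G\<^esub> y) y v \<in> space_R n" if "x \<in> space_R n" "y \<in> space_R n" for x y v
    using differential_in_space_R[OF openin_space_R smooth_map_translation] that by blast
  have "parallelism n (space_R n) (\<lambda>x u. left_field n G (\<iota> u) x) Q b"
  proof (rule parallelism.intro)
    fix x assume x: "x \<in> space_R n"
    note ix = inv_in_space[OF x]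
    have [simp]: "inv\<^bsub>G\<^esub> x \<otimes>\<^bsub>G\<^esub> x = \<one>\<^bsub>G\<^esub>" "x \<otimes>\<^bsub>G\<^esub> inv\<^bsub>G\<^esub> x = \<one>\<^bsub>G\<^esub>" "x \<otimes>\<^bsub>G\<^esub> \<one>\<^bsub>G\<^esub> = x"
      using x l_inv r_inv r_one carrier_eq by auto
    show "linear (\<lambda>u. left_field n G (\<iota> u) x)"
      using linear_compose[OF lin linear_differential] by (simp add: left_field_def o_def)
    show "linear (Q x)"
      using linear_compose[OF linear_differential \<kappa>(1)] unfolding Q_def[abs_def] by (simp add: o_def)
    show "left_field n G (\<iota> (Q x w)) x = w" if w: "w \<in> space_R n" for w
      using differential_translation_compose[OF x ix x, of w] differential_translation_one[OF x w]
        \<iota>\<kappa>[OF dsp[OF ix x]] by (simp add: left_field_def Q_def)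
    show "Q x (left_field n G (\<iota> u) x) = u" if u: "u \<in> space_R n" for u
      using differential_translation_compose[OF ix x one_in_space, of "\<iota> u"]
        differential_translation_one[OF one_in_space \<iota>_sp[OF u]] \<kappa>(2)[OF u]
      by (simp add: left_field_def Q_def)
    show "lie_bracket n (\<lambda>y. left_field n G (\<iota> u) y) (\<lambda>y. left_field n G (\<iota> v) y) x = left_field n G (\<iota> (b u v)) x"
      if "u \<in> space_R n" "v \<in> space_R n" for u v
      using lie_bracket_left_field[OF x \<iota>_sp[OF that(1)] \<iota>_sp[OF that(2)]] br[OF that] by simp
  next
    show "smooth_map n (space_R n) n (\<lambda>x. left_field n G (\<iota> u) x)" if "u \<in> space_R n" for u
      using left_field_smooth[OF \<iota>_sp[OF that]] .
    fix V X assume V: "openin (Euclidean_space n) V" "V \<subseteq> space_R n" and X: "smooth_map n V n X"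
    let ?Y = "\<lambda>x. differential n (\<lambda>y. inv\<^bsub>G\<^esub> x \<otimes>\<^bsub>G\<^esub> y) x (X x)"
    have Y: "smooth_map n V n ?Y"
      by (rule smooth_map_translation_differential[OF V(1) smooth_map_subset[OF smooth_inv V(2)] smooth_map_id[OF V(1)] X])
    show "smooth_map n V n (\<lambda>x. Q x (X x))"
      unfolding smooth_map_def
    proof (intro conjI allI impI)
      show "(\<lambda>x. Q x (X x)) ` V \<subseteq> space_R n"
        using \<iota>\<kappa> smooth_map_in_space[OF Y] by (auto simp: Q_def)
      fix i
      have "smooth n V (\<lambda>x. \<Sum>k<n. ?Y x k * \<kappa> (coord_vec k) i)"
        by (intro smooth_sum[OF V(1)] smooth_mult[OF V(1)] smooth_const[OF V(1)] smooth_map_component[OF V(1) Y]) simp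
      then show "smooth n V (\<lambda>x. Q x (X x) i)"
      proof (rule smooth_cong[OF V(1), rotated])
        fix x assume "x \<in> V"
        from fun_cong[OF linear_expansion[OF \<kappa>(1) smooth_map_in_space[OF Y this]], of i]
        show "(\<Sum>k<n. ?Y x k * \<kappa> (coord_vec k) i) = Q x (X x) i"
          by (simp add: Q_def sum_pt_apply scaleR_pt_apply)
      qed
    qed
  qed (use b in \<open>auto simp: lie_algebra_def\<close>)
  then show ?thesis by blast
qed

section \<open>The Poincare lemma\<close>

lemma scaleR_in_space_R: "x \<in> space_R n \<Longrightarrow> c *\<^sub>R x \<in> space_R n"
  by (rule subspace_scale[OF subspace_space_R])

lemma continuous_on_scaled_argument:
  fixes g :: "pt \<Rightarrow> real" and h :: "'a::topological_space \<Rightarrow> real"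
  assumes g: "continuous_on (space_R n) g" and h: "continuous_on S h"
    and k: "\<And>i. continuous_on S (\<lambda>p. k p i)" "k ` S \<subseteq> space_R n"
  shows "continuous_on S (\<lambda>p. g (h p *\<^sub>R k p))"
proof (rule continuous_on_compose2[OF g])
  show "continuous_on S (\<lambda>p. h p *\<^sub>R k p)"
    by (rule continuous_on_coordinatewise_then_product) (unfold scaleR_pt_apply, intro continuous_on_mult h k(1))
qed (use k(2) scaleR_in_space_R in blast)

text \<open>The primitive is the integral of the form along the ray from the origin. Differentiation
  under the integral sign and closedness turn the integrand into the \<open>t\<close>-derivative of
  \<open>t * \<alpha> j (t *\<^sub>R x)\<close>, a function equal to \<open>\<alpha> j x\<close> at
  1 and to 0 at 0.\<close>

lemma poincare_lemma_space_R:
  assumes sm: "\<And>j. j < n \<Longrightarrow> smooth n (space_R n) (\<alpha> j)"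
    and closed: "\<And>i j x. i < n \<Longrightarrow> j < n \<Longrightarrow> x \<in> space_R n \<Longrightarrow> partial i (\<alpha> j) x = partial j (\<alpha> i) x"
  shows "\<exists>f. smooth n (space_R n) f \<and> (\<forall>x\<in>space_R n. \<forall>j<n. partial j f x = \<alpha> j x)"
proof -
  define f where "f x = integral (cbox 0 1) (\<lambda>t::real. \<Sum>i<n. \<alpha> i (t *\<^sub>R x) * x i)" for x :: pt
  note cont = smooth_continuous[OF sm]
  note cont_curve = continuous_on_scaled_argument
  have radial: "((\<lambda>t. \<alpha> j (t *\<^sub>R x)) has_real_derivative (\<Sum>k<n. partial k (\<alpha> j) (t *\<^sub>R x) * x k)) (at t)"
    if x: "x \<in> space_R n" and j: "j < n" for x j t
  proof (rule chain_rule_curve[OF openin_space_R smooth_has_partials[OF sm[OF j]]])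
    show "continuous_on (space_R n) (partial k (\<alpha> j))" if "k < n" for k
      by (rule smooth_continuous[OF smooth_partial[OF sm[OF j] that]])
    show "t *\<^sub>R x \<in> space_R n" by (rule scaleR_in_space_R[OF x])
    show "\<forall>\<^sub>F t in nhds t. t *\<^sub>R x \<in> space_R n"
      by (rule always_eventually, rule allI, rule scaleR_in_space_R[OF x])
    show "((\<lambda>t. (t *\<^sub>R x) i) has_real_derivative x i) (at t)" for i
      unfolding scaleR_pt_apply using DERIV_cmult_right[OF DERIV_ident, of "x i" t] by simp
  qed
  have f_deriv: "((\<lambda>s. f (x(j := s))) has_real_derivative \<alpha> j x) (at (x j))"
    if x: "x \<in> space_R n" and j: "j < n" for x j
  proof -
    let ?x = "\<lambda>s. x(j := s)"
    note xs = fun_upd_in_space_R[OF x j]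
    let ?\<phi> = "\<lambda>s t. \<Sum>i<n. \<alpha> i (t *\<^sub>R ?x s) * ?x s i"
    let ?\<psi> = "\<lambda>s t. \<Sum>i<n. partial j (\<alpha> i) (t *\<^sub>R ?x s) * t * ?x s i + \<alpha> i (t *\<^sub>R ?x s) * (if i = j then 1 else 0)"
    have xc: "continuous_on S (\<lambda>p. ?x (fst p) i)" for S :: "(real \<times> real) set" and i
      by (cases "i = j") (auto intro!: continuous_intros)
    have xr: "(\<lambda>p. ?x (fst p)) ` S \<subseteq> space_R n" for S :: "(real \<times> real) set" using xs by blast
    have "((\<lambda>s. integral (cbox 0 1) (?\<phi> s)) has_field_derivative integral (cbox 0 1) (?\<psi> (x j))) (at (x j) within UNIV)"
    proof (rule leibniz_rule_field_derivative)
      show "((\<lambda>s. ?\<phi> s t) has_field_derivative ?\<psi> s t) (at s within UNIV)" for s t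
      proof (rule DERIV_sum)
        fix i assume i: "i \<in> {..<n}"
        have "((\<lambda>s. \<alpha> i (t *\<^sub>R ?x s)) has_real_derivative
            (\<Sum>k<n. partial k (\<alpha> i) (t *\<^sub>R ?x s) * (if k = j then t else 0))) (at s)"
        proof (rule chain_rule_curve[OF openin_space_R smooth_has_partials[OF sm]])
          show "((\<lambda>s. (t *\<^sub>R ?x s) k) has_real_derivative (if k = j then t else 0)) (at s)" for k
            by (cases "k = j") (auto simp: scaleR_pt_apply intro!: derivative_eq_intros)
        qed (use i xs scaleR_in_space_R in \<open>auto intro!: smooth_continuous[OF smooth_partial[OF sm]]\<close>)
        also have "(\<Sum>k<n. partial k (\<alpha> i) (t *\<^sub>R ?x s) * (if k = j then t else 0)) = partial j (\<alpha> i) (t *\<^sub>R ?x s) * t"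
          using j by (simp add: if_distrib[of "\<lambda>c. _ * c"] cong: if_cong)
        finally have 1: "((\<lambda>s. \<alpha> i (t *\<^sub>R ?x s)) has_real_derivative partial j (\<alpha> i) (t *\<^sub>R ?x s) * t) (at s)" .
        have 2: "((\<lambda>s. ?x s i) has_real_derivative (if i = j then 1 else 0)) (at s)"
          by (cases "i = j") auto
        show "((\<lambda>s. \<alpha> i (t *\<^sub>R ?x s) * ?x s i) has_real_derivative
            partial j (\<alpha> i) (t *\<^sub>R ?x s) * t * ?x s i + \<alpha> i (t *\<^sub>R ?x s) * (if i = j then 1 else 0)) (at s)"
          using DERIV_mult[OF 1 2] by (simp add: algebra_simps)
      qed
      show "?\<phi> s integrable_on cbox 0 1" for s
        using cont_curve[OF cont, of _ "cbox 0 1" "\<lambda>t. t" "\<lambda>t. ?x s"] xs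
        by (intro integrable_continuous continuous_on_sum continuous_on_mult) (auto intro: continuous_intros)
      show "continuous_on (UNIV \<times> cbox 0 1) (\<lambda>(s, t). ?\<psi> s t)"
        unfolding case_prod_unfold
        by (intro continuous_on_sum continuous_on_add continuous_on_mult continuous_on_const xc
            cont_curve[OF cont] cont_curve[OF smooth_continuous[OF smooth_partial[OF sm j]]] xr continuous_intros)
          auto
    qed auto
    moreover have "(?\<psi> (x j) has_integral 1 * \<alpha> j (1 *\<^sub>R x) - 0 * \<alpha> j (0 *\<^sub>R x)) (cbox 0 1)"
      unfolding cbox_interval
    proof (rule fundamental_theorem_of_calculus)
      fix t :: real assume "t \<in> {0..1}"
      have "?\<psi> (x j) t = (\<Sum>k<n. t * (partial k (\<alpha> j) (t *\<^sub>R x) * x k)) + \<alpha> j (t *\<^sub>R x)"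
        using j closed[OF _ j scaleR_in_space_R[OF x]]
        by (simp add: sum.distrib if_distrib[of "\<lambda>c. _ * c"] mult_ac cong: if_cong)
      then have "((\<lambda>t. t * \<alpha> j (t *\<^sub>R x)) has_real_derivative ?\<psi> (x j) t) (at t)"
        using DERIV_mult[OF DERIV_ident radial[OF x j, of t]] by (simp add: sum_distrib_left algebra_simps)
      then show "((\<lambda>t. t * \<alpha> j (t *\<^sub>R x)) has_vector_derivative ?\<psi> (x j) t) (at t within {0..1})"
        by (simp add: has_real_derivative_iff_has_vector_derivative has_vector_derivative_at_within)
    qed simp
    ultimately show ?thesis by (simp add: f_def[abs_def] integral_unique)
  qed
  have "continuous_on (space_R n) f"
    unfolding f_def[abs_def]
  proof (rule integral_continuous_on_param)
    have fs: "continuous_on S (\<lambda>p. fst p i)" for S :: "(pt \<times> real) set" and i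
    proof -
      have "continuous_on S (fst :: pt \<times> real \<Rightarrow> pt)" by (rule continuous_on_fst[OF continuous_on_id])
      then show ?thesis by (rule continuous_on_product_then_coordinatewise)
    qed
    show "continuous_on (space_R n \<times> cbox 0 1) (\<lambda>(x, t). \<Sum>i<n. \<alpha> i (t *\<^sub>R x) * x i)"
      unfolding case_prod_unfold
    proof (rule continuous_on_sum)
      fix i assume "i \<in> {..<n}"
      then have i: "i < n" by simp
      have "continuous_on (space_R n \<times> cbox 0 1) (\<lambda>p. \<alpha> i (snd p *\<^sub>R fst p))"
      proof (rule cont_curve[where h = snd and k = fst])
        show "continuous_on (space_R n) (\<alpha> i)" by (rule cont[OF i])
        show "continuous_on (space_R n \<times> cbox (0::real) 1) snd" by (rule continuous_on_snd[OF continuous_on_id])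
        show "continuous_on (space_R n \<times> cbox (0::real) 1) (\<lambda>p. fst p i)" for i by (rule fs)
        show "fst ` (space_R n \<times> cbox (0::real) 1) \<subseteq> space_R n"
          by (rule image_subsetI) (simp only: mem_Times_iff)
      qed
      then show "continuous_on (space_R n \<times> cbox 0 1) (\<lambda>p. \<alpha> i (snd p *\<^sub>R fst p) * fst p i)"
        by (rule continuous_on_mult[OF _ fs])
    qed
  qed
  then have hp: "has_partials n (space_R n) f"
    using f_deriv by (auto simp: has_partials_def real_differentiable_def)
  have pf: "partial j f x = \<alpha> j x" if "x \<in> space_R n" "j < n" for x j
    by (rule partial_eqI) (rule f_deriv[OF that])
  have "smooth n (space_R n) f"
  \<comment> \<open>Only \<open>f\<close> is not yet known to be smooth. Its partials on
    \<open>space_R n\<close> are the smooth \<open>\<alpha> j\<close>, so adjoining \<open>f\<close>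
    to the smooth functions gives a closed class.\<close>
  proof (rule smooth_coinduct[OF openin_space_R, where P="\<lambda>g. g = f \<or> smooth n (space_R n) g"])
    fix g assume "g = f \<or> smooth n (space_R n) g"
    then show "has_partials n (space_R n) g \<and>
      (\<forall>j<n. \<exists>h. (h = f \<or> smooth n (space_R n) h) \<and> (\<forall>x\<in>space_R n. partial j g x = h x))"
    proof
      assume g: "g = f"
      have "\<exists>h. (h = f \<or> smooth n (space_R n) h) \<and> (\<forall>x\<in>space_R n. partial j g x = h x)" if "j < n" for j
        using pf[OF _ that] sm[OF that] unfolding g by (intro exI[of _ "\<alpha> j"]) simp
      then show ?thesis using hp unfolding g by blast
    next
      assume g: "smooth n (space_R n) g"
      have "\<exists>h. (h = f \<or> smooth n (space_R n) h) \<and> (\<forall>x\<in>space_R n. partial j g x = h x)" if "j < n" for j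
        using smooth_partial[OF g that] by (intro exI[of _ "partial j g"]) simp
      then show ?thesis using smooth_has_partials[OF g] by blast
    qed
  qed simp
  then show ?thesis using pf by blast
qed

lemma ddir_coord_vec: "i < n \<Longrightarrow> ddir n f x (coord_vec i) = partial i f x"
  by (simp add: ddir_def coord_vec_def if_distrib[of "\<lambda>c. _ * c"] cong: if_cong)

text \<open>\<open>\<phi> x u\<close> is a 1-form evaluated on the frame vector
  \<open>P x u\<close>. Hypothesis \<open>cl\<close> says, by Cartan's formula for the exterior
  derivative, that the form is closed on pairs of frame fields; the proof rewrites this in
  coordinates to reach the Poincare lemma.\<close>

lemma (in parallelism) integrate_form:
  assumes UR: "U = space_R n"
    and lin: "\<And>x. x \<in> space_R n \<Longrightarrow> linear (\<phi> x)"
    and sm: "\<And>u. u \<in> space_R n \<Longrightarrow> smooth n (space_R n) (\<lambda>x. \<phi> x u)"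
    and cl: "\<And>x u v. x \<in> space_R n \<Longrightarrow> u \<in> space_R n \<Longrightarrow> v \<in> space_R n \<Longrightarrow>
       ddir n (\<lambda>y. \<phi> y v) x (P x u) - ddir n (\<lambda>y. \<phi> y u) x (P x v) = \<phi> x (b u v)"
  shows "\<exists>f. smooth n (space_R n) f \<and> (\<forall>x\<in>space_R n. \<forall>u\<in>space_R n. ddir n f x (P x u) = \<phi> x u)"
proof -
  define \<alpha> where "\<alpha> j x = \<phi> x (Q x (coord_vec j))" for j x
  have lin\<phi>: "\<phi> x u = (\<Sum>k<n. u k * \<phi> x (coord_vec k))" if "x \<in> space_R n" "u \<in> space_R n" for x u
    using linear_expansion[OF lin that(2)] that(1) by simp
  have sm\<alpha>: "smooth n (space_R n) (\<alpha> j)" if j: "j < n" for j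
  proof -
    have Qj: "smooth_map n (space_R n) n (\<lambda>x. Q x (coord_vec j))"
      using smooth_Q[OF openin_space_R _ smooth_map_const[OF coord_vec_in_space_R[OF j] openin_space_R]] UR by simp
    have "smooth n (space_R n) (\<lambda>x. \<Sum>k<n. Q x (coord_vec j) k * \<phi> x (coord_vec k))"
      using sm coord_vec_in_space_R
      by (intro smooth_sum[OF openin_space_R] smooth_mult[OF openin_space_R] smooth_map_component[OF openin_space_R Qj]) auto
    then show ?thesis
      by (rule smooth_cong[OF openin_space_R, rotated])
        (use lin\<phi> smooth_map_in_space[OF Qj] in \<open>simp add: \<alpha>_def\<close>)
  qed
  have \<alpha>P: "(\<Sum>j<n. \<alpha> j x * P x u j) = \<phi> x u" if x: "x \<in> space_R n" and u: "u \<in> space_R n" for x u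
  proof -
    have lc: "linear (\<lambda>w. \<phi> x (Q x w))"
      using linear_compose[OF linear_Q lin] x UR by (simp add: o_def)
    show ?thesis
      using linear_expansion[OF lc P_in_space[OF _ u, of x]] Q_P[OF _ u, of x] x UR by (simp add: \<alpha>_def mult.commute)
  qed
  \<comment> \<open>When \<open>\<phi>\<close> is expanded in the coordinate coefficients
    \<open>\<alpha> j\<close>, the terms that differentiate \<open>P\<close> add up to
    \<open>\<phi> x (b u v)\<close> and cancel against the right-hand side of \<open>cl\<close>. As
    \<open>P x\<close> is onto, the remaining symmetry holds for all tangent vectors.\<close>
  have sym: "(\<Sum>j<n. ddir n (\<alpha> j) x w * z j) = (\<Sum>j<n. ddir n (\<alpha> j) x z * w j)"
    if x: "x \<in> space_R n" and w: "w \<in> space_R n" and z: "z \<in> space_R n" for x w z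
  proof -
    have xU: "x \<in> U" using x UR by simp
    obtain u where u: "u \<in> space_R n" "w = P x u" 
      using P_Q[OF xU w] Q_in_space[OF xU w] by metis
    obtain v where v: "v \<in> space_R n" "z = P x v"
      using P_Q[OF xU z] Q_in_space[OF xU z] by metis
    have exp: "ddir n (\<lambda>y. \<phi> y v) x w = (\<Sum>j<n. ddir n (\<alpha> j) x w * P x v j) + (\<Sum>j<n. \<alpha> j x * ddir n (\<lambda>y. P y v j) x w)"
      if v: "v \<in> space_R n" for v w
    proof -
      note hP = smooth_has_partials[OF smooth_map_component[OF open_U smooth_P[OF v], unfolded UR]]
      note ha = smooth_has_partials[OF sm\<alpha>]
      have "ddir n (\<lambda>y. \<phi> y v) x w = ddir n (\<lambda>y. \<Sum>j<n. \<alpha> j y * P y v j) x w"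
        by (rule ddir_cong[OF openin_space_R _ x]) (simp add: \<alpha>P v)
      also have "\<dots> = (\<Sum>j<n. ddir n (\<lambda>y. \<alpha> j y * P y v j) x w)"
        by (rule ddir_sum[OF _ _ x]) (auto intro!: has_partials_mult hP ha)
      also have "\<dots> = (\<Sum>j<n. ddir n (\<alpha> j) x w * P x v j + \<alpha> j x * ddir n (\<lambda>y. P y v j) x w)"
        by (intro sum.cong refl ddir_mult[OF ha hP x]) auto
      finally show ?thesis by (simp add: sum.distrib)
    qed
    have "\<phi> x (b u v) = (\<Sum>j<n. \<alpha> j x * lie_bracket n (\<lambda>y. P y u) (\<lambda>y. P y v) x j)"
      using \<alpha>P[OF x b_in_space[OF u(1) v(1)]] bracket_P[OF xU u(1) v(1)] by simp
    also have "\<dots> = (\<Sum>j<n. \<alpha> j x * ddir n (\<lambda>y. P y v j) x w) - (\<Sum>j<n. \<alpha> j x * ddir n (\<lambda>y. P y u j) x z)"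
      by (simp add: lie_bracket_apply u(2) v(2) right_diff_distrib sum_subtractf)
    finally show ?thesis
      using cl[OF x u(1) v(1)] exp[OF v(1), of w] exp[OF u(1), of z] by (simp add: u(2)[symmetric] v(2)[symmetric])
  qed
  have "partial i (\<alpha> j) x = partial j (\<alpha> i) x" if ij: "i < n" "j < n" and x: "x \<in> space_R n" for i j x
  proof -
    have pick: "(\<Sum>k<n. g k * coord_vec l k) = g l" if "l < n" for g :: "nat \<Rightarrow> real" and l
      using that by (simp add: coord_vec_def if_distrib[of "\<lambda>c. _ * c"] cong: if_cong)
    show ?thesis
      using sym[OF x coord_vec_in_space_R[OF ij(1)] coord_vec_in_space_R[OF ij(2)]]
      by (simp only: pick[OF ij(1)] pick[OF ij(2)] ddir_coord_vec[OF ij(1)] ddir_coord_vec[OF ij(2)])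
  qed
  from poincare_lemma_space_R[of n \<alpha>, OF sm\<alpha> this]
  obtain f where f: "smooth n (space_R n) f" "\<And>x j. x \<in> space_R n \<Longrightarrow> j < n \<Longrightarrow> partial j f x = \<alpha> j x" by blast
  have "ddir n f x (P x u) = \<phi> x u" if "x \<in> space_R n" "u \<in> space_R n" for x u
    using \<alpha>P[OF that] f(2)[OF that(1)] by (simp add: ddir_def)
  then show ?thesis using f(1) by blast
qed

section \<open>Graded algebras with growth (2, 1, 2, \<dots>)\<close>

lemma bilinear_in_subspace:
  assumes b: "bilinear b" and T: "subspace T" and u: "u \<in> span A" and v: "v \<in> span C"
    and AC: "\<And>a c. a \<in> A \<Longrightarrow> c \<in> C \<Longrightarrow> b a c \<in> T"
  shows "b u v \<in> T"
proof -
  have 1: "b a v \<in> T" if "a \<in> A" for a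
  proof -
    have "span C \<subseteq> b a -` T"
      by (rule span_minimal)
        (use AC that b linear_subspace_vimage[OF _ T, of "b a"] in \<open>auto simp: bilinear_def\<close>)
    then show ?thesis using v by blast
  qed
  have "span A \<subseteq> (\<lambda>u. b u v) -` T"
    by (rule span_minimal)
      (use 1 b linear_subspace_vimage[OF _ T, of "\<lambda>u. b u v"] in \<open>auto simp: bilinear_def\<close>)
  then show ?thesis using u by blast
qed

section \<open>The target algebra and an adapted basis of the given algebra\<close>

text \<open>
  The Carnot algebra of the Hilbert--Cartan distribution: degree \<open>-1\<close> is spanned by the coordinates
  \<open>0, 1\<close>, degree \<open>-2\<close> by \<open>2\<close> and degree \<open>-3\<close> by \<open>3, 4\<close>.
\<close>

definition hc_bracket :: "pt \<Rightarrow> pt \<Rightarrow> pt"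
  where "hc_bracket u v = (u 0 * v 1 - u 1 * v 0) *\<^sub>R coord_vec 2 + (u 0 * v 2 - u 2 * v 0) *\<^sub>R coord_vec 3
    + (u 1 * v 2 - u 2 * v 1) *\<^sub>R coord_vec 4"

lemma hc_bracket_apply:
  "hc_bracket u v i = (if i = 2 then u 0 * v 1 - u 1 * v 0 else if i = 3 then u 0 * v 2 - u 2 * v 0
    else if i = 4 then u 1 * v 2 - u 2 * v 1 else 0)"
  by (simp add: hc_bracket_def scaleR_pt_apply coord_vec_def)

lemma bilinear_hc_bracket: "bilinear hc_bracket"
  unfolding bilinear_def linear_iff fun_eq_iff plus_pt_apply scaleR_pt_apply hc_bracket_apply
  by (auto simp: scaleR_pt_apply algebra_simps)

text \<open>\<open>gen\<close> is complete non-holonomy read in the algebra, and the 5 in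
  \<open>dim3\<close> is the sum 2 + 1 + 2 of the prescribed growth.\<close>

locale growth_212_algebra =
  fixes n :: nat and b :: "pt \<Rightarrow> pt \<Rightarrow> pt" and g :: "nat \<Rightarrow> pt set" and a0 a1 :: pt
  assumes graded: "graded_nilpotent_lie_algebra n b g"
    and g1: "g 1 = span {a0, a1}"
    and dim3: "dim (alg_flag b (g 1) 3) = 5"
    and gen: "\<exists>s. alg_flag b (g 1) s = space_R n"
begin

lemma bil: "bilinear b" and b_self: "u \<in> space_R n \<Longrightarrow> b u u = 0"
  and g_subspace: "subspace (g i)" and g_subset: "g i \<subseteq> space_R n"
  and g_bracket: "u \<in> g i \<Longrightarrow> v \<in> g j \<Longrightarrow> b u v \<in> g (i + j)"
  using graded by (auto simp: graded_nilpotent_lie_algebra_def lie_algebra_def)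

lemma b_antisym:
  assumes "u \<in> space_R n" "v \<in> space_R n" shows "b v u = - b u v"
proof -
  have "b (u + v) (u + v) = 0" by (rule b_self[OF subspace_add[OF subspace_space_R assms]])
  then have "b v u + b u v = 0"
    by (simp only: bilinear_ladd[OF bil] bilinear_radd[OF bil] b_self[OF assms(1)] b_self[OF assms(2)] add_0_left add_0_right)
  then show ?thesis by (simp only: eq_neg_iff_add_eq_0)
qed

text \<open>The Hall basis of the free 3-step nilpotent Lie algebra on \<open>a0\<close> and
  \<open>a1\<close>, in the order of the coordinates used by \<open>hc_bracket\<close>. Only
  \<open>i < 5\<close> is meaningful.\<close>

definition e :: "nat \<Rightarrow> pt"
  where "e i = (if i = 0 then a0 else if i = 1 then a1 else if i = 2 then b a0 a1
    else if i = 3 then b a0 (b a0 a1) else b a1 (b a0 a1))"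

lemma e_simps: "e 0 = a0" "e 1 = a1" "e (Suc 0) = a1" "e 2 = b a0 a1" "e 3 = b a0 (b a0 a1)" "e 4 = b a1 (b a0 a1)"
  by (auto simp: e_def)

lemma lessThan_5: "{..<5} = {0, 1, 2, 3, 4::nat}" by auto

abbreviation E :: "pt set" where "E \<equiv> e ` {..<5}"

lemma E_eq: "E = {e 0, e 1, e 2, e 3, e 4}"
  unfolding lessThan_5 by simp

abbreviation deg :: "nat \<Rightarrow> nat" where "deg i \<equiv> (if i < 2 then 1 else if i = 2 then 2 else 3)"

lemma e_in_g: "i < 5 \<Longrightarrow> e i \<in> g (deg i)"
proof -
  have a: "a0 \<in> g 1" "a1 \<in> g 1" unfolding g1 by (auto intro: span_base)
  have a2: "b a0 a1 \<in> g 2" using g_bracket[OF a] by (simp only: one_add_one)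
  have "b a0 (b a0 a1) \<in> g (1 + 2)" "b a1 (b a0 a1) \<in> g (1 + 2)"
    by (rule g_bracket[OF _ a2], rule a)+
  moreover have "1 + 2 = (3::nat)" by simp
  ultimately have a3: "b a0 (b a0 a1) \<in> g 3" "b a1 (b a0 a1) \<in> g 3" by (simp_all only:)
  assume "i < 5"
  then have "i \<in> {0, 1, 2, 3, 4}" using lessThan_5 by blast
  then show ?thesis using a a2 a3 by (auto simp: e_simps)
qed

lemma e_in_space: "i < 5 \<Longrightarrow> e i \<in> space_R n"
  using e_in_g g_subset by blast

lemma e_bracket: "b (e 0) (e 1) = e 2" "b (e 1) (e 0) = - e 2" "b (e 0) (e 2) = e 3" "b (e 2) (e 0) = - e 3"
  "b (e 1) (e 2) = e 4" "b (e 2) (e 1) = - e 4" "i < 5 \<Longrightarrow> b (e i) (e i) = 0"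
proof -
  show "b (e 0) (e 1) = e 2" "b (e 0) (e 2) = e 3" "b (e 1) (e 2) = e 4" by (simp_all add: e_simps)
  with b_antisym[OF e_in_space e_in_space, of 0 1] b_antisym[OF e_in_space e_in_space, of 0 2]
    b_antisym[OF e_in_space e_in_space, of 1 2]
  show "b (e 1) (e 0) = - e 2" "b (e 2) (e 0) = - e 3" "b (e 2) (e 1) = - e 4" by simp_all
  show "i < 5 \<Longrightarrow> b (e i) (e i) = 0" by (rule b_self[OF e_in_space])
qed

lemma g1_span: "g 1 = span (e ` {..<2})"
proof -
  have "{..<2} = {0, 1::nat}" by auto
  then show ?thesis unfolding g1 by (simp add: e_simps)
qed

lemma alg_flag_2_subset: "alg_flag b (g 1) 2 \<subseteq> span (e ` {..<3})"
proof -
  have sub: "g 1 \<subseteq> span (e ` {..<3})" unfolding g1_span by (rule span_mono) auto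
  have "b u v \<in> span (e ` {..<3})" if "u \<in> g 1" "v \<in> g 1" for u v
  proof (rule bilinear_in_subspace[OF bil subspace_span])
    show "u \<in> span (e ` {..<2})" "v \<in> span (e ` {..<2})" using that g1_span by auto
    have e2: "e 2 \<in> span (e ` {..<3})" by (rule span_base) auto
    fix a c assume "a \<in> e ` {..<2}" "c \<in> e ` {..<2}"
    then obtain i j where "a = e i" "c = e j" "i < 2" "j < 2" by auto
    moreover from this have "i \<in> {0, 1}" "j \<in> {0, 1}" by auto
    ultimately show "b a c \<in> span (e ` {..<3})"
      using e2 e_bracket(1,2) e_bracket(7)[of 0] e_bracket(7)[of 1] span_neg[OF e2] span_zero[of "e ` {..<3}"] by auto
  qed
  then show ?thesis unfolding numeral_2_eq_2 alg_flag.simps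
    using sub by (intro span_minimal subspace_span) auto
qed

lemma alg_flag_3_subset: "alg_flag b (g 1) 3 \<subseteq> span E"
proof -
  have sub: "alg_flag b (g 1) 2 \<subseteq> span E"
    by (rule order_trans[OF alg_flag_2_subset span_mono]) auto
  have "b u v \<in> span E" if "u \<in> g 1" "v \<in> alg_flag b (g 1) 2" for u v
  proof (rule bilinear_in_subspace[OF bil subspace_span])
    show "u \<in> span (e ` {..<2})" using that g1_span by auto
    show "v \<in> span (e ` {..<3})" using that alg_flag_2_subset by auto
    have eE: "e i \<in> span E" if "i < 5" for i by (rule span_base) (use that in auto)
    fix a c assume "a \<in> e ` {..<2}" "c \<in> e ` {..<3}"
    then obtain i j where "a = e i" "c = e j" "i < 2" "j < 3" by auto
    moreover from this have "i \<in> {0, 1}" "j \<in> {0, 1, 2}" by auto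
    ultimately show "b a c \<in> span E"
      using eE[of 2] eE[of 3] eE[of 4] e_bracket(1-6) e_bracket(7)[of 0] e_bracket(7)[of 1] span_neg[OF eE[of 2]] span_zero[of E]
      by auto
  qed
  then show ?thesis
    unfolding numeral_3_eq_3 alg_flag.simps using sub unfolding numeral_2_eq_2 
    by (intro span_minimal subspace_span) auto
qed

text \<open>By \<open>alg_flag_3_subset\<close> a space of dimension 5 lies in the span of
  \<open>E\<close>. A basis chosen inside \<open>E\<close> therefore has at least five elements,
  while \<open>E\<close> has at most five.\<close>

lemma independent_E: "independent E" and inj_e: "inj_on e {..<5}"
proof -
  obtain B where B: "B \<subseteq> E" "independent B" "E \<subseteq> span B" "card B = dim E" by (rule basis_exists)
  have fB: "finite B" using B(1) by (rule finite_subset) simp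
  have "span E \<subseteq> span B" by (rule span_minimal[OF B(3) subspace_span])
  then have "dim (alg_flag b (g 1) 3) \<le> card B"
    using alg_flag_3_subset by (intro dim_le_card[OF _ fB]) blast
  then have "5 \<le> card B" using dim3 by simp
  moreover have cE: "card E \<le> 5" using card_image_le[of "{..<5::nat}" e] by simp
  ultimately have "B = E" using B(1) by (intro card_seteq) auto
  then have "card E = 5" and "independent E" using B(2) \<open>5 \<le> card B\<close> cE by auto
  then show "independent E" "inj_on e {..<5}" by (auto intro: eq_card_imp_inj_on)
qed

definition high :: "pt set" where "high = (\<Union>j\<in>{4..}. g j)"

text \<open>Bracketing with \<open>g 1\<close> raises the degree by one: it sends
  \<open>e 0\<close>, \<open>e 1\<close>, \<open>e 2\<close> into the span of \<open>E\<close>, and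
  everything homogeneous of degree at least 3 into \<open>high\<close>.\<close>

lemma flag_subset_span: "alg_flag b (g 1) i \<subseteq> span (E \<union> high)"
proof (induction i)
  case 0
  show ?case using span_zero by simp
next
  case (Suc i)
  have eS: "e j \<in> span (E \<union> high)" if "j < 5" for j by (rule span_base) (use that in auto)
  have gS: "v \<in> span (E \<union> high)" if "v \<in> g j" "j \<ge> 4" for v j
    by (rule span_base) (use that in \<open>auto simp: high_def\<close>)
  have g1S: "g 1 \<subseteq> span (E \<union> high)" unfolding g1_span by (rule span_mono) auto
  have br: "b u v \<in> span (E \<union> high)" if "u \<in> g 1" "v \<in> span (E \<union> high)" for u v
  proof (rule bilinear_in_subspace[OF bil subspace_span])
    show "u \<in> span (e ` {..<2})" using that g1_span by auto
    show "v \<in> span (E \<union> high)" by fact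
    fix a c assume "a \<in> e ` {..<2}" and c: "c \<in> E \<union> high"
    then obtain i where i: "a = e i" "i < 2" by auto
    then have a1: "a \<in> g 1" using e_in_g[of i] by auto
    show "b a c \<in> span (E \<union> high)"
    \<comment> \<open>The cut is at degree 3 and not at membership in \<open>E\<close>: brackets of
      generators with \<open>e 3\<close> and \<open>e 4\<close> already have degree 4 and are
      handled like those with \<open>high\<close>.\<close>
    proof (cases "c \<in> e ` {..<3}")
      case True
      then obtain j where "c = e j" "j < 3" by auto
      moreover from this i have "i \<in> {0, 1}" "j \<in> {0, 1, 2}" by auto
      ultimately show ?thesis
        using i eS[of 2] eS[of 3] eS[of 4] e_bracket(1-6) e_bracket(7)[of 0] e_bracket(7)[of 1]
          span_neg[OF eS[of 2]] span_zero[of "E \<union> high"]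
        by auto
    next
      case False
      obtain j where "c \<in> g j" "j \<ge> 3"
      proof (cases "c \<in> high")
        case True
        then obtain j where "j \<ge> 4" "c \<in> g j" by (auto simp: high_def)
        then show ?thesis by (intro that[of j]) auto
      next
        case F: False
        then obtain j where j: "c = e j" "j < 5" using c by auto
        then have "\<not> j < 3" using False by auto
        then show ?thesis using e_in_g[of j] j by (intro that[of 3]) auto
      qed
      then show ?thesis using g_bracket[OF a1, of c j] by (intro gS) auto
    qed
  qed
  show ?case
  proof (cases i)
    case (Suc k)
    have "{b u v |u v. u \<in> g 1 \<and> v \<in> alg_flag b (g 1) (Suc k)} \<union> alg_flag b (g 1) (Suc k) \<subseteq> span (E \<union> high)"
      using br Suc.IH unfolding Suc by blast
    then show ?thesis unfolding Suc alg_flag.simps by (rule span_minimal[OF _ subspace_span])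
  qed (use g1S in simp)
qed

lemma space_eq_span: "space_R n = span (E \<union> high)"
proof
  show "space_R n \<subseteq> span (E \<union> high)" using gen flag_subset_span by metis
  show "span (E \<union> high) \<subseteq> space_R n"
    by (rule span_minimal[OF _ subspace_space_R]) (use e_in_space g_subset in \<open>auto simp: high_def\<close>)
qed

text \<open>The span of \<open>E\<close> has components in degrees 1 to 3 and that of
  \<open>high\<close> in degrees from 4 on, so uniqueness of the homogeneous decomposition forces a
  common vector to vanish.\<close>

lemma span_E_high_disjoint:
  assumes "v \<in> span E" "v \<in> span high" shows "v = 0"
proof -
  from graded obtain s where s: "\<And>i. i > s \<Longrightarrow> g i = {0}"
    "\<And>v. v \<in> space_R n \<Longrightarrow> \<exists>!u. (\<forall>i. u i \<in> g i) \<and> v = (\<Sum>i\<le>s. u i)"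
  proof -
    have "\<exists>s. (\<forall>i>s. g i = {0}) \<and> (\<forall>v\<in>space_R n. \<exists>!u. (\<forall>i. u i \<in> g i) \<and> v = (\<Sum>i\<le>s. u i))"
      using graded unfolding graded_nilpotent_lie_algebra_def by (elim conjE)
    then obtain s where "(\<forall>i>s. g i = {0}) \<and> (\<forall>v\<in>space_R n. \<exists>!u. (\<forall>i. u i \<in> g i) \<and> v = (\<Sum>i\<le>s. u i))" ..
    then show thesis by (intro that[of s]) simp_all
  qed
  have g0: "0 \<in> g i" for i by (rule subspace_0[OF g_subspace])
  define K where "K = {\<Sum>i\<le>s. u i | u. (\<forall>i. u i \<in> g i) \<and> (\<forall>i<4. u i = 0)}"
  have "span high \<subseteq> K"
  proof (rule span_minimal)
    show "high \<subseteq> K"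
    proof
      fix v assume "v \<in> high"
      then obtain j where j: "j \<ge> 4" "v \<in> g j" by (auto simp: high_def)
      define u where "u i = (if i = j then v else 0)" for i
      have "v = (\<Sum>i\<le>s. u i)"
      proof (cases "j \<le> s")
        case True
        then show ?thesis by (simp add: u_def)
      next
        \<comment> \<open>Above \<open>s\<close> the homogeneous components are zero, so the sum up
          to \<open>s\<close>, which misses the index \<open>j\<close>, still equals
          \<open>v\<close>.\<close>
        case False
        then have "v = 0" using s(1)[of j] j by auto
        then show ?thesis by (simp add: u_def)
      qed
      moreover have "(\<forall>i. u i \<in> g i) \<and> (\<forall>i<4. u i = 0)" using j g0 by (auto simp: u_def)
      ultimately show "v \<in> K" unfolding K_def by blast
    qed
    show "subspace K"
      unfolding subspace_def
    proof (intro conjI ballI allI)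
      show "0 \<in> K" unfolding K_def by (rule CollectI, rule exI[of _ "\<lambda>i. 0"]) (use g0 in simp)
      fix x assume "x \<in> K"
      then obtain u where u: "x = (\<Sum>i\<le>s. u i)" "(\<forall>i. u i \<in> g i) \<and> (\<forall>i<4. u i = 0)" unfolding K_def by blast
      show "c *\<^sub>R x \<in> K" for c
        unfolding K_def
        by (rule CollectI, rule exI[of _ "\<lambda>i. c *\<^sub>R u i"])
          (use u subspace_scale[OF g_subspace] in \<open>simp add: scaleR_sum_right\<close>)
      fix y assume "y \<in> K"
      then obtain w where w: "y = (\<Sum>i\<le>s. w i)" "(\<forall>i. w i \<in> g i) \<and> (\<forall>i<4. w i = 0)" unfolding K_def by blast
      show "x + y \<in> K"
        unfolding K_def
        by (rule CollectI, rule exI[of _ "\<lambda>i. u i + w i"])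
          (use u w subspace_add[OF g_subspace] in \<open>simp add: sum.distrib\<close>)
    qed
  qed
  with assms(2) have "v \<in> K" by (rule subsetD[rotated])
  then obtain u where u: "v = (\<Sum>i\<le>s. u i)" "\<And>i. u i \<in> g i" "\<And>i. i < 4 \<Longrightarrow> u i = 0"
    unfolding K_def by (elim CollectE exE conjE) simp
  \<comment> \<open>A nonzero vector of degree 3 gives \<open>s \<ge> 3\<close>, so that the sum up
    to \<open>s\<close> contains all degrees occurring in \<open>E\<close>.\<close>
  have "e 3 \<noteq> 0"
  proof
    assume "e 3 = 0"
    moreover have "e 3 \<in> E" by auto
    ultimately show False using independent_E dependent_zero[of E] by simp
  qed
  then have s3: "s \<ge> 3" using s(1)[of 3] e_in_g[of 3] by (cases "s < 3") auto
  obtain c where c: "v = (\<Sum>x\<in>E. c x *\<^sub>R x)"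
    using assms(1) span_finite[of E] by auto
  define c' where "c' i = c (e i) *\<^sub>R e i" for i
  have vc: "v = c' 0 + c' 1 + c' 2 + c' 3 + c' 4"
  proof -
    have "v = (\<Sum>i<5. c' i)" unfolding c by (simp add: sum.reindex[OF inj_e] c'_def)
    also have "\<dots> = c' 0 + c' 1 + c' 2 + c' 3 + c' 4" by (simp add: lessThan_5 add.assoc)
    finally show ?thesis .
  qed
  \<comment> \<open>The same vector regrouped by degree, to be compared with the decomposition
    \<open>u\<close>, which has nothing below degree 4.\<close>
  define w where "w i = (if i = 1 then c' 0 + c' 1 else if i = 2 then c' 2 else if i = 3 then c' 3 + c' 4 else 0)" for i :: nat
  have c'g: "c' i \<in> g (deg i)" if "i < 5" for i
    unfolding c'_def by (rule subspace_scale[OF g_subspace e_in_g[OF that]])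
  have wg: "w i \<in> g i" for i
    using c'g[of 0] c'g[of 1] c'g[of 2] c'g[of 3] c'g[of 4] g0 subspace_add[OF g_subspace]
    by (auto simp: w_def)
  have "(\<Sum>i\<le>s. w i) = (\<Sum>i\<in>{1, 2, 3}. w i)"
    by (rule sum.mono_neutral_right) (use s3 in \<open>auto simp: w_def\<close>)
  also have "\<dots> = v" by (simp add: vc w_def add.assoc)
  finally have "v = (\<Sum>i\<le>s. w i)" by simp
  moreover have "v \<in> space_R n" using assms(1) space_eq_span span_mono[of E "E \<union> high"] by auto
  ultimately have "w = u" using s(2)[of v] u(1,2) wg by blast
  then have "w 1 = 0" "w 2 = 0" "w 3 = 0" using u(3) by auto
  then show ?thesis by (simp add: vc w_def add.assoc)
qed

text \<open>The vectors \<open>e k\<close> are added to \<open>B\<close> one at a time. If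
  \<open>e k\<close> were in the span of the earlier ones and \<open>B\<close>, its part in
  \<open>span B\<close> would also lie in \<open>span E\<close>, hence vanish by
  \<open>span_E_high_disjoint\<close>, against the independence of \<open>E\<close>.\<close>

lemma independent_E_Un:
  assumes B: "independent B" "span B = span high" and k: "k \<le> 5"
  shows "independent (e ` {..<k} \<union> B)"
  using k
proof (induction k)
  case 0
  then show ?case using B by simp
next
  case (Suc k)
  have "e k \<notin> span (e ` {..<k} \<union> B)"
  proof
    assume "e k \<in> span (e ` {..<k} \<union> B)"
    then obtain x y where xy: "e k = x + y" "x \<in> span (e ` {..<k})" "y \<in> span B" unfolding span_Un by blast
    have "e ` {..<k} \<subseteq> E" using Suc.prems by auto
    then have "x \<in> span E" using xy(2) span_mono by blast
    moreover have "e k \<in> span E" by (rule span_base) (use Suc.prems in auto)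
    ultimately have "e k - x \<in> span E" by (rule span_diff[rotated])
    then have "y \<in> span E" using xy(1) by simp
    then have "y = 0" using span_E_high_disjoint xy(3) B(2) by blast
    then have "e k \<in> span (e ` {..<k})" using xy by simp
    moreover have "e ` {..<k} \<subseteq> E - {e k}"
      using inj_onD[OF inj_e] Suc.prems by fastforce
    ultimately have "e k \<in> span (E - {e k})" using span_mono by blast
    then show False using independent_E Suc.prems unfolding dependent_def by auto
  qed
  moreover have "e ` {..<Suc k} \<union> B = insert (e k) (e ` {..<k} \<union> B)" by (auto simp: lessThan_Suc)
  ultimately show ?case using Suc by (simp add: independent_insert)
qed

lemma obtain_hom:
  obtains \<Theta> :: "pt \<Rightarrow> pt" where "linear \<Theta>" "\<And>i. i < 5 \<Longrightarrow> \<Theta> (e i) = coord_vec i" "\<And>v. v \<in> span high \<Longrightarrow> \<Theta> v = 0"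
proof -
  \<comment> \<open>\<open>high\<close> is a union of subspaces and not an independent set. Values
    can be prescribed freely only on \<open>E\<close> together with a basis taken from
    \<open>high\<close>.\<close>
  obtain B where B: "B \<subseteq> high" "independent B" "high \<subseteq> span B" by (rule basis_exists)
  have sB: "span B = span high" by (rule subset_antisym[OF span_mono[OF B(1)] span_minimal[OF B(3) subspace_span]])
  define f where "f x = (if x \<in> E then coord_vec (inv_into {..<5} e x) else 0)" for x
  obtain \<Theta> where T: "linear \<Theta>" "\<And>x. x \<in> E \<union> B \<Longrightarrow> \<Theta> x = f x"
    using linear_independent_extend[OF independent_E_Un[OF B(2) sB order_refl], of f] by blast
  have Te: "\<Theta> (e i) = coord_vec i" if "i < 5" for i
    using T(2)[of "e i"] that by (simp add: f_def inv_into_f_f[OF inj_e])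
  have TB: "\<Theta> x = 0" if x: "x \<in> B" for x
  proof -
    have "x \<notin> E"
    proof
      assume "x \<in> E"
      moreover have "x \<in> high" using x B(1) by (rule subsetD[rotated])
      ultimately have "x = 0" by (intro span_E_high_disjoint span_base)
      then show False using x B(2) dependent_zero by blast
    qed
    then show ?thesis using T(2)[of x] x by (simp add: f_def)
  qed
  have "\<Theta> v = 0" if "v \<in> span high" for v
    using linear_eq_0_on_span[OF T(1) TB] that sB by blast
  then show ?thesis using that T(1) Te by blast
qed

text \<open>\<open>\<Theta>\<close> kills all degrees from 4 on. By bilinearity, brackets are
  compared only on \<open>E\<close> and \<open>high\<close>: total degree at least 4 gives 0 on both
  sides, and the other pairs are settled by \<open>e_bracket\<close>. Injectivity on the second step
  is what later keeps the kernel of the differential of \<open>\<pi>\<close> away from the second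
  step of the weak flag.\<close>

lemma hom_to_hc:
  obtains \<Theta> :: "pt \<Rightarrow> pt" where "linear \<Theta>" "\<Theta> ` space_R n = space_R 5"
    "\<And>u v. u \<in> space_R n \<Longrightarrow> v \<in> space_R n \<Longrightarrow> \<Theta> (b u v) = hc_bracket (\<Theta> u) (\<Theta> v)"
    "\<Theta> ` g 1 = span {coord_vec 0, coord_vec 1}" "inj_on \<Theta> (alg_flag b (g 1) 2)"
proof -
  obtain \<Theta> :: "pt \<Rightarrow> pt" where T: "linear \<Theta>" "\<And>i. i < 5 \<Longrightarrow> \<Theta> (e i) = coord_vec i" "\<And>v. v \<in> span high \<Longrightarrow> \<Theta> v = 0"
    by (rule obtain_hom) blast
  have Thigh: "\<Theta> v = 0" if "v \<in> g j" "j \<ge> 4" for v j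
    by (rule T(3)[OF span_base]) (use that in \<open>auto simp: high_def\<close>)
  show ?thesis
  proof (rule that[OF T(1)])
    show "\<Theta> ` space_R n = space_R 5"
    proof
      have "E \<union> high \<subseteq> \<Theta> -` space_R 5"
        using T(2) coord_vec_in_space_R[of _ 5] T(3) span_base subspace_0[OF subspace_space_R] by fastforce
      then show "\<Theta> ` space_R n \<subseteq> space_R 5"
        unfolding space_eq_span
        using span_minimal[OF _ linear_subspace_vimage[OF T(1) subspace_space_R]] by blast
      show "space_R 5 \<subseteq> \<Theta> ` space_R n"
      proof
        fix w assume w: "w \<in> space_R 5"
        have "(\<Sum>k<5. w k *\<^sub>R e k) \<in> space_R n"
          by (intro subspace_sum[OF subspace_space_R] subspace_scale[OF subspace_space_R]) (simp add: e_in_space)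
        moreover have "\<Theta> (\<Sum>k<5. w k *\<^sub>R e k) = (\<Sum>k<5. w k *\<^sub>R coord_vec k)"
          unfolding linear_sum[OF T(1)] linear_scale[OF T(1)] by (intro sum.cong refl) (simp add: T(2))
        ultimately show "w \<in> \<Theta> ` space_R n" using coord_vec_expansion[OF w] by (intro image_eqI) simp_all
      qed
    qed
    show "\<Theta> (b u v) = hc_bracket (\<Theta> u) (\<Theta> v)" if "u \<in> space_R n" "v \<in> space_R n" for u v
    proof (rule bilinear_eq[OF _ _ _ _ that, where B = "E \<union> high" and C = "E \<union> high"])
      show "bilinear (\<lambda>u v. \<Theta> (b u v))"
        using bil linear_compose[OF _ T(1)] unfolding bilinear_def by (auto simp: o_def)
      show "bilinear (\<lambda>u v. hc_bracket (\<Theta> u) (\<Theta> v))"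
        using bilinear_hc_bracket linear_compose[OF T(1)] unfolding bilinear_def by (auto simp: o_def)
      fix x y assume x: "x \<in> E \<union> high" and y: "y \<in> E \<union> high"
      consider (ee) i j where "i < 5" "j < 5" "x = e i" "y = e j" "deg i + deg j < 4"
        | (hi) i j where "x \<in> g i" "y \<in> g j" "i + j \<ge> 4" "hc_bracket (\<Theta> x) (\<Theta> y) = 0"
      proof -
        have hc0: "hc_bracket (\<Theta> x) (\<Theta> y) = 0" if "\<Theta> x = 0 \<or> \<Theta> y = 0"
          using that bilinear_lzero[OF bilinear_hc_bracket] bilinear_rzero[OF bilinear_hc_bracket] by auto
        show thesis
        proof (cases "x \<in> high \<or> y \<in> high")
          case True
          obtain i where i: "x \<in> g i" using x e_in_g by (auto simp: high_def)
          obtain j where j: "y \<in> g j" using y e_in_g by (auto simp: high_def)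
          from True show ?thesis
          proof
            assume "x \<in> high"
            then obtain i where "x \<in> g i" "i \<ge> 4" by (auto simp: high_def)
            then show ?thesis using hi[of i j] j hc0 Thigh by auto
          next
            assume "y \<in> high"
            then obtain j where "y \<in> g j" "j \<ge> 4" by (auto simp: high_def)
            then show ?thesis using hi[of i j] i hc0 Thigh by auto
          qed
        next
          case False
          then obtain i j where ij: "i < 5" "j < 5" "x = e i" "y = e j" using x y by auto
          show ?thesis
          proof (cases "deg i + deg j < 4")
            case True
            then show ?thesis by (rule ee[OF ij])
          next
            case F: False
            have "hc_bracket (coord_vec i) (coord_vec j) = 0"
              using F by (auto simp: fun_eq_iff hc_bracket_apply coord_vec_def split: if_splits)
            then show ?thesis using hi[of "deg i" "deg j"] e_in_g ij F T(2) by auto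
          qed
        qed
      qed
      then show "\<Theta> (b x y) = hc_bracket (\<Theta> x) (\<Theta> y)"
      proof cases
        case ee
        have ij: "(i, j) \<in> {(0,0),(0,1),(1,0),(1,1),(0,2),(2,0),(1,2),(2,1)}"
          using ee(5) by (auto split: if_splits)
        have cv: "hc_bracket (coord_vec 0) (coord_vec 1) = coord_vec 2" "hc_bracket (coord_vec 1) (coord_vec 0) = - coord_vec 2"
          "hc_bracket (coord_vec 0) (coord_vec 2) = coord_vec 3" "hc_bracket (coord_vec 2) (coord_vec 0) = - coord_vec 3"
          "hc_bracket (coord_vec 1) (coord_vec 2) = coord_vec 4" "hc_bracket (coord_vec 2) (coord_vec 1) = - coord_vec 4"
          "hc_bracket (coord_vec k) (coord_vec k) = 0" for k
          by (auto simp: fun_eq_iff hc_bracket_apply coord_vec_def)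
        have Tn: "\<Theta> (- v) = - \<Theta> v" for v by (rule linear_neg[OF T(1)])
        show ?thesis
          unfolding ee(3,4) T(2)[OF ee(1)] T(2)[OF ee(2)]
          using ij e_bracket(1-6) e_bracket(7)[of 0] e_bracket(7)[of 1] T(2)[of 2] T(2)[of 3] T(2)[of 4] linear_0[OF T(1)] Tn cv
          by auto
      next
        case hi
        then show ?thesis using Thigh[OF g_bracket[OF hi(1,2)] hi(3)] by simp
      qed
    qed (simp_all add: space_eq_span)
    have "e ` {..<2} = {e 0, e 1}" by (auto simp: lessThan_Suc numeral_2_eq_2)
    then show "\<Theta> ` g 1 = span {coord_vec 0, coord_vec 1}"
      unfolding g1_span linear_span_image[OF T(1), symmetric] by (simp add: T(2))
    \<comment> \<open>An explicit left inverse of \<open>\<Theta>\<close> on \<open>span E\<close>,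
      which contains the second step.\<close>
    have "(\<Sum>k<5. \<Theta> v k *\<^sub>R e k) = v" if "v \<in> span E" for v
    proof (rule linear_eq_on[OF _ _ that])
      show "linear (\<lambda>v. \<Sum>k<5. \<Theta> v k *\<^sub>R e k)"
        by (rule linearI)
          (simp_all add: linear_add[OF T(1)] linear_scale[OF T(1)] scaleR_pt_apply scaleR_left_distrib sum.distrib scaleR_sum_right)
      show "linear (\<lambda>v::pt. v)" by (rule linear_id[unfolded id_def])
      fix x assume "x \<in> E"
      then obtain i where i: "i < 5" "x = e i" by auto
      have "(\<Sum>k<5. coord_vec i k *\<^sub>R e k) = (\<Sum>k<5. if k = i then e k else 0)"
        by (intro sum.cong) (auto simp: coord_vec_def)
      then show "(\<Sum>k<5. \<Theta> x k *\<^sub>R e k) = x" using i by (simp add: T(2))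
    qed
    moreover have "alg_flag b (g 1) 2 \<subseteq> span E" by (rule order_trans[OF alg_flag_2_subset span_mono]) auto
    ultimately show "inj_on \<Theta> (alg_flag b (g 1) 2)" by (intro inj_onI) (metis subsetD)
  qed
qed

end

section \<open>The Hilbert--Cartan frame and the extension\<close>

lemma dim_linear_image:
  fixes f :: "pt \<Rightarrow> pt"
  assumes f: "linear f" and S: "subspace S" and inj: "inj_on f S"
  shows "dim (f ` S) = dim S"
proof -
  obtain B where B: "B \<subseteq> S" "independent B" "S \<subseteq> span B" "card B = dim S" by (rule basis_exists)
  have sB: "span B = S" by (rule span_subspace[OF B(1,3) S])
  have "independent (f ` B)"
    by (rule linear_independent_injective_image[OF f B(2)]) (use inj sB in simp)
  moreover have "f ` S \<subseteq> span (f ` B)" unfolding linear_span_image[OF f] sB by simp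
  ultimately have "card (f ` B) = dim (f ` S)"
    using B(1) by (intro basis_card_eq_dim) auto
  moreover have "card (f ` B) = card B"
    by (rule card_image[OF inj_on_subset[OF inj B(1)]])
  ultimately show ?thesis using B(4) by simp
qed

lemma nontrivial_if_dim_pos:
  fixes S :: "pt set"
  assumes "dim S > 0" shows "S \<noteq> {0}"
proof
  assume "S = {0}"
  then have "dim S = dim (span ({} :: pt set))" by (simp only: span_empty)
  also have "\<dots> = card ({} :: pt set)" by (rule dim_eq_card) (simp_all add: span_span independent_empty)
  finally show False using assms by simp
qed

text \<open>Constancy of ranks is automatic for an invariant distribution: each step of its flag is
  the image of one fixed subspace under the injective \<open>P x\<close>.\<close>

lemma (in parallelism) parallel_distribution:
  assumes H: "H = span {a0, a1}" "a0 \<in> space_R n" "a1 \<in> space_R n" "dim H = 2"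
    and D: "\<And>x. x \<in> U \<Longrightarrow> D x = P x ` H"
    and s: "s \<ge> 1" "alg_flag b H s = space_R n"
  shows "distribution n 2 U D"
proof -
  have Hs: "subspace H" "H \<subseteq> space_R n" "H \<noteq> {0}"
    using H(2,3) span_minimal[OF _ subspace_space_R, of "{a0, a1}"] nontrivial_if_dim_pos[of H] H(4)
    unfolding H(1) by auto
  have flag: "weak_flag n U D i x = P x ` alg_flag b H i" if "x \<in> U" for i x
    by (rule weak_flag_parallel[OF Hs D that])
  have sub: "subspace (alg_flag b H i)" "alg_flag b H i \<subseteq> space_R n" for i
    by (rule alg_flag_subspace[OF Hs D], assumption, rule alg_flag_subset[OF Hs D])
  have dims: "dim (weak_flag n U D i x) = dim (alg_flag b H i)" if "x \<in> U" for i x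
    unfolding flag[OF that]
    by (rule dim_linear_image[OF linear_P[OF that] sub(1) inj_on_subset[OF inj_on_P[OF that] sub(2)]])
  have "subbundle n 2 U D"
    unfolding subbundle_def
  proof (intro ballI conjI)
    fix p assume p: "p \<in> U"
    show "dim (D p) = 2" using dims[OF p, of 1] H(4) by simp
    define X where "X i = (\<lambda>x. P x (if i = 0 then a0 else a1))" for i :: nat
    have "D x = span ((\<lambda>i. X i x) ` {..<2})" if "x \<in> U" for x
    proof -
      have "(\<lambda>i. X i x) ` {..<2} = P x ` {a0, a1}" by (auto simp: X_def numeral_2_eq_2 lessThan_Suc)
      then show ?thesis unfolding D[OF that] H(1) using linear_span_image[OF linear_P[OF that], of "{a0, a1}"] by (simp only:)
    qed
    moreover have "smooth_map n U n (X i)" for i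
      using smooth_P H(2,3) by (simp add: X_def)
    ultimately show "\<exists>V X. openin (Euclidean_space n) V \<and> p \<in> V \<and> V \<subseteq> U \<and>
          (\<forall>i<2::nat. smooth_map n V n (X i)) \<and> (\<forall>x\<in>V. D x = span ((\<lambda>i. X i x) ` {..<2}))"
      using open_U p by (intro exI[of _ U] exI[of _ X]) simp
  qed
  moreover have "\<forall>i. \<exists>r. \<forall>x\<in>U. dim (weak_flag n U D i x) = r" using dims by blast
  moreover have "\<forall>x\<in>U. weak_flag n U D s x = space_R n" using flag s(2) P_image_space by simp
  ultimately show ?thesis unfolding distribution_def using open_U s(1) by blast
qed

section \<open>An explicit frame on R^5\<close>

text \<open>
  The frame consists of the two generators \<open>X, Y\<close> of the Hilbert--Cartan distribution followed by \<open>[X, Y]\<close>,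
  \<open>[X, [X, Y]]\<close> and \<open>[Y, [X, Y]]\<close>.
\<close>

definition hc_frame :: "pt \<Rightarrow> pt \<Rightarrow> pt"
  where "hc_frame q u = (\<lambda>i. if i = 0 then u 0
    else if i = 1 then q 4 * q 4 * u 0 + -2 * q 4 * u 2 + -2 * u 4
    else if i = 2 then q 3 * u 0 + u 3 else if i = 3 then q 4 * u 0 + -1 * u 2 else if i = 4 then u 1 else 0)"

text \<open>The inverse of \<open>hc_frame q\<close>, found by solving for \<open>u 0\<close>,
  \<open>u 1\<close>, \<open>u 2\<close>, \<open>u 3\<close>, \<open>u 4\<close> in this order; the
  factor -1/2 comes from [Y, [X, Y]] = -2 d/dy. As in \<open>hc_frame\<close>, differences are
  written as sums with the factor -1, the shape to which the smoothness rules for sums and products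
  apply.\<close>

definition hc_coframe :: "pt \<Rightarrow> pt \<Rightarrow> pt"
  where "hc_coframe q w = (\<lambda>i. if i = 0 then w 0 else if i = 1 then w 4
    else if i = 2 then q 4 * w 0 + -1 * w 3 else if i = 3 then w 2 + -1 * q 3 * w 0
    else if i = 4 then (-1/2) * (q 4 * q 4 * w 0) + q 4 * w 3 + (-1/2) * w 1 else 0)"

lemma space_R5_cases:
  assumes "w \<in> space_R 5" "u \<in> space_R 5" "w 0 = u 0" "w 1 = u 1" "w 2 = u 2" "w 3 = u 3" "w 4 = u 4"
  shows "w = u"
proof
  fix i :: nat
  consider "i = 0" | "i = 1" | "i = 2" | "i = 3" | "i = 4" | "i \<ge> 5" by linarith
  then show "w i = u i" by cases (use assms in \<open>auto simp: space_R_iff\<close>)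
qed

lemma ddir_hc_frame:
  "ddir 5 (\<lambda>q. hc_frame q v i) x w = (if i = 1 then (2 * x 4 * v 0 - 2 * v 2) * w 4
    else if i = 2 then v 0 * w 3 else if i = 3 then v 0 * w 4 else 0)"
proof -
  have p1: "partial j (\<lambda>q. q 4 * q 4 * v 0 + -2 * q 4 * v 2 + -2 * v 4) x = (if j = 4 then 2 * x 4 * v 0 - 2 * v 2 else 0)" for j
    by (rule partial_eqI, cases "j = 4") (auto intro!: derivative_eq_intros)
  have p2: "partial j (\<lambda>q. q 3 * v 0 + v 3) x = (if j = 3 then v 0 else 0)" for j
    by (rule partial_eqI, cases "j = 3") (auto intro!: derivative_eq_intros)
  have p3: "partial j (\<lambda>q. q 4 * v 0 + -1 * v 2) x = (if j = 4 then v 0 else 0)" for j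
    by (rule partial_eqI, cases "j = 4") (auto intro!: derivative_eq_intros)
  have sum_if: "(\<Sum>j<5. (if j = k then c else 0) * w j) = c * w k" if "k < 5" for k :: nat and c :: real
    using that by (simp add: if_distrib[of "\<lambda>c. c * _"] cong: if_cong)
  consider "i = 0" | "i = 1" | "i = 2" | "i = 3" | "i = 4" | "i \<ge> 5" by linarith
  then show ?thesis
  proof cases
    case 2
    then have fr: "(\<lambda>q. hc_frame q v i) = (\<lambda>q. q 4 * q 4 * v 0 + -2 * q 4 * v 2 + -2 * v 4)"
      by (simp add: hc_frame_def)
    show ?thesis unfolding fr ddir_def p1 using sum_if[of 4 "2 * x 4 * v 0 - 2 * v 2"] 2 by simp
  next
    case 3
    then show ?thesis unfolding hc_frame_def ddir_def by (simp add: p2 sum_if)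
  next
    case 4
    then show ?thesis unfolding hc_frame_def ddir_def using p3 by (simp add: sum_if)
  qed (auto simp: hc_frame_def ddir_def)
qed

lemma linear_hc_frame: "linear (hc_frame q)"
  by (rule linearI) (auto simp: hc_frame_def fun_eq_iff scaleR_pt_apply algebra_simps)

lemma linear_hc_coframe: "linear (hc_coframe q)"
  by (rule linearI) (auto simp: hc_coframe_def fun_eq_iff scaleR_pt_apply algebra_simps)

lemma hc_frame_in_space: "hc_frame q u \<in> space_R 5" and hc_coframe_in_space: "hc_coframe q u \<in> space_R 5"
  by (auto simp: space_R_iff hc_frame_def hc_coframe_def)

lemma hc_parallelism: "parallelism 5 (space_R 5) hc_frame hc_coframe hc_bracket"
proof (rule parallelism.intro)
  show "smooth_map 5 (space_R 5) 5 (\<lambda>x. hc_frame x u)" for u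
    unfolding smooth_map_def
  proof (intro conjI allI impI)
    show "(\<lambda>x. hc_frame x u) ` space_R 5 \<subseteq> space_R 5" using hc_frame_in_space by blast
    fix i :: nat
    note rules = smooth_add[OF openin_space_R] smooth_mult[OF openin_space_R] smooth_const[OF openin_space_R] smooth_coord[OF openin_space_R]
    have sm: "smooth 5 (space_R 5) (\<lambda>q. q 4 * q 4 * u 0 + -2 * q 4 * u 2 + -2 * u 4)"
      "smooth 5 (space_R 5) (\<lambda>q. q 3 * u 0 + u 3)" "smooth 5 (space_R 5) (\<lambda>q. q 4 * u 0 + -1 * u 2)"
      by (intro rules)+
    assume "i < 5"
    then consider "i = 0" | "i = 1" | "i = 2" | "i = 3" | "i = 4" by linarith
    then show "smooth 5 (space_R 5) (\<lambda>x. hc_frame x u i)"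
      by cases (use sm in \<open>simp_all add: hc_frame_def smooth_const[OF openin_space_R]\<close>)
  qed
  show "smooth_map 5 V 5 (\<lambda>x. hc_coframe x (X x))"
    if V: "openin (Euclidean_space 5) V" and X: "smooth_map 5 V 5 X" for V X
    unfolding smooth_map_def
  proof (intro conjI allI impI)
    show "(\<lambda>x. hc_coframe x (X x)) ` V \<subseteq> space_R 5" using hc_coframe_in_space by blast
    fix i :: nat
    note rules = smooth_add[OF V] smooth_mult[OF V] smooth_const[OF V] smooth_coord[OF V] smooth_map_component[OF V X]
    have sm: "smooth 5 V (\<lambda>q. q 4 * X q 0 + -1 * X q 3)" "smooth 5 V (\<lambda>q. X q 2 + -1 * q 3 * X q 0)"
      "smooth 5 V (\<lambda>q. (-1/2) * (q 4 * q 4 * X q 0) + q 4 * X q 3 + (-1/2) * X q 1)"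
      by (intro rules)+
    assume "i < 5"
    then consider "i = 0" | "i = 1" | "i = 2" | "i = 3" | "i = 4" by linarith
    then show "smooth 5 V (\<lambda>x. hc_coframe x (X x) i)"
      by cases (use sm in \<open>simp_all add: hc_coframe_def smooth_map_component[OF V X]\<close>)
  qed
  show "hc_frame x (hc_coframe x w) = w" if "w \<in> space_R 5" for x w
    by (rule space_R5_cases[OF hc_frame_in_space that]) (auto simp: hc_frame_def hc_coframe_def field_simps)
  show "hc_coframe x (hc_frame x w) = w" if "w \<in> space_R 5" for x w
    by (rule space_R5_cases[OF hc_coframe_in_space that]) (auto simp: hc_frame_def hc_coframe_def field_simps)
  show "lie_bracket 5 (\<lambda>y. hc_frame y u) (\<lambda>y. hc_frame y v) x = hc_frame x (hc_bracket u v)" for x u v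
    by (rule ext, unfold lie_bracket_apply ddir_hc_frame)
      (auto simp: hc_frame_def hc_bracket_apply algebra_simps)
  show "hc_bracket u v \<in> space_R 5" for u v
    by (auto simp: space_R_iff hc_bracket_apply)
qed (use linear_hc_frame linear_hc_coframe bilinear_hc_bracket in auto)

lemma hilbert_cartan_eq_frame: "hilbert_cartan q = hc_frame q ` span {coord_vec 0, coord_vec 1}"
proof -
  have "hc_frame q (coord_vec 0) = coord_vec 0 + (q 4)\<^sup>2 *\<^sub>R coord_vec 1 + q 3 *\<^sub>R coord_vec 2 + q 4 *\<^sub>R coord_vec 3"
    by (auto simp: fun_eq_iff hc_frame_def coord_vec_def scaleR_pt_apply power2_eq_square)
  moreover have "hc_frame q (coord_vec 1) = coord_vec 4"
    by (auto simp: fun_eq_iff hc_frame_def coord_vec_def)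
  ultimately show ?thesis
    unfolding hilbert_cartan_def linear_span_image[OF linear_hc_frame, symmetric] by simp
qed

text \<open>Three steps of the algebraic flag suffice: the generators bracket to
  \<open>coord_vec 2\<close>, whose brackets with them are \<open>coord_vec 3\<close> and
  \<open>coord_vec 4\<close>. The base of an integrable extension has to satisfy the standing
  assumptions too.\<close>

lemma distribution_hilbert_cartan: "distribution 5 2 (space_R 5) hilbert_cartan"
proof -
  interpret parallelism 5 "space_R 5" hc_frame hc_coframe hc_bracket by (rule hc_parallelism)
  let ?H = "span {coord_vec 0, coord_vec 1}"
  have c: "coord_vec 0 \<in> space_R 5" "coord_vec 1 \<in> space_R 5" by (rule coord_vec_in_space_R, simp)+
  have "coord_vec 0 \<notin> span {coord_vec 1}"
  proof
    assume "coord_vec 0 \<in> span {coord_vec 1}"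
    then obtain k where "coord_vec 0 = k *\<^sub>R coord_vec 1" unfolding span_singleton by blast
    from fun_cong[OF this, of 0] show False by (simp add: coord_vec_def scaleR_pt_apply)
  qed
  moreover have "coord_vec 1 1 \<noteq> 0" "coord_vec 0 0 \<noteq> coord_vec 1 0" by (simp_all add: coord_vec_def)
  then have "coord_vec 1 \<noteq> 0" "coord_vec 0 \<noteq> coord_vec 1" by (metis zero_fun_apply, metis)
  ultimately have ind: "independent {coord_vec 0, coord_vec 1}" and card: "card {coord_vec 0, coord_vec 1} = 2"
    by (simp_all add: independent_insert)
  have dim: "dim ?H = 2" using dim_eq_card_independent[OF ind] card by simp
  have H: "subspace ?H" "?H \<subseteq> space_R 5" "?H \<noteq> {0}"
    using c span_minimal[OF _ subspace_space_R, of "{coord_vec 0, coord_vec 1}"]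
      nontrivial_if_dim_pos[of ?H] dim by auto
  note Hsub = alg_flag_subset[OF H hilbert_cartan_eq_frame]
  have h01: "coord_vec 0 \<in> ?H" "coord_vec 1 \<in> ?H" by (auto intro: span_base)
  have fl: "alg_flag hc_bracket ?H 2 = span ({hc_bracket u v | u v. u \<in> ?H \<and> v \<in> ?H} \<union> ?H)"
    "alg_flag hc_bracket ?H 3 = span ({hc_bracket u v | u v. u \<in> ?H \<and> v \<in> alg_flag hc_bracket ?H 2} \<union> alg_flag hc_bracket ?H 2)"
    by (simp_all add: numeral_2_eq_2 numeral_3_eq_3)
  have f1: "v \<in> alg_flag hc_bracket ?H 2" if "v \<in> ?H" for v unfolding fl by (rule span_base) (use that in blast)
  have f2: "v \<in> alg_flag hc_bracket ?H 3" if "v \<in> alg_flag hc_bracket ?H 2" for v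
    unfolding fl(2) by (rule span_base) (use that in blast)
  have cv: "hc_bracket (coord_vec 0) (coord_vec 1) = coord_vec 2" "hc_bracket (coord_vec 0) (coord_vec 2) = coord_vec 3"
    "hc_bracket (coord_vec 1) (coord_vec 2) = coord_vec 4"
    by (auto simp: fun_eq_iff hc_bracket_apply coord_vec_def)
  have c2: "coord_vec 2 \<in> alg_flag hc_bracket ?H 2"
    unfolding fl cv(1)[symmetric] by (rule span_base) (use h01 in blast)
  have "coord_vec 3 \<in> alg_flag hc_bracket ?H 3" "coord_vec 4 \<in> alg_flag hc_bracket ?H 3"
    unfolding fl(2) cv(2,3)[symmetric] using h01 c2 by (intro span_base; blast)+
  moreover have "{..<5} = {0, 1, 2, 3, 4::nat}" by auto
  ultimately have "coord_vec k \<in> alg_flag hc_bracket ?H 3" if "k < 5" for k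
    using that h01 f1 f2 c2 by (metis (no_types, lifting) insertE lessThan_iff singletonD)
  then have "(\<Sum>k<5. w k *\<^sub>R coord_vec k) \<in> alg_flag hc_bracket ?H 3" for w :: pt
    by (intro subspace_sum subspace_scale alg_flag_subspace[OF H hilbert_cartan_eq_frame]) simp
  then have "space_R 5 \<subseteq> alg_flag hc_bracket ?H 3"
    using coord_vec_expansion by (metis subsetI)
  then have "alg_flag hc_bracket ?H 3 = space_R 5" using Hsub by blast
  then show ?thesis
    using parallel_distribution[OF refl c dim hilbert_cartan_eq_frame, of 3] by simp
qed

text \<open>Closedness of the form \<open>h A + k B + C\<close>, whose linear forms
  \<open>A\<close>, \<open>B\<close>, \<open>C\<close> are constant in the frame, amounts to
  \<open>cl\<close>. Two variable coefficients are enough: the \<open>y\<close>-component needs the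
  most, with coefficient functions \<open>z_2^2\<close> and \<open>z_2\<close>.\<close>

lemma (in parallelism) integrate_affine_form:
  fixes A B C :: "pt \<Rightarrow> real"
  assumes UR: "U = space_R n" and lin: "linear A" "linear B" "linear C"
    and h: "smooth n (space_R n) h" and k: "smooth n (space_R n) k"
    and cl: "\<And>x u v. x \<in> space_R n \<Longrightarrow> u \<in> space_R n \<Longrightarrow> v \<in> space_R n \<Longrightarrow>
       ddir n h x (P x u) * A v + ddir n k x (P x u) * B v - (ddir n h x (P x v) * A u + ddir n k x (P x v) * B u)
        = h x * A (b u v) + k x * B (b u v) + C (b u v)"
  obtains f where "smooth n (space_R n) f"
    "\<And>x u. x \<in> space_R n \<Longrightarrow> u \<in> space_R n \<Longrightarrow> ddir n f x (P x u) = h x * A u + k x * B u + C u"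
proof -
  let ?\<phi> = "\<lambda>x u. h x * A u + k x * B u + C u"
  have dd: "ddir n (\<lambda>y. ?\<phi> y v) x w = ddir n h x w * A v + ddir n k x w * B v" if x: "x \<in> space_R n" for x v w
  proof -
    note hp = smooth_has_partials[OF h] and kp = smooth_has_partials[OF k]
    have "partial j (\<lambda>y. ?\<phi> y v) x = partial j h x * A v + partial j k x * B v" if j: "j < n" for j
      by (rule partial_eqI)
        (use has_partialsD[OF hp x j] has_partialsD[OF kp x j] in \<open>auto intro!: derivative_eq_intros\<close>)
    then show ?thesis
      by (simp add: ddir_def distrib_right sum.distrib sum_distrib_left sum_distrib_right algebra_simps)
  qed
  have "\<exists>f. smooth n (space_R n) f \<and> (\<forall>x\<in>space_R n. \<forall>u\<in>space_R n. ddir n f x (P x u) = ?\<phi> x u)"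
  proof (rule integrate_form[OF UR])
    show "linear (?\<phi> x)" for x
      by (rule linearI) (simp_all add: linear_add[OF lin(1)] linear_add[OF lin(2)] linear_add[OF lin(3)]
          linear_scale[OF lin(1)] linear_scale[OF lin(2)] linear_scale[OF lin(3)] algebra_simps)
    show "smooth n (space_R n) (\<lambda>x. ?\<phi> x u)" for u
      by (rule smooth_add[OF openin_space_R smooth_add[OF openin_space_R
          smooth_mult[OF openin_space_R h smooth_const[OF openin_space_R]]
          smooth_mult[OF openin_space_R k smooth_const[OF openin_space_R]]] smooth_const[OF openin_space_R]])
  qed (simp only: dd cl)
  then show ?thesis using that by blast
qed

text \<open>The components of the map are found in the order \<open>x, z\<^sub>2, z\<^sub>1, z, y\<close> as primitives of closed forms.\<close>

lemma (in parallelism) integrate_hom_to_hc: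
  assumes UR: "U = space_R n" and T: "linear \<Theta>"
    and hom: "\<And>u v. u \<in> space_R n \<Longrightarrow> v \<in> space_R n \<Longrightarrow> \<Theta> (b u v) = hc_bracket (\<Theta> u) (\<Theta> v)"
  obtains \<pi> where "smooth_map n (space_R n) 5 \<pi>"
    "\<And>x u. x \<in> space_R n \<Longrightarrow> u \<in> space_R n \<Longrightarrow> differential n \<pi> x (P x u) = hc_frame (\<pi> x) (\<Theta> u)"
proof -
  have lin: "linear (\<lambda>u. c * \<Theta> u i)" for c i
    by (rule linearI) (simp_all add: linear_add[OF T] linear_scale[OF T] scaleR_pt_apply algebra_simps)
  have lin1: "linear (\<lambda>u. \<Theta> u i)" and lin0: "linear (\<lambda>u::pt. 0::real)" for i
    using lin[of 1 i] lin[of 0 i] by simp_all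
  note c0 = smooth_const[OF openin_space_R, of n 0]
  note hb = hom hc_bracket_apply
  obtain f0 where f0: "smooth n (space_R n) f0"
    "\<And>x u. x \<in> space_R n \<Longrightarrow> u \<in> space_R n \<Longrightarrow> ddir n f0 x (P x u) = \<Theta> u 0"
    by (rule integrate_affine_form[OF UR lin0 lin0 lin1[of 0] c0 c0]) (simp_all add: hb)
  obtain f4 where f4: "smooth n (space_R n) f4"
    "\<And>x u. x \<in> space_R n \<Longrightarrow> u \<in> space_R n \<Longrightarrow> ddir n f4 x (P x u) = \<Theta> u 1"
    by (rule integrate_affine_form[OF UR lin0 lin0 lin1[of 1] c0 c0]) (simp_all add: hb)
  obtain f3 where f3: "smooth n (space_R n) f3"
    "\<And>x u. x \<in> space_R n \<Longrightarrow> u \<in> space_R n \<Longrightarrow> ddir n f3 x (P x u) = f4 x * \<Theta> u 0 + -1 * \<Theta> u 2"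
    by (rule integrate_affine_form[OF UR lin1[of 0] lin0 lin[of "-1" 2] f4(1) c0]) (simp_all add: hb f4(2) algebra_simps)
  obtain f2 where f2: "smooth n (space_R n) f2"
    "\<And>x u. x \<in> space_R n \<Longrightarrow> u \<in> space_R n \<Longrightarrow> ddir n f2 x (P x u) = f3 x * \<Theta> u 0 + \<Theta> u 3"
    by (rule integrate_affine_form[OF UR lin1[of 0] lin0 lin1[of 3] f3(1) c0]) (simp_all add: hb f3(2) algebra_simps)
  have sq: "smooth n (space_R n) (\<lambda>x. f4 x * f4 x)" by (rule smooth_mult[OF openin_space_R f4(1) f4(1)])
  have dsq: "ddir n (\<lambda>x. f4 x * f4 x) x (P x u) = 2 * f4 x * \<Theta> u 1" if "x \<in> space_R n" "u \<in> space_R n" for x u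
    using ddir_mult[OF smooth_has_partials[OF f4(1)] smooth_has_partials[OF f4(1)] that(1)] f4(2)[OF that] by simp
  \<comment> \<open>Closedness: the terms containing \<open>f4\<close> match -2 \<open>f4\<close>
    times component 2 of the bracket, the others match -2 times its component 4.\<close>
  obtain f1 where f1: "smooth n (space_R n) f1"
    "\<And>x u. x \<in> space_R n \<Longrightarrow> u \<in> space_R n \<Longrightarrow>
      ddir n f1 x (P x u) = f4 x * f4 x * \<Theta> u 0 + f4 x * (-2 * \<Theta> u 2) + -2 * \<Theta> u 4"
    by (rule integrate_affine_form[OF UR lin1[of 0] lin[of "-2" 2] lin[of "-2" 4] sq f4(1)])
      (simp_all add: hb f4(2) dsq algebra_simps)
  define \<pi> where "\<pi> x = (\<lambda>i::nat. if i = 0 then f0 x else if i = 1 then f1 x else if i = 2 then f2 x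
    else if i = 3 then f3 x else if i = 4 then f4 x else (0::real))" for x
  have \<pi>: "\<pi> x 0 = f0 x" "\<pi> x 1 = f1 x" "\<pi> x 2 = f2 x" "\<pi> x 3 = f3 x" "\<pi> x 4 = f4 x" for x
    by (auto simp: \<pi>_def)
  have sm: "smooth_map n (space_R n) 5 \<pi>"
    unfolding smooth_map_def
  proof (intro conjI allI impI)
    show "\<pi> ` space_R n \<subseteq> space_R 5" by (auto simp: space_R_iff \<pi>_def)
    fix i :: nat assume "i < 5"
    then consider "i = 0" | "i = 1" | "i = 2" | "i = 3" | "i = 4" by linarith
    then show "smooth n (space_R n) (\<lambda>x. \<pi> x i)"
      by cases (simp_all only: \<pi> f0(1) f1(1) f2(1) f3(1) f4(1))
  qed
  have "differential n \<pi> x (P x u) = hc_frame (\<pi> x) (\<Theta> u)" if x: "x \<in> space_R n" and u: "u \<in> space_R n" for x u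
  proof (rule space_R5_cases[OF differential_in_space_R[OF openin_space_R sm x] hc_frame_in_space])
    show "differential n \<pi> x (P x u) 0 = hc_frame (\<pi> x) (\<Theta> u) 0"
      "differential n \<pi> x (P x u) 1 = hc_frame (\<pi> x) (\<Theta> u) 1"
      "differential n \<pi> x (P x u) 2 = hc_frame (\<pi> x) (\<Theta> u) 2"
      "differential n \<pi> x (P x u) 3 = hc_frame (\<pi> x) (\<Theta> u) 3"
      "differential n \<pi> x (P x u) 4 = hc_frame (\<pi> x) (\<Theta> u) 4"
      unfolding differential_apply \<pi>
      using f0(2)[OF x u] f1(2)[OF x u] f2(2)[OF x u] f3(2)[OF x u] f4(2)[OF x u]
      by (simp_all add: hc_frame_def \<pi>_def)
  qed
  with sm show ?thesis by (rule that)
qed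

lemma (in parallelism) parallel_integrable_extension:
  assumes UR: "U = space_R n" and graded: "graded_nilpotent_lie_algebra n b g"
    and dim1: "dim (g 1) = 2" and dim3: "dim (alg_flag b (g 1) 3) = 5"
    and s: "s \<ge> 1" "alg_flag b (g 1) s = space_R n"
    and D: "\<And>x. x \<in> U \<Longrightarrow> D x = P x ` g 1"
  shows "\<exists>\<pi>. integrable_extension n U D 5 (space_R 5) hilbert_cartan \<pi>"
proof -
  have g: "subspace (g 1)" "g 1 \<subseteq> space_R n" using graded by (auto simp: graded_nilpotent_lie_algebra_def)
  obtain B where B: "B \<subseteq> g 1" "independent B" "g 1 \<subseteq> span B" "card B = dim (g 1)" by (rule basis_exists)
  then obtain a0 a1 where a: "B = {a0, a1}" using dim1 by (auto simp: card_2_iff)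
  have g1: "g 1 = span {a0, a1}" using span_subspace[OF B(1,3) g(1)] a by simp
  have g0: "g 1 \<noteq> {0}"
    by (rule nontrivial_if_dim_pos) (simp only: dim1 zero_less_numeral)
  interpret growth_212_algebra n b g a0 a1
    by (rule growth_212_algebra.intro[OF graded g1 dim3]) (use s in blast)
  obtain \<Theta> where T: "linear \<Theta>" "\<Theta> ` space_R n = space_R 5"
    "\<And>u v. u \<in> space_R n \<Longrightarrow> v \<in> space_R n \<Longrightarrow> \<Theta> (b u v) = hc_bracket (\<Theta> u) (\<Theta> v)"
    "\<Theta> ` g 1 = span {coord_vec 0, coord_vec 1}" "inj_on \<Theta> (alg_flag b (g 1) 2)"
    by (rule hom_to_hc) blast
  obtain \<pi> where \<pi>: "smooth_map n (space_R n) 5 \<pi>"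
    "\<And>x u. x \<in> space_R n \<Longrightarrow> u \<in> space_R n \<Longrightarrow> differential n \<pi> x (P x u) = hc_frame (\<pi> x) (\<Theta> u)"
    by (rule integrate_hom_to_hc[OF UR T(1,3)]) (assumption, assumption, rule that, assumption)
  interpret hc: parallelism 5 "space_R 5" hc_frame hc_coframe hc_bracket by (rule hc_parallelism)
  have W2: "subspace (alg_flag b (g 1) 2)" "alg_flag b (g 1) 2 \<subseteq> space_R n"
    by (rule alg_flag_subspace[OF g g0 D], assumption, rule alg_flag_subset[OF g g0 D])
  have g1W2: "g 1 \<subseteq> alg_flag b (g 1) 2"
    unfolding numeral_2_eq_2 alg_flag.simps One_nat_def by (rule subset_trans[OF Un_upper2 span_superset])
  \<comment> \<open>This serves twice: on \<open>g 1\<close> it gives the fibrewise isomorphism of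
    the distributions, and on the whole second step the trivial intersection with the
    kernel.\<close>
  have injP: "inj_on (\<lambda>w. differential n \<pi> x (P x w)) (alg_flag b (g 1) 2)" if x: "x \<in> space_R n" for x
  proof (rule inj_onI)
    fix v w assume v: "v \<in> alg_flag b (g 1) 2" and w: "w \<in> alg_flag b (g 1) 2"
      and eq: "differential n \<pi> x (P x v) = differential n \<pi> x (P x w)"
    have vw: "v \<in> space_R n" "w \<in> space_R n" using v w W2(2) by blast+
    have "hc_frame (\<pi> x) (\<Theta> v) = hc_frame (\<pi> x) (\<Theta> w)" using eq \<pi>(2)[OF x vw(1)] \<pi>(2)[OF x vw(2)] by simp
    moreover have "\<Theta> v \<in> space_R 5" "\<Theta> w \<in> space_R 5" using vw T(2) by blast+
    ultimately have "\<Theta> v = \<Theta> w"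
      using inj_onD[OF hc.inj_on_P[OF smooth_map_in_space[OF \<pi>(1) x]]] by blast
    then show "v = w" using inj_onD[OF T(5)] v w by blast
  qed
  have image: "(\<lambda>w. differential n \<pi> x (P x w)) ` W = hc_frame (\<pi> x) ` \<Theta> ` W"
    if x: "x \<in> space_R n" and W: "W \<subseteq> space_R n" for x W
    unfolding image_image by (rule image_cong[OF refl], rule \<pi>(2)[OF x]) (use W in blast)
  have "integrable_extension n U D 5 (space_R 5) hilbert_cartan \<pi>"
    unfolding integrable_extension_def submersion_def
  proof (intro conjI ballI exI)
    show "distribution n 2 U D"
      by (rule parallel_distribution[OF g1 _ _ dim1 D s]) (use B(1) a g(2) in auto)
    show "distribution 5 2 (space_R 5) hilbert_cartan" by (rule distribution_hilbert_cartan)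
    show "smooth_map n U 5 \<pi>" using \<pi>(1) UR by simp
    show "\<pi> ` U \<subseteq> space_R 5" using smooth_map_in_space[OF \<pi>(1)] UR by blast
    fix x assume xU: "x \<in> U"
    then have x: "x \<in> space_R n" using UR by simp
    have "differential n \<pi> x ` space_R n = differential n \<pi> x ` P x ` space_R n"
      using P_image_space[OF xU] by simp
    also have "\<dots> = hc_frame (\<pi> x) ` \<Theta> ` space_R n" using image[OF x subset_refl] by (simp only: image_image)
    also have "\<dots> = space_R 5"
      unfolding T(2) by (rule hc.P_image_space[OF smooth_map_in_space[OF \<pi>(1) x]])
    finally show "differential n \<pi> x ` space_R n = space_R 5" .
    show "bij_betw (differential n \<pi> x) (D x) (hilbert_cartan (\<pi> x))"
      unfolding bij_betw_def
    proof
      show "inj_on (differential n \<pi> x) (D x)"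
        unfolding D[OF xU]
        using inj_on_imageI[of "differential n \<pi> x" "P x" "g 1"] inj_on_subset[OF injP[OF x] g1W2]
        by (simp add: o_def)
      show "differential n \<pi> x ` D x = hilbert_cartan (\<pi> x)"
        unfolding D[OF xU] hilbert_cartan_eq_frame T(4)[symmetric]
        using image[OF x g(2)] by (simp only: image_image)
    qed
    show "weak_flag n U D 2 x \<inter> {v \<in> space_R n. differential n \<pi> x v = 0} = {0}"
    proof
      have P0: "P x 0 = 0" by (rule linear_0[OF linear_P[OF xU]])
      have d0: "differential n \<pi> x 0 = 0" by (rule linear_0[OF linear_differential])
      have z: "0 \<in> alg_flag b (g 1) 2" by (rule subspace_0[OF W2(1)])
      have flag: "weak_flag n U D 2 x = P x ` alg_flag b (g 1) 2" by (rule weak_flag_parallel[OF g g0 D xU])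
      show "{0} \<subseteq> weak_flag n U D 2 x \<inter> {v \<in> space_R n. differential n \<pi> x v = 0}"
        unfolding flag using imageI[OF z, of "P x"] P0 d0 subspace_0[OF subspace_space_R] by simp
      show "weak_flag n U D 2 x \<inter> {v \<in> space_R n. differential n \<pi> x v = 0} \<subseteq> {0}"
      proof
        fix v assume v: "v \<in> weak_flag n U D 2 x \<inter> {v \<in> space_R n. differential n \<pi> x v = 0}"
        then obtain w where w: "w \<in> alg_flag b (g 1) 2" "v = P x w" unfolding flag by blast
        have "differential n \<pi> x (P x w) = differential n \<pi> x (P x 0)" using v w(2) P0 d0 by simp
        then have "w = 0" using inj_onD[OF injP[OF x]] w(1) z by blast
        then show "v \<in> {0}" using w(2) P0 by simp
      qed
    qed
  qed
  then show ?thesis by blast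
qed

section \<open>From the given distribution to the group model\<close>

lemma distribution_subset_space:
  assumes "distribution n k U D" "x \<in> U" shows "subspace (D x)" "D x \<subseteq> space_R n"
proof -
  obtain V X where V: "openin (Euclidean_space n) V" "x \<in> V" "\<forall>i<k. smooth_map n V n (X i)"
    "\<forall>x\<in>V. D x = span ((\<lambda>i. X i x) ` {..<k})"
    using assms unfolding distribution_def subbundle_def by blast
  then have Dx: "D x = span ((\<lambda>i. X i x) ` {..<k})" by blast
  then show "subspace (D x)" by simp
  show "D x \<subseteq> space_R n"
    unfolding Dx by (rule span_minimal[OF _ subspace_space_R]) (use V smooth_map_in_space in blast)
qed

theorem theorem3:
  fixes n :: nat and U :: "pt set" and D :: dist
  assumes "distribution n 2 U D"
    and "flat n U D"
    and "\<And>x. x \<in> U \<Longrightarrow> growth n U D x 1 = 2 \<and> growth n U D x 2 = 1 \<and> growth n U D x 3 = 2"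
  shows "\<exists>n' U' D'. successive_extension n' U' D' \<and> locally_equivalent n U D n' U' D'"
proof (cases "U = {}")
  case True
  \<comment> \<open>Local equivalence is vacuous on the empty set, so the empty chain of extensions
    will do.\<close>
  then have "locally_equivalent n U D 5 (space_R 5) hilbert_cartan" by (simp add: locally_equivalent_def)
  then show ?thesis using successive_extension.base by blast
next
  case False
  \<comment> \<open>One point is enough: the dimensions found there pass to the algebra, and from
    the algebra by invariance to all of the group.\<close>
  then obtain p where p: "p \<in> U" by blast
  from assms(2) obtain b g G \<iota> where graded: "graded_nilpotent_lie_algebra n b g"
    and G: "lie_group n G" "lie_algebra_of_group n G b \<iota>"
    and le: "locally_equivalent n U D n (space_R n) (left_distribution n G (\<iota> ` g 1))"
    unfolding flat_def by blast
  let ?L = "left_distribution n G (\<iota> ` g 1)" and ?P = "\<lambda>x u. left_field n G (\<iota> u) x"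
  have g: "subspace (g 1)" "g 1 \<subseteq> space_R n" and lie: "lie_algebra n b"
    using graded by (auto simp: graded_nilpotent_lie_algebra_def)
  obtain Q where "parallelism n (space_R n) ?P Q b"
    using lie_group_parallelism[OF G(1) lie G(2)] by blast
  then interpret parallelism n "space_R n" ?P Q b .
  have L: "?L x = ?P x ` g 1" for x by (simp add: left_distribution_def image_image)
  obtain V V' F where V: "openin (Euclidean_space n) V" "p \<in> V" "V \<subseteq> U"
    and V': "openin (Euclidean_space n) V'" "V' \<subseteq> space_R n"
    and F: "diffeomorphism n V n V' F" and FD: "\<And>x. x \<in> V \<Longrightarrow> differential n F x ` D x = ?L (F x)"
  proof -
    from bspec[OF le[unfolded locally_equivalent_def] p]
    show thesis
    proof (elim exE conjE)
      fix V V' F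
      assume h: "openin (Euclidean_space n) V" "p \<in> V" "V \<subseteq> U" "openin (Euclidean_space n) V'"
        "V' \<subseteq> space_R n" "diffeomorphism n V n V' F" "\<forall>x\<in>V. differential n F x ` D x = ?L (F x)"
      show thesis by (rule that[OF h(1-6) bspec[OF h(7)]])
    qed
  qed
  from F obtain F' where F': "smooth_map n V n F" "smooth_map n V' n F'" "F ` V = V'" "F' ` V' = V"
    "\<And>x. x \<in> V \<Longrightarrow> F' (F x) = x" "\<And>y. y \<in> V' \<Longrightarrow> F (F' y) = y"
  proof -
    from F show thesis
      unfolding diffeomorphism_def
    proof (elim exE conjE)
      fix F'
      assume h: "smooth_map n V n F" "smooth_map n V' n F'" "F ` V = V'" "F' ` V' = V"
        "\<forall>x\<in>V. F' (F x) = x" "\<forall>y\<in>V'. F (F' y) = y"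
      show thesis by (rule that[OF h(1-4) bspec[OF h(5)] bspec[OF h(6)]])
    qed
  qed
  define q where "q = F p"
  have q: "q \<in> V'" "q \<in> space_R n" using F'(3) V(2) V'(2) by (auto simp: q_def)
  have Lsp: "?L y \<subseteq> space_R n" if "y \<in> V'" for y
    unfolding L using P_image_space[of y] image_mono[OF g(2), of "?P y"] that V'(2) by blast
  have Dsp: "D x \<subseteq> space_R n" if "x \<in> V" for x
    using distribution_subset_space(2)[OF assms(1)] that V(3) by blast
  note push = weak_flag_push[OF V(1) F'(1) V'(1) F'(2) equalityD1[OF F'(3)] equalityD1[OF F'(4)] F'(5,6) FD Dsp Lsp V(2), folded q_def]
  have push1: "weak_flag n (space_R n) ?L i q = differential n F p ` weak_flag n U D i p" for i
    using push(1)[of i] weak_flag_local[OF V'(1,2) q(1), of ?L i] weak_flag_local[OF V(1,3,2), of D i] by simp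
  have wfD: "subspace (weak_flag n U D i p)" "weak_flag n U D i p \<subseteq> space_R n" for i
    by (rule weak_flag_subspace[of D p, OF distribution_subset_space(1)[OF assms(1) p]],
        rule weak_flag_subset_space_R[of D p, OF distribution_subset_space(2)[OF assms(1) p]])
  have dim_push: "dim (weak_flag n (space_R n) ?L i q) = dim (weak_flag n U D i p)" for i
    unfolding push1 by (rule dim_linear_image[OF linear_differential wfD(1) inj_on_subset[OF push(2) wfD(2)]])
  have growth: "dim (weak_flag n U D 1 p) = 2" "dim (weak_flag n U D 3 p) = 5"
  proof -
    show d1: "dim (weak_flag n U D 1 p) = 2"
      using assms(1) p by (simp add: distribution_def subbundle_def)
    show "dim (weak_flag n U D 3 p) = 5"
    proof -
      \<comment> \<open>These are differences of natural numbers. Both are positive, so there is no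
        truncation, and the dimensions of the second and third step are 3 and 5.\<close>
      have "dim (weak_flag n U D 2 p) - 2 = 1" "dim (weak_flag n U D 3 p) - dim (weak_flag n U D 2 p) = 2"
        using assms(3)[OF p] d1 by (simp_all add: growth_def)
      then show ?thesis by arith
    qed
  qed
  have "dim (?P q ` g 1) = 2" using dim_push[of 1] growth(1) L[of q] by simp
  then have dim1: "dim (g 1) = 2"
    using dim_linear_image[OF linear_P[OF q(2)] g(1) inj_on_subset[OF inj_on_P[OF q(2)] g(2)]] by simp
  then have g0: "g 1 \<noteq> {0}" by (intro nontrivial_if_dim_pos) (simp only: zero_less_numeral)
  note flag = weak_flag_parallel[OF g g0 L]
  have W: "subspace (alg_flag b (g 1) i)" "alg_flag b (g 1) i \<subseteq> space_R n" for i
    by (rule alg_flag_subspace[OF g g0 L], rule alg_flag_subset[OF g g0 L])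
  have dim3: "dim (alg_flag b (g 1) 3) = 5"
    using dim_push[of 3] growth(2) flag[OF q(2), of 3]
      dim_linear_image[OF linear_P[OF q(2)] W(1) inj_on_subset[OF inj_on_P[OF q(2)] W(2)], of 3] by simp
  obtain s where s: "s \<ge> 1" "weak_flag n U D s p = space_R n"
    using assms(1) p unfolding distribution_def by blast
  \<comment> \<open>Complete non-holonomy of \<open>D\<close> at \<open>p\<close> is carried to the
    model at \<open>q\<close>; injectivity of the frame at \<open>q\<close> then removes
    \<open>?P q\<close> from both sides.\<close>
  have "?P q ` alg_flag b (g 1) s = ?P q ` space_R n"
    using push1[of s] flag[OF q(2), of s] push(3) s(2) P_image_space[OF q(2)] by simp
  then have "alg_flag b (g 1) s = space_R n"
    using inj_on_image_eq_iff[OF inj_on_P[OF q(2)] W(2) subset_refl] by simp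
  from parallel_integrable_extension[OF refl graded dim1 dim3 s(1) this L]
  obtain \<pi> where "integrable_extension n (space_R n) ?L 5 (space_R 5) hilbert_cartan \<pi>" by blast
  then have "successive_extension n (space_R n) ?L"
    by (rule successive_extension.step[OF successive_extension.base])
  \<comment> \<open>The extension lives on the whole group, and its local equivalence with the given
    distribution is the one provided by flatness.\<close>
  then show ?thesis using le by blast
qed

end
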